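(* Let $\mathbf{G}$ be a connected algebraic subgroup of $GL_d$ defined over $\mathbf{Q}$. Assume that $\mathbf{G}(\mathbf{Q})$ is generated by unipotent one-parameter subgroups. Let $a\in\mathbf{A}^d$ and $x=\varphi(a)\in X=\mathbf{A}^d/\mathbf{Q}^d$. Then there exists a $\mathbf{G}(\mathbf{Q})$-invariant linear subspace $V_0$ of $\mathbf{Q}^d$ such that the closure of the $\mathbf{G}(\mathbf{Q})$-orbit of $x$ in $X$ coincides with $x+\varphi(V_0(\mathbf{A}))$.
   Context: $\mathbf{A}=\mathbf{R}\times\prod_{p}(\mathbf{Q}_p,\mathbf{Z}_p)$ (restricted product over all primes $p$) is the adele ring of $\mathbf{Q}$, and $\mathbf{Q}$ is diagonally embedded in $\mathbf{A}$ as a discrete cocompact subring. $X=\mathbf{A}^d/\mathbf{Q}^d$ is a compact connected abelian group and $\varphi:\mathbf{A}^d\to X$ is the canonical projection. The group $GL_d(\mathbf{Q})$ acts diagonally and linearly on $\mathbf{A}^d$ preserving $\mathbf{Q}^d$, hence acts by automorphisms on $X$; $\mathbf{G}(\mathbf{Q})=\mathbf{G}\cap GL_d(\mathbf{Q})$ acts by restriction. For a linear subspace $V$ of $\mathbf{Q}^d$, let $V(\mathbf{Q}_p)$ and $V(\mathbf{R})$ be the linear spans of $V$ in $\mathbf{Q}_p^d$ and $\mathbf{R}^d$, let $V(\mathbf{Z})=V\cap\mathbf{Z}^d$, let $V(\mathbf{Z}_p)$ be the $\mathbf{Z}_p$-span of $V(\mathbf{Z})$ in $V(\mathbf{Q}_p)$,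 and $$V(\mathbf{A})=\bigcup_S\Big(\prod_{p\in S}V(\mathbf{Q}_p)\times\prod_{p\notin S}V(\mathbf{Z}_p)\Big)\subset\mathbf{A}^d,$$ where $S$ runs over finite sets of places containing $\infty$ (with $\mathbf{Q}_\infty=\mathbf{R}$). A unipotent one-parameter subgroup of $\mathbf{G}(\mathbf{Q})$ is a subgroup $\{u(t)\mid t\in\mathbf{Q}\}$ with $u:\mathbf{G}_a\to\mathbf{G}$ a nontrivial $\mathbf{Q}$-rational homomorphism from the additive group of dimension 1. *)

theory Defs
  imports
    "HOL-Analysis.Analysis"
    "HOL-Computational_Algebra.Computational_Algebra"
    "HOL-Algebra.QuotRing"
    "HOL-Algebra.Generated_Groups"
begin

section \<open>The field of \<open>p\<close>-adic numbers\<close>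

definition padic_abs :: "nat \<Rightarrow> rat \<Rightarrow> real" where
  "padic_abs p x =
     (if x = 0 then 0
      else let (a, b) = quotient_of x
           in real p powi (int (multiplicity (int p) b) - int (multiplicity (int p) a)))"

lemma padic_abs_0 [simp]: "padic_abs p 0 = 0"
  by (simp add: padic_abs_def)

lemma padic_abs_nonneg [simp]: "padic_abs p x \<ge> 0"
  by (simp add: padic_abs_def case_prod_unfold Let_def)

lemma padic_abs_divide:
  assumes p: "prime p" and b: "b \<noteq> 0" and a: "a \<noteq> 0"
  shows "padic_abs p (of_int a / of_int b) =
    real p powi (int (multiplicity (int p) b) - int (multiplicity (int p) a))"
proof -
  obtain c d where cd: "quotient_of (of_int a / of_int b) = (c, d)" by fastforce
  have d: "d > 0" using cd by (rule quotient_of_denom_pos)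
  have eq: "(of_int a / of_int b :: rat) = of_int c / of_int d" using cd by (rule quotient_of_div)
  hence "(of_int (a * d) :: rat) = of_int (c * b)"
    using b d by (simp add: field_simps)
  hence ad: "a * d = c * b" by (simp only: of_int_eq_iff)
  have c: "c \<noteq> 0" using ad a d by auto
  have pe: "prime_elem (int p)" using p by simp
  have "multiplicity (int p) a + multiplicity (int p) d = multiplicity (int p) c + multiplicity (int p) b"
    using arg_cong[OF ad, of "multiplicity (int p)"] a b c d pe
    by (simp add: prime_elem_multiplicity_mult_distrib)
  hence "int (multiplicity (int p) d) - int (multiplicity (int p) c)
      = int (multiplicity (int p) b) - int (multiplicity (int p) a)" by linarith
  moreover have "(of_int a / of_int b :: rat) \<noteq> 0" using a b by simp
  ultimately show ?thesis using cd by (simp add: padic_abs_def)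
qed

lemma rat_as_fraction: obtains a b :: int where "b > 0" "x = (of_int a / of_int b :: rat)"
  by (metis quotient_of_denom_pos' quotient_of_div surjective_pairing)

lemma padic_abs_mult:
  assumes p: "prime p" shows "padic_abs p (x * y) = padic_abs p x * padic_abs p y"
proof (cases "x = 0 \<or> y = 0")
  case False
  obtain a b where ab: "b > 0" "x = of_int a / of_int b" by (rule rat_as_fraction)
  obtain c d where cd: "d > 0" "y = of_int c / of_int d" by (rule rat_as_fraction)
  have nz: "a \<noteq> 0" "c \<noteq> 0" "b \<noteq> 0" "d \<noteq> 0" using False ab cd by auto
  have pe: "prime_elem (int p)" using p by simp
  have p0: "real p \<noteq> 0" using p by (simp add: prime_gt_0_nat)
  have "x * y = of_int (a * c) / of_int (b * d)" using ab cd by simp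
  hence "padic_abs p (x * y) = real p powi (int (multiplicity (int p) (b * d)) - int (multiplicity (int p) (a * c)))"
    using padic_abs_divide[OF p, of "b * d" "a * c"] nz by simp
  also have "\<dots> = real p powi ((int (multiplicity (int p) b) - int (multiplicity (int p) a))
      + (int (multiplicity (int p) d) - int (multiplicity (int p) c)))"
    using nz pe by (simp add: prime_elem_multiplicity_mult_distrib algebra_simps)
  also have "\<dots> = padic_abs p x * padic_abs p y"
    unfolding ab cd using nz p p0 by (simp add: padic_abs_divide power_int_add)
  finally show ?thesis .
qed auto

lemma padic_abs_pos: "prime p \<Longrightarrow> x \<noteq> 0 \<Longrightarrow> padic_abs p x > 0"
  by (simp add: padic_abs_def case_prod_unfold Let_def prime_gt_0_nat)

lemma padic_abs_1 [simp]: "padic_abs p 1 = 1"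
  by (simp add: padic_abs_def)

lemma padic_abs_minus:
  assumes p: "prime p" shows "padic_abs p (- x) = padic_abs p x"
proof -
  have "padic_abs p (of_int (-1) / of_int 1) = 1"
    by (subst padic_abs_divide[OF p]) (auto simp: multiplicity_unit_right)
  hence "padic_abs p (-1) = 1" by simp
  thus ?thesis using padic_abs_mult[OF p, of "-1" x] by simp
qed

lemma padic_abs_add:
  assumes p: "prime p" shows "padic_abs p (x + y) \<le> max (padic_abs p x) (padic_abs p y)"
proof (cases "x = 0 \<or> y = 0 \<or> x + y = 0")
  case False
  obtain a b where ab: "b > 0" "x = of_int a / of_int b" by (rule rat_as_fraction)
  obtain c d where cd: "d > 0" "y = of_int c / of_int d" by (rule rat_as_fraction)
  define A C D where "A = a * d" and "C = c * b" and "D = b * d"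
  have D: "D \<noteq> 0" using ab cd by (simp add: D_def)
  have x: "x = of_int A / of_int D" and y: "y = of_int C / of_int D"
    using ab cd by (auto simp: A_def C_def D_def)
  have xy: "x + y = of_int (A + C) / of_int D" using D by (simp add: x y add_divide_distrib)
  have nz: "A \<noteq> 0" "C \<noteq> 0" "A + C \<noteq> 0" using False x y xy by auto
  let ?m = "multiplicity (int p)"
  have p1: "real p \<ge> 1" using prime_ge_1_nat[OF p] by simp
  have nu: "\<not> is_unit (int p)" using p by auto
  have "?m (A + C) \<ge> min (?m A) (?m C)"
  proof (rule multiplicity_geI)
    show "int p ^ min (?m A) (?m C) dvd A + C"
      by (intro dvd_add) (auto intro: multiplicity_dvd')
  qed (use nz nu in auto)
  hence le: "?m (A + C) \<ge> ?m A \<or> ?m (A + C) \<ge> ?m C" by linarith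
  have "padic_abs p (x + y) = real p powi (int (?m D) - int (?m (A + C)))"
    unfolding xy using D nz p by (rule_tac padic_abs_divide) auto
  moreover have "padic_abs p x = real p powi (int (?m D) - int (?m A))"
    unfolding x using D nz p by (rule_tac padic_abs_divide) auto
  moreover have "padic_abs p y = real p powi (int (?m D) - int (?m C))"
    unfolding y using D nz p by (rule_tac padic_abs_divide) auto
  moreover have "real p powi (int (?m D) - int (?m (A + C))) \<le> real p powi (int (?m D) - int (?m A))
    \<or> real p powi (int (?m D) - int (?m (A + C))) \<le> real p powi (int (?m D) - int (?m C))"
    using le
  proof
    assume "?m A \<le> ?m (A + C)"
    thus ?thesis by (intro disjI1 power_int_increasing p1) simp
  next
    assume "?m C \<le> ?m (A + C)"
    thus ?thesis by (intro disjI2 power_int_increasing p1) simp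
  qed
  ultimately show ?thesis by (auto simp: le_max_iff_disj)
qed (auto simp: le_max_iff_disj)

lemma padic_abs_triangle: "prime p \<Longrightarrow> padic_abs p (x + y) \<le> padic_abs p x + padic_abs p y"
  using padic_abs_add[of p x y] padic_abs_nonneg[of p x] padic_abs_nonneg[of p y] by linarith

lemma padic_abs_diff_commute: "prime p \<Longrightarrow> padic_abs p (x - y) = padic_abs p (y - x)"
  using padic_abs_minus[of p "x - y"] by simp

lemma padic_abs_diff_abs:
  assumes p: "prime p" shows "\<bar>padic_abs p x - padic_abs p y\<bar> \<le> padic_abs p (x - y)"
  using padic_abs_triangle[OF p, of "x - y" y] padic_abs_triangle[OF p, of "y - x" x]
    padic_abs_diff_commute[OF p, of x y] by simp

definition padic_Cauchy :: "nat \<Rightarrow> (nat \<Rightarrow> rat) \<Rightarrow> bool" where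
  "padic_Cauchy p s \<longleftrightarrow> (\<forall>e>0. \<exists>N. \<forall>m\<ge>N. \<forall>n\<ge>N. padic_abs p (s m - s n) < e)"

definition padic_null :: "nat \<Rightarrow> (nat \<Rightarrow> rat) \<Rightarrow> bool" where
  "padic_null p s \<longleftrightarrow> (\<lambda>n. padic_abs p (s n)) \<longlonglongrightarrow> 0"

definition padic_Cauchy_ring :: "nat \<Rightarrow> (nat \<Rightarrow> rat) ring" where
  "padic_Cauchy_ring p =
    \<lparr>carrier = {s. padic_Cauchy p s}, mult = (\<lambda>s t n. s n * t n), one = (\<lambda>_. 1),
     zero = (\<lambda>_. 0), add = (\<lambda>s t n. s n + t n)\<rparr>"

type_synonym padic = "(nat \<Rightarrow> rat) set"

text \<open>
  \<open>Qp p\<close> is the completion of the rationals with respect to the \<open>p\<close>-adic absolute value: Cauchy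
  sequences modulo null sequences.  It is a ring record since its carrier depends on \<open>p\<close>.
\<close>

definition Qp :: "nat \<Rightarrow> padic ring" where
  "Qp p = padic_Cauchy_ring p Quot {s. padic_null p s}"

definition padic_of_rat :: "nat \<Rightarrow> rat \<Rightarrow> padic" where
  "padic_of_rat p q = {s. padic_null p s} +>\<^bsub>padic_Cauchy_ring p\<^esub> (\<lambda>_. q)"

definition padic_norm :: "nat \<Rightarrow> padic \<Rightarrow> real" where
  "padic_norm p x = (THE r. \<forall>s\<in>x. (\<lambda>n. padic_abs p (s n)) \<longlonglongrightarrow> r)"

definition Zp :: "nat \<Rightarrow> padic set" where
  "Zp p = {x \<in> carrier (Qp p). padic_norm p x \<le> 1}"

text \<open>The value 0 outside the carrier only serves to make this an instance of \<^locale>\<open>Metric_space\<close>.\<close>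

definition padic_dist :: "nat \<Rightarrow> padic \<Rightarrow> padic \<Rightarrow> real" where
  "padic_dist p x y =
    (if x \<in> carrier (Qp p) \<and> y \<in> carrier (Qp p) then padic_norm p (x \<ominus>\<^bsub>Qp p\<^esub> y) else 0)"

definition padic_topology :: "nat \<Rightarrow> padic topology" where
  "padic_topology p = Metric_space.mtopology (carrier (Qp p)) (padic_dist p)"

lemma padic_Cauchy_add:
  assumes p: "prime p" and s: "padic_Cauchy p s" and t: "padic_Cauchy p t"
  shows "padic_Cauchy p (\<lambda>n. s n + t n)"
  unfolding padic_Cauchy_def
proof (intro allI impI)
  fix e :: real assume e: "e > 0"
  obtain M where M: "\<forall>m\<ge>M. \<forall>n\<ge>M. padic_abs p (s m - s n) < e" using s e unfolding padic_Cauchy_def by blast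
  obtain N where N: "\<forall>m\<ge>N. \<forall>n\<ge>N. padic_abs p (t m - t n) < e" using t e unfolding padic_Cauchy_def by blast
  show "\<exists>K. \<forall>m\<ge>K. \<forall>n\<ge>K. padic_abs p (s m + t m - (s n + t n)) < e"
  proof (intro exI[of _ "max M N"] allI impI)
    fix m n assume "m \<ge> max M N" "n \<ge> max M N"
    moreover have "padic_abs p (s m + t m - (s n + t n)) \<le> max (padic_abs p (s m - s n)) (padic_abs p (t m - t n))"
      using padic_abs_add[OF p, of "s m - s n" "t m - t n"] by (simp add: algebra_simps)
    ultimately show "padic_abs p (s m + t m - (s n + t n)) < e"
      using M N by (meson max.bounded_iff max_less_iff_conj le_less_trans)
  qed
qed

lemma padic_Cauchy_minus:
  assumes p: "prime p" and s: "padic_Cauchy p s"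
  shows "padic_Cauchy p (\<lambda>n. - s n)"
proof -
  have "padic_abs p (- s m - - s n) = padic_abs p (s m - s n)" for m n
    using padic_abs_minus[OF p, of "s m - s n"] by simp
  thus ?thesis using s by (simp add: padic_Cauchy_def)
qed

lemma padic_Cauchy_const [simp]: "padic_Cauchy p (\<lambda>_. q)"
  by (simp add: padic_Cauchy_def)

lemma padic_Cauchy_convergent:
  assumes p: "prime p" and s: "padic_Cauchy p s"
  shows "convergent (\<lambda>n. padic_abs p (s n))"
proof -
  have "Cauchy (\<lambda>n. padic_abs p (s n))"
    unfolding Cauchy_def dist_real_def
  proof (intro allI impI)
    fix e :: real assume "e > 0"
    then obtain M where "\<forall>m\<ge>M. \<forall>n\<ge>M. padic_abs p (s m - s n) < e" using s unfolding padic_Cauchy_def by blast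
    thus "\<exists>M. \<forall>m\<ge>M. \<forall>n\<ge>M. \<bar>padic_abs p (s m) - padic_abs p (s n)\<bar> < e"
      using padic_abs_diff_abs[OF p] by (meson le_less_trans)
  qed
  thus ?thesis by (rule Cauchy_convergent)
qed

lemma padic_Cauchy_bounded:
  assumes p: "prime p" and s: "padic_Cauchy p s"
  obtains B where "B > 0" "\<And>n. padic_abs p (s n) \<le> B"
proof -
  have "Bseq (\<lambda>n. padic_abs p (s n))"
    using padic_Cauchy_convergent[OF assms] by (rule convergent_imp_Bseq)
  thus thesis using that unfolding Bseq_def by auto
qed

lemma padic_Cauchy_mult:
  assumes p: "prime p" and s: "padic_Cauchy p s" and t: "padic_Cauchy p t"
  shows "padic_Cauchy p (\<lambda>n. s n * t n)"
  unfolding padic_Cauchy_def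
proof (intro allI impI)
  fix e :: real assume e: "e > 0"
  obtain B where B: "B > 0" "\<And>n. padic_abs p (s n) \<le> B" using padic_Cauchy_bounded[OF p s] by blast
  obtain C where C: "C > 0" "\<And>n. padic_abs p (t n) \<le> C" using padic_Cauchy_bounded[OF p t] by blast
  obtain M where M: "\<forall>m\<ge>M. \<forall>n\<ge>M. padic_abs p (s m - s n) < e / C"
    using s e C unfolding padic_Cauchy_def by (meson divide_pos_pos)
  obtain N where N: "\<forall>m\<ge>N. \<forall>n\<ge>N. padic_abs p (t m - t n) < e / B"
    using t e B unfolding padic_Cauchy_def by (meson divide_pos_pos)
  show "\<exists>K. \<forall>m\<ge>K. \<forall>n\<ge>K. padic_abs p (s m * t m - s n * t n) < e"
  proof (intro exI[of _ "max M N"] allI impI)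
    fix m n assume mn: "m \<ge> max M N" "n \<ge> max M N"
    have "padic_abs p (s m * t m - s n * t n)
      \<le> max (padic_abs p ((s m - s n) * t m)) (padic_abs p (s n * (t m - t n)))"
      using padic_abs_add[OF p, of "(s m - s n) * t m" "s n * (t m - t n)"] by (simp add: algebra_simps)
    moreover have "padic_abs p ((s m - s n) * t m) < e"
    proof -
      have "padic_abs p ((s m - s n) * t m) \<le> padic_abs p (s m - s n) * C"
        using C by (simp add: padic_abs_mult[OF p] mult_left_mono)
      also have "\<dots> < e" using M mn C by (simp add: pos_less_divide_eq)
      finally show ?thesis .
    qed
    moreover have "padic_abs p (s n * (t m - t n)) < e"
    proof -
      have "padic_abs p (s n * (t m - t n)) \<le> padic_abs p (t m - t n) * B"
        using mult_right_mono[OF B(2)[of n] padic_abs_nonneg[of p "t m - t n"]]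
        by (simp add: padic_abs_mult[OF p] mult.commute)
      also have "\<dots> < e" using N mn B by (simp add: pos_less_divide_eq)
      finally show ?thesis .
    qed
    ultimately show "padic_abs p (s m * t m - s n * t n) < e" by linarith
  qed
qed

lemma padic_null_add:
  assumes p: "prime p" and s: "padic_null p s" and t: "padic_null p t"
  shows "padic_null p (\<lambda>n. s n + t n)"
proof -
  have "(\<lambda>n. padic_abs p (s n) + padic_abs p (t n)) \<longlonglongrightarrow> 0"
    using s t unfolding padic_null_def by (rule tendsto_add_zero)
  thus ?thesis unfolding padic_null_def
    by (rule tendsto_0_le[where K = 1]) (auto simp: padic_abs_triangle[OF p])
qed

lemma padic_null_minus: "prime p \<Longrightarrow> padic_null p s \<Longrightarrow> padic_null p (\<lambda>n. - s n)"
  by (simp add: padic_null_def padic_abs_minus)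

lemma padic_null_imp_Cauchy:
  assumes p: "prime p" and s: "padic_null p s" shows "padic_Cauchy p s"
  unfolding padic_Cauchy_def
proof (intro allI impI)
  fix e :: real assume "e > 0"
  then obtain N where N: "\<forall>n\<ge>N. padic_abs p (s n) < e"
    using s unfolding padic_null_def LIMSEQ_def by (auto simp: dist_real_def)
  show "\<exists>N. \<forall>m\<ge>N. \<forall>n\<ge>N. padic_abs p (s m - s n) < e"
  proof (intro exI[of _ N] allI impI)
    fix m n assume "m \<ge> N" "n \<ge> N"
    moreover have "padic_abs p (s m - s n) \<le> max (padic_abs p (s m)) (padic_abs p (s n))"
      using padic_abs_add[OF p, of "s m" "- s n"] by (simp add: padic_abs_minus[OF p])
    ultimately show "padic_abs p (s m - s n) < e" using N by (meson max_less_iff_conj le_less_trans)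
  qed
qed

lemma padic_null_mult:
  assumes p: "prime p" and s: "padic_null p s" and t: "padic_Cauchy p t"
  shows "padic_null p (\<lambda>n. s n * t n)"
proof -
  obtain C where C: "C > 0" "\<And>n. padic_abs p (t n) \<le> C" using padic_Cauchy_bounded[OF p t] by blast
  show ?thesis using s unfolding padic_null_def
    by (rule tendsto_0_le[where K = C]) (auto simp: padic_abs_mult[OF p] C mult_left_mono)
qed

lemma padic_Cauchy_ring_cring:
  assumes p: "prime p" shows "cring (padic_Cauchy_ring p)"
proof (rule cringI)
  show "abelian_group (padic_Cauchy_ring p)"
  proof (rule abelian_groupI)
    fix x assume "x \<in> carrier (padic_Cauchy_ring p)"
    thus "\<exists>y\<in>carrier (padic_Cauchy_ring p). y \<oplus>\<^bsub>padic_Cauchy_ring p\<^esub> x = \<zero>\<^bsub>padic_Cauchy_ring p\<^esub>"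
      using padic_Cauchy_minus[OF p] by (intro bexI[of _ "\<lambda>n. - x n"]) (auto simp: padic_Cauchy_ring_def)
  qed (auto simp: padic_Cauchy_ring_def padic_Cauchy_add[OF p] algebra_simps)
  show "Group.comm_monoid (padic_Cauchy_ring p)"
    by (rule comm_monoidI) (auto simp: padic_Cauchy_ring_def padic_Cauchy_mult[OF p] algebra_simps)
qed (auto simp: padic_Cauchy_ring_def algebra_simps)

lemma a_inv_padic_Cauchy_ring:
  assumes p: "prime p" and s: "padic_Cauchy p s"
  shows "\<ominus>\<^bsub>padic_Cauchy_ring p\<^esub> s = (\<lambda>n. - s n)"
proof -
  interpret cring "padic_Cauchy_ring p" by (rule padic_Cauchy_ring_cring[OF p])
  have "(\<lambda>n. - s n) \<oplus>\<^bsub>padic_Cauchy_ring p\<^esub> s = \<zero>\<^bsub>padic_Cauchy_ring p\<^esub>"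
    by (simp add: padic_Cauchy_ring_def)
  thus ?thesis using padic_Cauchy_minus[OF p s] s
    by (intro minus_equality) (auto simp: padic_Cauchy_ring_def)
qed

lemma padic_null_ideal:
  assumes p: "prime p" shows "ideal {s. padic_null p s} (padic_Cauchy_ring p)"
proof (rule idealI)
  interpret cring "padic_Cauchy_ring p" by (rule padic_Cauchy_ring_cring[OF p])
  show "ring (padic_Cauchy_ring p)" by (rule ring_axioms)
  show "subgroup {s. padic_null p s} (add_monoid (padic_Cauchy_ring p))"
  proof (rule add.subgroupI)
    show "{s. padic_null p s} \<noteq> {}" by (auto simp: padic_null_def intro!: exI[of _ "\<lambda>_. 0"])
    show "{s. padic_null p s} \<subseteq> carrier (padic_Cauchy_ring p)"
      by (auto simp: padic_Cauchy_ring_def padic_null_imp_Cauchy[OF p])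
    fix a b assume "a \<in> {s. padic_null p s}" "b \<in> {s. padic_null p s}"
    thus "a \<oplus>\<^bsub>padic_Cauchy_ring p\<^esub> b \<in> {s. padic_null p s}"
      by (auto simp: padic_Cauchy_ring_def padic_null_add[OF p])
  next
    fix a assume "a \<in> {s. padic_null p s}"
    thus "\<ominus>\<^bsub>padic_Cauchy_ring p\<^esub> a \<in> {s. padic_null p s}"
      by (simp add: a_inv_padic_Cauchy_ring[OF p] padic_null_imp_Cauchy[OF p] padic_null_minus[OF p])
  qed
next
  fix a x assume "a \<in> {s. padic_null p s}" "x \<in> carrier (padic_Cauchy_ring p)"
  thus "x \<otimes>\<^bsub>padic_Cauchy_ring p\<^esub> a \<in> {s. padic_null p s}" "a \<otimes>\<^bsub>padic_Cauchy_ring p\<^esub> x \<in> {s. padic_null p s}"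
    using padic_null_mult[OF p, of a x] by (auto simp: padic_Cauchy_ring_def mult.commute)
qed

lemma Qp_cring: "prime p \<Longrightarrow> cring (Qp p)"
  unfolding Qp_def by (rule ideal.quotient_is_cring[OF padic_null_ideal padic_Cauchy_ring_cring])

definition padic_class :: "nat \<Rightarrow> (nat \<Rightarrow> rat) \<Rightarrow> padic" where
  "padic_class p s = {s. padic_null p s} +>\<^bsub>padic_Cauchy_ring p\<^esub> s"

lemma padic_of_rat_eq_class: "padic_of_rat p q = padic_class p (\<lambda>_. q)"
  by (simp add: padic_of_rat_def padic_class_def)

lemma mem_padic_class: "t \<in> padic_class p s \<longleftrightarrow> padic_null p (\<lambda>n. t n - s n)"
proof
  assume "padic_null p (\<lambda>n. t n - s n)"
  moreover have "t = (\<lambda>n. (t n - s n) + s n)" by simp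
  ultimately show "t \<in> padic_class p s"
    unfolding padic_class_def a_r_coset_def r_coset_def padic_Cauchy_ring_def by fastforce
qed (auto simp: padic_class_def a_r_coset_def r_coset_def padic_Cauchy_ring_def)

lemma carrier_Qp: "carrier (Qp p) = padic_class p ` {s. padic_Cauchy p s}"
  by (auto simp: Qp_def FactRing_def A_RCOSETS_def RCOSETS_def a_r_coset_def padic_class_def padic_Cauchy_ring_def)

lemma Qp_ops:
  assumes p: "prime p"
  shows "\<zero>\<^bsub>Qp p\<^esub> = padic_class p (\<lambda>_. 0)" "\<one>\<^bsub>Qp p\<^esub> = padic_class p (\<lambda>_. 1)"
    and "padic_Cauchy p s \<Longrightarrow> padic_Cauchy p t \<Longrightarrow>
           padic_class p s \<oplus>\<^bsub>Qp p\<^esub> padic_class p t = padic_class p (\<lambda>n. s n + t n)"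
    and "padic_Cauchy p s \<Longrightarrow> padic_Cauchy p t \<Longrightarrow>
           padic_class p s \<otimes>\<^bsub>Qp p\<^esub> padic_class p t = padic_class p (\<lambda>n. s n * t n)"
proof -
  interpret ideal "{s. padic_null p s}" "padic_Cauchy_ring p" by (rule padic_null_ideal[OF p])
  show "\<zero>\<^bsub>Qp p\<^esub> = padic_class p (\<lambda>_. 0)"
    by (auto simp: mem_padic_class Qp_def FactRing_def)
  show "\<one>\<^bsub>Qp p\<^esub> = padic_class p (\<lambda>_. 1)"
    by (simp add: padic_class_def Qp_def FactRing_def, simp add: padic_Cauchy_ring_def)
  show "padic_class p s \<oplus>\<^bsub>Qp p\<^esub> padic_class p t = padic_class p (\<lambda>n. s n + t n)"
    if "padic_Cauchy p s" "padic_Cauchy p t"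
    using a_rcos_sum[of s t] that
    by (simp add: padic_class_def Qp_def FactRing_def, simp add: padic_Cauchy_ring_def)
  show "padic_class p s \<otimes>\<^bsub>Qp p\<^esub> padic_class p t = padic_class p (\<lambda>n. s n * t n)"
    if "padic_Cauchy p s" "padic_Cauchy p t"
    using rcoset_mult_add[of s t] that
    unfolding padic_class_def Qp_def FactRing_def by (simp add: padic_Cauchy_ring_def)
qed

lemma Qp_a_inv:
  assumes p: "prime p" and s: "padic_Cauchy p s"
  shows "\<ominus>\<^bsub>Qp p\<^esub> padic_class p s = padic_class p (\<lambda>n. - s n)"
proof -
  interpret cring "Qp p" by (rule Qp_cring[OF p])
  have "padic_class p (\<lambda>n. - s n) \<oplus>\<^bsub>Qp p\<^esub> padic_class p s = \<zero>\<^bsub>Qp p\<^esub>"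
    using padic_Cauchy_minus[OF p s] s by (simp add: Qp_ops[OF p])
  thus ?thesis using padic_Cauchy_minus[OF p s] s
    by (intro minus_equality) (auto simp: carrier_Qp)
qed

lemma padic_norm_class:
  assumes p: "prime p" and s: "padic_Cauchy p s"
  shows "(\<lambda>n. padic_abs p (s n)) \<longlonglongrightarrow> padic_norm p (padic_class p s)"
proof -
  obtain r where r: "(\<lambda>n. padic_abs p (s n)) \<longlonglongrightarrow> r"
    using padic_Cauchy_convergent[OF assms] by (auto simp: convergent_def)
  have s_in: "s \<in> padic_class p s" by (simp add: mem_padic_class padic_null_def)
  have "(\<lambda>n. padic_abs p (t n)) \<longlonglongrightarrow> r" if "t \<in> padic_class p s" for t
  proof -
    have "(\<lambda>n. padic_abs p (t n - s n)) \<longlonglongrightarrow> 0" using that by (simp add: mem_padic_class padic_null_def)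
    hence "(\<lambda>n. padic_abs p (t n) - padic_abs p (s n)) \<longlonglongrightarrow> 0"
      by (rule tendsto_0_le[where K = 1]) (auto simp: padic_abs_diff_abs[OF p])
    from tendsto_add[OF this r] show ?thesis by simp
  qed
  hence "padic_norm p (padic_class p s) = r"
    unfolding padic_norm_def using s_in LIMSEQ_unique r by (intro the_equality) blast+
  thus ?thesis using r by simp
qed

lemma padic_norm_unique:
  "prime p \<Longrightarrow> padic_Cauchy p s \<Longrightarrow> (\<lambda>n. padic_abs p (s n)) \<longlonglongrightarrow> r \<Longrightarrow> padic_norm p (padic_class p s) = r"
  using padic_norm_class LIMSEQ_unique by blast

lemma padic_norm_nonneg:
  assumes p: "prime p" and "x \<in> carrier (Qp p)" shows "padic_norm p x \<ge> 0"
proof -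
  obtain s where s: "x = padic_class p s" "padic_Cauchy p s"
    using assms by (auto simp: carrier_Qp)
  show ?thesis unfolding s(1) by (rule LIMSEQ_le_const[OF padic_norm_class[OF p s(2)]]) simp
qed

lemma padic_norm_of_rat: "prime p \<Longrightarrow> padic_norm p (padic_of_rat p q) = padic_abs p q"
  by (simp add: padic_of_rat_eq_class padic_norm_unique)

lemma padic_norm_mult:
  assumes p: "prime p" and "x \<in> carrier (Qp p)" "y \<in> carrier (Qp p)"
  shows "padic_norm p (x \<otimes>\<^bsub>Qp p\<^esub> y) = padic_norm p x * padic_norm p y"
proof -
  obtain s t where st: "x = padic_class p s" "y = padic_class p t" "padic_Cauchy p s" "padic_Cauchy p t"
    using assms by (auto simp: carrier_Qp)
  show ?thesis unfolding st Qp_ops(4)[OF p st(3,4)]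
    using tendsto_mult[OF padic_norm_class[OF p st(3)] padic_norm_class[OF p st(4)]]
    by (intro padic_norm_unique p padic_Cauchy_mult st) (simp add: padic_abs_mult[OF p])
qed

lemma padic_norm_add:
  assumes p: "prime p" and "x \<in> carrier (Qp p)" "y \<in> carrier (Qp p)"
  shows "padic_norm p (x \<oplus>\<^bsub>Qp p\<^esub> y) \<le> max (padic_norm p x) (padic_norm p y)"
proof -
  obtain s t where st: "x = padic_class p s" "y = padic_class p t" "padic_Cauchy p s" "padic_Cauchy p t"
    using assms by (auto simp: carrier_Qp)
  show ?thesis unfolding st Qp_ops(3)[OF p st(3,4)]
    by (rule LIMSEQ_le[OF padic_norm_class[OF p padic_Cauchy_add[OF p st(3,4)]]
        tendsto_max[OF padic_norm_class[OF p st(3)] padic_norm_class[OF p st(4)]]])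
      (simp add: padic_abs_add[OF p])
qed

lemma padic_norm_a_inv:
  assumes p: "prime p" and "x \<in> carrier (Qp p)"
  shows "padic_norm p (\<ominus>\<^bsub>Qp p\<^esub> x) = padic_norm p x"
proof -
  obtain s where s: "x = padic_class p s" "padic_Cauchy p s"
    using assms by (auto simp: carrier_Qp)
  show ?thesis unfolding s Qp_a_inv[OF p s(2)]
    using padic_norm_class[OF p s(2)]
    by (intro padic_norm_unique p padic_Cauchy_minus s) (simp add: padic_abs_minus[OF p])
qed

lemma padic_norm_eq_0:
  assumes p: "prime p" and "x \<in> carrier (Qp p)"
  shows "padic_norm p x = 0 \<longleftrightarrow> x = \<zero>\<^bsub>Qp p\<^esub>"
proof -
  interpret ideal "{s. padic_null p s}" "padic_Cauchy_ring p" by (rule padic_null_ideal[OF p])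
  obtain s where s: "x = padic_class p s" "padic_Cauchy p s"
    using assms by (auto simp: carrier_Qp)
  show ?thesis
  proof
    assume "padic_norm p x = 0"
    hence "padic_null p s" using padic_norm_class[OF p s(2)] s(1) by (simp add: padic_null_def)
    hence "padic_class p s = {s. padic_null p s}"
      unfolding padic_class_def
      by - (rule a_coset_join2[OF _ a_subgroup], use s(2) in \<open>simp_all add: padic_Cauchy_ring_def\<close>)
    thus "x = \<zero>\<^bsub>Qp p\<^esub>" by (simp add: s Qp_def FactRing_def)
  next
    assume "x = \<zero>\<^bsub>Qp p\<^esub>"
    thus "padic_norm p x = 0"
      using padic_norm_of_rat[OF p, of 0] by (simp add: Qp_ops[OF p] padic_of_rat_eq_class)
  qed
qed

lemma Metric_space_Qp:
  assumes p: "prime p" shows "Metric_space (carrier (Qp p)) (padic_dist p)"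
proof
  interpret cring "Qp p" by (rule Qp_cring[OF p])
  show "padic_dist p x y \<ge> 0" for x y
    by (simp add: padic_dist_def padic_norm_nonneg[OF p])
  show "padic_dist p x y = padic_dist p y x" for x y
  proof -
    have "x \<ominus>\<^bsub>Qp p\<^esub> y = \<ominus>\<^bsub>Qp p\<^esub> (y \<ominus>\<^bsub>Qp p\<^esub> x)" if "x \<in> carrier (Qp p)" "y \<in> carrier (Qp p)"
      using that by algebra
    thus ?thesis using padic_norm_a_inv[OF p] by (auto simp: padic_dist_def)
  qed
  fix x y z assume x: "x \<in> carrier (Qp p)" and y: "y \<in> carrier (Qp p)"
  show "padic_dist p x y = 0 \<longleftrightarrow> x = y"
  proof -
    have "x = (x \<ominus>\<^bsub>Qp p\<^esub> y) \<oplus>\<^bsub>Qp p\<^esub> y" using x y by algebra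
    hence "x = y" if "x \<ominus>\<^bsub>Qp p\<^esub> y = \<zero>\<^bsub>Qp p\<^esub>" using that y by simp
    moreover have "x \<ominus>\<^bsub>Qp p\<^esub> y = \<zero>\<^bsub>Qp p\<^esub>" if "x = y"
      using that y by (simp add: a_minus_def r_neg)
    ultimately show ?thesis using x y by (auto simp: padic_dist_def padic_norm_eq_0[OF p])
  qed
  assume z: "z \<in> carrier (Qp p)"
  have "x \<ominus>\<^bsub>Qp p\<^esub> z = (x \<ominus>\<^bsub>Qp p\<^esub> y) \<oplus>\<^bsub>Qp p\<^esub> (y \<ominus>\<^bsub>Qp p\<^esub> z)" using x y z by algebra
  thus "padic_dist p x z \<le> padic_dist p x y + padic_dist p y z"
    using padic_norm_add[OF p, of "x \<ominus>\<^bsub>Qp p\<^esub> y" "y \<ominus>\<^bsub>Qp p\<^esub> z"]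
      padic_norm_nonneg[OF p, of "x \<ominus>\<^bsub>Qp p\<^esub> y"] padic_norm_nonneg[OF p, of "y \<ominus>\<^bsub>Qp p\<^esub> z"] x y z
    by (simp add: padic_dist_def)
qed

lemma padic_of_rat_in_Qp: "padic_of_rat p q \<in> carrier (Qp p)"
  by (auto simp: padic_of_rat_eq_class carrier_Qp)

lemma Zp_subset: "Zp p \<subseteq> carrier (Qp p)"
  by (auto simp: Zp_def)

lemma Zp_closed:
  assumes p: "prime p" and x: "x \<in> Zp p" and y: "y \<in> Zp p"
  shows "x \<oplus>\<^bsub>Qp p\<^esub> y \<in> Zp p" "x \<otimes>\<^bsub>Qp p\<^esub> y \<in> Zp p" "\<ominus>\<^bsub>Qp p\<^esub> x \<in> Zp p"
proof -
  interpret cring "Qp p" by (rule Qp_cring[OF p])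
  note xy = x[unfolded Zp_def] y[unfolded Zp_def]
  show "x \<oplus>\<^bsub>Qp p\<^esub> y \<in> Zp p" using xy padic_norm_add[OF p, of x y] by (auto simp: Zp_def)
  show "x \<otimes>\<^bsub>Qp p\<^esub> y \<in> Zp p" using xy by (auto simp: Zp_def padic_norm_mult[OF p] padic_norm_nonneg[OF p] mult_le_one)
  show "\<ominus>\<^bsub>Qp p\<^esub> x \<in> Zp p" using xy by (auto simp: Zp_def padic_norm_a_inv[OF p])
qed

lemma padic_of_rat_hom:
  assumes p: "prime p"
  shows "padic_of_rat p 0 = \<zero>\<^bsub>Qp p\<^esub>" "padic_of_rat p 1 = \<one>\<^bsub>Qp p\<^esub>"
    "padic_of_rat p (q + r) = padic_of_rat p q \<oplus>\<^bsub>Qp p\<^esub> padic_of_rat p r"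
    "padic_of_rat p (q * r) = padic_of_rat p q \<otimes>\<^bsub>Qp p\<^esub> padic_of_rat p r"
    "padic_of_rat p (- q) = \<ominus>\<^bsub>Qp p\<^esub> padic_of_rat p q"
  by (simp_all add: padic_of_rat_eq_class Qp_ops[OF p] Qp_a_inv[OF p])

lemma Zp_0_1:
  assumes p: "prime p" shows "\<zero>\<^bsub>Qp p\<^esub> \<in> Zp p" "\<one>\<^bsub>Qp p\<^esub> \<in> Zp p"
  using padic_norm_of_rat[OF p, of 0] padic_norm_of_rat[OF p, of 1] padic_of_rat_in_Qp[of p]
  by (auto simp: Zp_def simp flip: padic_of_rat_hom[OF p])

lemma finite_not_Zp: "finite {p. prime p \<and> padic_of_rat p q \<notin> Zp p}"
proof -
  obtain a b where ab: "b > 0" "q = of_int a / of_int b" by (rule rat_as_fraction)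
  have "p dvd nat b" if p: "prime p" and q: "padic_of_rat p q \<notin> Zp p" for p
  proof (rule ccontr)
    assume "\<not> p dvd nat b"
    hence "\<not> int p dvd b" using ab(1) by (metis int_dvd_int_iff int_nat_eq less_imp_le)
    hence m: "multiplicity (int p) b = 0" by (rule not_dvd_imp_multiplicity_0)
    have p1: "real p \<ge> 1" using prime_ge_1_nat[OF p] by simp
    have "padic_abs p q \<le> 1"
    proof (cases "a = 0")
      case False
      hence "padic_abs p q = real p powi (- int (multiplicity (int p) a))"
        unfolding ab(2) using ab(1) m by (subst padic_abs_divide[OF p]) auto
      also have "\<dots> \<le> real p powi 0" by (intro power_int_increasing p1) auto
      finally show ?thesis by simp
    qed (simp add: ab)
    thus False using q by (simp add: Zp_def padic_of_rat_in_Qp padic_norm_of_rat[OF p])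
  qed
  hence "{p. prime p \<and> padic_of_rat p q \<notin> Zp p} \<subseteq> {p. p dvd nat b}" by blast
  thus ?thesis using ab(1) by (elim finite_subset) (simp add: finite_divisors_nat)
qed

section \<open>The adele ring of the rationals\<close>

abbreviation primes :: "nat set" where "primes \<equiv> {p. prime p}"

typedef adele =
  "{(r :: real, f). f \<in> (\<Pi>\<^sub>E p\<in>primes. carrier (Qp p)) \<and> finite {p \<in> primes. f p \<notin> Zp p}}"
proof -
  have "{p \<in> primes. (\<lambda>p\<in>primes. \<zero>\<^bsub>Qp p\<^esub>) p \<notin> Zp p} = {}" by (auto simp: Zp_0_1)
  moreover have "(\<lambda>p\<in>primes. \<zero>\<^bsub>Qp p\<^esub>) \<in> (\<Pi>\<^sub>E p\<in>primes. carrier (Qp p))"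
    using Zp_0_1 Zp_subset by auto
  ultimately show ?thesis by (intro exI[of _ "(0, \<lambda>p\<in>primes. \<zero>\<^bsub>Qp p\<^esub>)"]) auto
qed

setup_lifting type_definition_adele

lift_definition adele_real :: "adele \<Rightarrow> real" is fst .

lift_definition adele_padic :: "nat \<Rightarrow> adele \<Rightarrow> padic" is "\<lambda>p a. snd a p" .

lift_definition adele_of_rat :: "rat \<Rightarrow> adele" is
  "\<lambda>q. (of_rat q, \<lambda>p\<in>primes. padic_of_rat p q)"
proof -
  fix q
  have "{p \<in> primes. (\<lambda>p\<in>primes. padic_of_rat p q) p \<notin> Zp p} = {p. prime p \<and> padic_of_rat p q \<notin> Zp p}"
    by auto
  thus "(of_rat q, \<lambda>p\<in>primes. padic_of_rat p q)
      \<in> {(r, f). f \<in> (\<Pi>\<^sub>E p\<in>primes. carrier (Qp p)) \<and> finite {p \<in> primes. f p \<notin> Zp p}}"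
    using finite_not_Zp[of q] by (auto simp: padic_of_rat_in_Qp)
qed

lemma restricted_product_binop:
  assumes "f \<in> (\<Pi>\<^sub>E p\<in>primes. carrier (Qp p))" "finite {p \<in> primes. f p \<notin> Zp p}"
    and "g \<in> (\<Pi>\<^sub>E p\<in>primes. carrier (Qp p))" "finite {p \<in> primes. g p \<notin> Zp p}"
    and "\<And>p x y. prime p \<Longrightarrow> x \<in> carrier (Qp p) \<Longrightarrow> y \<in> carrier (Qp p) \<Longrightarrow> h p x y \<in> carrier (Qp p)"
    and "\<And>p x y. prime p \<Longrightarrow> x \<in> Zp p \<Longrightarrow> y \<in> Zp p \<Longrightarrow> h p x y \<in> Zp p"
  shows "(\<lambda>p\<in>primes. h p (f p) (g p)) \<in> (\<Pi>\<^sub>E p\<in>primes. carrier (Qp p))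
    \<and> finite {p \<in> primes. (\<lambda>p\<in>primes. h p (f p) (g p)) p \<notin> Zp p}"
proof
  show "(\<lambda>p\<in>primes. h p (f p) (g p)) \<in> (\<Pi>\<^sub>E p\<in>primes. carrier (Qp p))"
    using assms(1,3,5) by (auto simp: PiE_iff)
  have "{p \<in> primes. (\<lambda>p\<in>primes. h p (f p) (g p)) p \<notin> Zp p}
      \<subseteq> {p \<in> primes. f p \<notin> Zp p} \<union> {p \<in> primes. g p \<notin> Zp p}"
    using assms(6) by auto
  thus "finite {p \<in> primes. (\<lambda>p\<in>primes. h p (f p) (g p)) p \<notin> Zp p}"
    by (rule finite_subset) (use assms(2,4) in blast)
qed

lemma Qp_closed:
  assumes p: "prime p" and x: "x \<in> carrier (Qp p)" and y: "y \<in> carrier (Qp p)"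
  shows "x \<oplus>\<^bsub>Qp p\<^esub> y \<in> carrier (Qp p)" "x \<otimes>\<^bsub>Qp p\<^esub> y \<in> carrier (Qp p)" "\<ominus>\<^bsub>Qp p\<^esub> x \<in> carrier (Qp p)"
proof -
  interpret cring "Qp p" by (rule Qp_cring[OF p])
  show "x \<oplus>\<^bsub>Qp p\<^esub> y \<in> carrier (Qp p)" "x \<otimes>\<^bsub>Qp p\<^esub> y \<in> carrier (Qp p)" "\<ominus>\<^bsub>Qp p\<^esub> x \<in> carrier (Qp p)"
    using x y by auto
qed

lemma Qp_l_one: "prime p \<Longrightarrow> x \<in> carrier (Qp p) \<Longrightarrow> \<one>\<^bsub>Qp p\<^esub> \<otimes>\<^bsub>Qp p\<^esub> x = x"
  using Qp_cring[of p] by (simp add: cring_def ring_def monoid.l_one)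

instantiation adele :: comm_ring_1
begin

definition zero_adele :: adele where "0 = adele_of_rat 0"

definition one_adele :: adele where "1 = adele_of_rat 1"

lift_definition plus_adele :: "adele \<Rightarrow> adele \<Rightarrow> adele" is
  "\<lambda>(r, f) (s, g). (r + s, \<lambda>p\<in>primes. f p \<oplus>\<^bsub>Qp p\<^esub> g p)"
  using restricted_product_binop[where h = "\<lambda>p x y. x \<oplus>\<^bsub>Qp p\<^esub> y", OF _ _ _ _ Qp_closed(1) Zp_closed(1)]
  by (simp add: case_prod_unfold)

lift_definition times_adele :: "adele \<Rightarrow> adele \<Rightarrow> adele" is
  "\<lambda>(r, f) (s, g). (r * s, \<lambda>p\<in>primes. f p \<otimes>\<^bsub>Qp p\<^esub> g p)"
  using restricted_product_binop[where h = "\<lambda>p x y. x \<otimes>\<^bsub>Qp p\<^esub> y", OF _ _ _ _ Qp_closed(2) Zp_closed(2)]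
  by (simp add: case_prod_unfold)

lift_definition uminus_adele :: "adele \<Rightarrow> adele" is
  "\<lambda>(r, f). (- r, \<lambda>p\<in>primes. \<ominus>\<^bsub>Qp p\<^esub> f p)"
  subgoal for a
    using restricted_product_binop[where f = "snd a" and g = "snd a"
        and h = "\<lambda>p x y. \<ominus>\<^bsub>Qp p\<^esub> x", OF _ _ _ _ Qp_closed(3) Zp_closed(3)]
    by (simp add: case_prod_unfold)
  done

definition minus_adele :: "adele \<Rightarrow> adele \<Rightarrow> adele" where "a - b = a + - b" for a b :: adele

lemma adele_padic_in_Qp: "prime p \<Longrightarrow> adele_padic p a \<in> carrier (Qp p)"
  using Rep_adele[of a] by (auto simp: adele_padic.rep_eq PiE_iff)

lemma adele_eqI:
  assumes "adele_real a = adele_real b" and "\<And>p. prime p \<Longrightarrow> adele_padic p a = adele_padic p b"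
  shows "a = b"
proof -
  have "snd (Rep_adele a) = snd (Rep_adele b)"
  proof (rule PiE_ext)
    show "snd (Rep_adele a) \<in> (\<Pi>\<^sub>E p\<in>primes. carrier (Qp p))" using Rep_adele[of a] by (simp add: case_prod_unfold)
    show "snd (Rep_adele b) \<in> (\<Pi>\<^sub>E p\<in>primes. carrier (Qp p))" using Rep_adele[of b] by (simp add: case_prod_unfold)
    show "snd (Rep_adele a) p = snd (Rep_adele b) p" if "p \<in> primes" for p
      using assms(2)[of p] that by (simp add: adele_padic.rep_eq)
  qed
  moreover have "fst (Rep_adele a) = fst (Rep_adele b)"
    using assms(1) by (simp add: adele_real.rep_eq)
  ultimately show ?thesis by (simp add: prod_eq_iff flip: Rep_adele_inject)
qed

lemma adele_real_ops [simp]: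
  "adele_real (a + b) = adele_real a + adele_real b"
  "adele_real (a * b) = adele_real a * adele_real b"
  "adele_real (- a) = - adele_real a"
  "adele_real (adele_of_rat q) = of_rat q"
  by (simp_all add: adele_real.rep_eq plus_adele.rep_eq times_adele.rep_eq uminus_adele.rep_eq
      adele_of_rat.rep_eq case_prod_unfold)

lemma adele_padic_ops [simp]:
  assumes "prime p"
  shows "adele_padic p (a + b) = adele_padic p a \<oplus>\<^bsub>Qp p\<^esub> adele_padic p b"
    "adele_padic p (a * b) = adele_padic p a \<otimes>\<^bsub>Qp p\<^esub> adele_padic p b"
    "adele_padic p (- a) = \<ominus>\<^bsub>Qp p\<^esub> adele_padic p a"
    "adele_padic p (adele_of_rat q) = padic_of_rat p q"
  using assms by (simp_all add: adele_padic.rep_eq plus_adele.rep_eq times_adele.rep_eq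
      uminus_adele.rep_eq adele_of_rat.rep_eq case_prod_unfold)

instance
proof
  fix a b c :: adele
  note axs = cring.cring_simprules[OF Qp_cring]
  note simps = axs adele_padic_in_Qp padic_of_rat_hom zero_adele_def one_adele_def
  show "a * b * c = a * (b * c)" by (rule adele_eqI) (simp_all add: simps)
  show "a * b = b * a" by (rule adele_eqI) (simp_all add: simps)
  show "1 * a = a"
    by (rule adele_eqI) (simp_all add: adele_padic_in_Qp padic_of_rat_hom one_adele_def Qp_l_one)
  show "a + b + c = a + (b + c)" by (rule adele_eqI) (simp_all add: simps)
  show "a + b = b + a" by (rule adele_eqI) (simp_all add: simps)
  show "0 + a = a" by (rule adele_eqI) (simp_all add: simps)
  show "- a + a = 0" by (rule adele_eqI) (simp_all add: simps)
  show "a - b = a + - b" by (rule minus_adele_def)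
  show "(a + b) * c = a * c + b * c" by (rule adele_eqI) (simp_all add: simps distrib_right)
  have "adele_real 0 \<noteq> adele_real 1" by (simp add: zero_adele_def one_adele_def)
  thus "(0 :: adele) \<noteq> 1" by metis
qed

end

lemma adele_of_rat_hom:
  "adele_of_rat 0 = 0" "adele_of_rat 1 = 1"
  "adele_of_rat (q + r) = adele_of_rat q + adele_of_rat r"
  "adele_of_rat (q * r) = adele_of_rat q * adele_of_rat r"
  "adele_of_rat (- q) = - adele_of_rat q"
  by (auto intro!: adele_eqI simp: zero_adele_def one_adele_def padic_of_rat_hom of_rat_add of_rat_mult of_rat_minus)

instantiation adele :: topological_space
begin

definition open_adele :: "adele set \<Rightarrow> bool" where
  "open_adele = generate_topology
     {{a. adele_real a \<in> W \<and> (\<forall>p\<in>primes. adele_padic p a \<in> U p)} | W U.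
        open W \<and> (\<forall>p\<in>primes. openin (padic_topology p) (U p)) \<and> finite {p \<in> primes. U p \<noteq> Zp p}}"

instance
proof -
  interpret T: topological_space "open :: adele set \<Rightarrow> bool"
    unfolding open_adele_def by (rule topological_space_generate_topology)
  show "OFCLASS(adele, topological_space_class)"
    by standard (auto intro: T.open_Int T.open_Union)
qed

end

section \<open>The quotient of adelic space by its rational points\<close>

definition adele_vec_of_rat :: "rat^'d \<Rightarrow> adele^'d" where
  "adele_vec_of_rat v = (\<chi> i. adele_of_rat (v $ i))"

lemma adele_vec_of_rat_hom:
  "adele_vec_of_rat 0 = 0"
  "adele_vec_of_rat (v + w) = adele_vec_of_rat v + adele_vec_of_rat w"
  "adele_vec_of_rat (- v) = - adele_vec_of_rat v"
  by (simp_all add: vec_eq_iff adele_vec_of_rat_def adele_of_rat_hom)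

lemma zero_in_range_adele_vec_of_rat: "0 \<in> range adele_vec_of_rat"
  by (metis rangeI adele_vec_of_rat_hom(1))

quotient_type 'd solenoid = "adele^('d::finite)" / "\<lambda>a b. a - b \<in> range adele_vec_of_rat"
  morphisms rep_solenoid solenoid_proj
proof (rule equivpI)
  show "reflp (\<lambda>a b :: adele^'d. a - b \<in> range adele_vec_of_rat)"
    by (rule reflpI) (simp add: zero_in_range_adele_vec_of_rat)
  show "symp (\<lambda>a b :: adele^'d. a - b \<in> range adele_vec_of_rat)"
  proof (rule sympI)
    fix a b :: "adele^'d" assume "a - b \<in> range adele_vec_of_rat"
    then obtain v where "a - b = adele_vec_of_rat v" by blast
    hence "b - a = adele_vec_of_rat (- v)" by (metis adele_vec_of_rat_hom(3) minus_diff_eq)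
    thus "b - a \<in> range adele_vec_of_rat" by blast
  qed
  show "transp (\<lambda>a b :: adele^'d. a - b \<in> range adele_vec_of_rat)"
  proof (rule transpI)
    fix a b c :: "adele^'d"
    assume "a - b \<in> range adele_vec_of_rat" "b - c \<in> range adele_vec_of_rat"
    then obtain v w where vw: "a - b = adele_vec_of_rat v" "b - c = adele_vec_of_rat w" by blast
    have "a - c = (a - b) + (b - c)" by simp
    also have "\<dots> = adele_vec_of_rat (v + w)" by (simp only: vw adele_vec_of_rat_hom)
    finally show "a - c \<in> range adele_vec_of_rat" by blast
  qed
qed

instantiation solenoid :: (finite) ab_group_add
begin

lift_definition zero_solenoid :: "'a solenoid" is 0 .

lift_definition plus_solenoid :: "'a solenoid \<Rightarrow> 'a solenoid \<Rightarrow> 'a solenoid" is "(+)"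
proof -
  fix a a' b b' :: "adele^'a"
  assume "a - a' \<in> range adele_vec_of_rat" "b - b' \<in> range adele_vec_of_rat"
  then obtain v w where vw: "a - a' = adele_vec_of_rat v" "b - b' = adele_vec_of_rat w" by blast
  have "(a + b) - (a' + b') = (a - a') + (b - b')" by simp
  also have "\<dots> = adele_vec_of_rat (v + w)" by (simp only: vw adele_vec_of_rat_hom)
  finally show "(a + b) - (a' + b') \<in> range adele_vec_of_rat" by blast
qed

lift_definition uminus_solenoid :: "'a solenoid \<Rightarrow> 'a solenoid" is uminus
proof -
  fix a a' :: "adele^'a"
  assume "a - a' \<in> range adele_vec_of_rat"
  then obtain v where v: "a - a' = adele_vec_of_rat v" by blast
  have "(- a) - (- a') = - (a - a')" by simp
  also have "\<dots> = adele_vec_of_rat (- v)" by (simp only: v adele_vec_of_rat_hom)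
  finally show "(- a) - (- a') \<in> range adele_vec_of_rat" by blast
qed

definition minus_solenoid :: "'a solenoid \<Rightarrow> 'a solenoid \<Rightarrow> 'a solenoid" where
  "x - y = x + - y" for x y :: "'a solenoid"

instance
proof
  fix x y z :: "'a solenoid"
  show "x + y + z = x + (y + z)" by transfer (simp add: add.assoc zero_in_range_adele_vec_of_rat)
  show "x + y = y + x" by transfer (simp add: add.commute zero_in_range_adele_vec_of_rat)
  show "0 + x = x" by transfer (simp add: zero_in_range_adele_vec_of_rat)
  show "- x + x = 0" by transfer (simp add: zero_in_range_adele_vec_of_rat)
  show "x - y = x + - y" by (rule minus_solenoid_def)
qed

end

instantiation solenoid :: (finite) topological_space
begin

definition open_solenoid :: "'a solenoid set \<Rightarrow> bool" where
  "open_solenoid U \<longleftrightarrow> open (solenoid_proj -` U)"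

instance
  by standard (auto simp: open_solenoid_def vimage_Union)

end

lift_definition rat_matrix_act :: "rat^'d^'d \<Rightarrow> 'd::finite solenoid \<Rightarrow> 'd solenoid" is
  "\<lambda>g a. map_matrix adele_of_rat g *v a"
proof -
  fix g :: "rat^'d^'d" and a b :: "adele^'d"
  have sum: "adele_of_rat (sum f A) = (\<Sum>i\<in>A. adele_of_rat (f i))" for f and A :: "'d set"
    by (induction A rule: infinite_finite_induct) (auto simp: adele_of_rat_hom)
  assume "a - b \<in> range adele_vec_of_rat"
  then obtain v where v: "a - b = adele_vec_of_rat v" by blast
  have "map_matrix adele_of_rat g *v a - map_matrix adele_of_rat g *v b = map_matrix adele_of_rat g *v (a - b)"
    by (simp add: vec_eq_iff matrix_vector_mult_def sum_subtractf right_diff_distrib)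
  also have "\<dots> = adele_vec_of_rat (g *v v)"
    unfolding v by (simp add: vec_eq_iff matrix_vector_mult_def adele_vec_of_rat_def sum adele_of_rat_hom)
  finally show "map_matrix adele_of_rat g *v a - map_matrix adele_of_rat g *v b \<in> range adele_vec_of_rat"
    by blast
qed

section \<open>The adelic points of a rational subspace\<close>

text \<open>
  \<open>padic_span p R B\<close> is the set of linear combinations of the rational vectors in \<open>B\<close> with
  coefficients in the subring \<open>R\<close> of \<open>Qp p\<close>.
\<close>

definition padic_span :: "nat \<Rightarrow> padic set \<Rightarrow> (rat^'d) set \<Rightarrow> (padic^'d) set" where
  "padic_span p R B =
    {x. \<exists>F c. finite F \<and> F \<subseteq> B \<and> c \<in> F \<rightarrow> R \<and>
      (\<forall>i. x $ i = (\<Oplus>\<^bsub>Qp p\<^esub>v\<in>F. c v \<otimes>\<^bsub>Qp p\<^esub> padic_of_rat p (v $ i)))}"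

definition Qp_points :: "nat \<Rightarrow> (rat^'d) set \<Rightarrow> (padic^'d) set" where
  "Qp_points p V = padic_span p (carrier (Qp p)) V"

definition Zp_points :: "nat \<Rightarrow> (rat^'d) set \<Rightarrow> (padic^'d) set" where
  "Zp_points p V = padic_span p (Zp p) {v \<in> V. \<forall>i. v $ i \<in> \<int>}"

definition real_points :: "(rat^'d) set \<Rightarrow> (real^'d) set" where
  "real_points V = span ((\<lambda>v. \<chi> i. of_rat (v $ i)) ` V)"

text \<open>Here \<open>S\<close> is the set of finite places, so the infinite place is always included.\<close>

definition adelic_points :: "(rat^'d) set \<Rightarrow> (adele^'d) set" where
  "adelic_points V =
    (\<Union>S\<in>{S. finite S \<and> S \<subseteq> primes}.
      {a. (\<chi> i. adele_real (a $ i)) \<in> real_points V \<and>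
          (\<forall>p\<in>S. (\<chi> i. adele_padic p (a $ i)) \<in> Qp_points p V) \<and>
          (\<forall>p\<in>primes - S. (\<chi> i. adele_padic p (a $ i)) \<in> Zp_points p V)})"

section \<open>Linear algebraic groups over the rationals\<close>

definition GL :: "('a::field^'d^'d) monoid" where
  "GL = \<lparr>carrier = {g. invertible g}, mult = (**), one = mat 1\<rparr>"

lemma group_GL: "group (GL :: ('a::field^'d^'d) monoid)"
proof (rule groupI)
  fix x :: "'a^'d^'d" assume "x \<in> carrier GL"
  thus "\<exists>y\<in>carrier GL. y \<otimes>\<^bsub>GL\<^esub> x = \<one>\<^bsub>GL\<^esub>"
    unfolding GL_def invertible_def by auto
next
  show "\<one>\<^bsub>GL\<^esub> \<in> carrier (GL :: ('a^'d^'d) monoid)"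
    by (auto simp: GL_def invertible_def intro: exI[of _ "mat 1"])
qed (auto simp: GL_def invertible_mult matrix_mul_assoc)

text \<open>
  Algebraic groups are identified with their groups of complex points.  A polynomial in the
  entries of a matrix is represented by the function it induces on complex matrices.
\<close>

inductive_set matrix_polys :: "complex set \<Rightarrow> (complex^'d^'d \<Rightarrow> complex) set"
  for K :: "complex set" where
  const: "c \<in> K \<Longrightarrow> (\<lambda>_. c) \<in> matrix_polys K"
| entry: "(\<lambda>g. g $ i $ j) \<in> matrix_polys K"
| add: "f \<in> matrix_polys K \<Longrightarrow> h \<in> matrix_polys K \<Longrightarrow> (\<lambda>g. f g + h g) \<in> matrix_polys K"
| mult: "f \<in> matrix_polys K \<Longrightarrow> h \<in> matrix_polys K \<Longrightarrow> (\<lambda>g. f g * h g) \<in> matrix_polys K"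

definition zariski :: "(complex^'d^'d) topology" where
  "zariski = topology_generated_by ((\<lambda>f. {g. f g \<noteq> 0}) ` matrix_polys UNIV)"

text \<open>
  Being cut out by rational polynomials is the same as being defined over the rationals, because
  the characteristic is 0.
\<close>

definition algebraic_subgroup_over_rat :: "(complex^'d^'d) set \<Rightarrow> bool" where
  "algebraic_subgroup_over_rat G \<longleftrightarrow> subgroup G GL \<and>
    (\<exists>P \<subseteq> matrix_polys \<rat>. G = {g. invertible g \<and> (\<forall>f\<in>P. f g = 0)})"

definition rat_points :: "(complex^'d^'d) set \<Rightarrow> (rat^'d^'d) set" where
  "rat_points G = {g. map_matrix of_rat g \<in> G}"

definition eval_poly_matrix :: "'a::comm_semiring_0 poly^'d^'d \<Rightarrow> 'a \<Rightarrow> 'a^'d^'d" where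
  "eval_poly_matrix u t = map_matrix (\<lambda>q. poly q t) u"

text \<open>
  A rational morphism from the additive group into \<open>GL\<close> is a matrix of polynomials with rational
  coefficients, as its matrix entries are regular functions on the affine line.
\<close>

definition rational_one_parameter :: "(complex^'d^'d) set \<Rightarrow> rat poly^'d^'d \<Rightarrow> bool" where
  "rational_one_parameter G u \<longleftrightarrow>
    (let U = eval_poly_matrix (map_matrix (map_poly of_rat) u) :: complex \<Rightarrow> complex^'d^'d
     in (\<forall>t. U t \<in> G) \<and> (\<forall>s t. U (s + t) = U s ** U t) \<and> (\<exists>t. U t \<noteq> mat 1))"

definition unipotent_one_parameter_subgroups :: "(complex^'d^'d) set \<Rightarrow> (rat^'d^'d) set set" where
  "unipotent_one_parameter_subgroups G = {range (eval_poly_matrix u) | u. rational_one_parameter G u}"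

end

theory Submission
  imports Defs "HOL-Library.Function_Algebras"
begin

text \<open>
  Let \<open>W\<close> be the space of rational row vectors \<open>r\<close> with \<open>r (g a - a)\<close> rational for all \<open>g\<close> in the
  group, and let \<open>V\<^sub>0\<close> be its annihilator.  The orbit lies in the closed set \<open>x + \<phi>(V\<^sub>0(\<bold>A))\<close> because an
  adelic vector on which \<open>W\<close> takes rational values is rational modulo \<open>V\<^sub>0(\<bold>A)\<close>.

  For density, a product of unipotent one-parameter subgroups is a polynomial map \<open>P\<close> on a divisible
  group \<open>T\<close>, and finitely many elements of the group lie in the image of one such map.
  By Weyl's method a nonconstant polynomial phase on \<open>T\<close> has mean zero, in the sense that averages over
  suitable finite sets of translates are uniformly small.  So the characters of the quotient
  given by \<open>r\<close> average to zero along \<open>P a\<close> unless \<open>r\<close> lies in \<open>W\<close>, and testing against a Fejer-like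
  kernel shows that the orbit meets every neighbourhood of every point of the coset.
\<close>

section \<open>Weyl sums over divisible groups\<close>

text \<open>A single character of the adeles, trivial on the rationals, composed with rational row
  vectors yields all characters that occur; averages over finite lists of shifts serve as means. The
  obstacle: the relation space is cut out by infinitely many group elements, while one polynomial
  family sees only a parametrized piece of the group. But for a fixed neighbourhood the kernel has
  finitely many frequencies, each one outside the relation space has a witness \<open>g\<close>, and
  finitely many witnesses fit into one family. As the kernel coefficients are nonnegative,
  frequencies that are relations can only raise the mean: such a term averages to 1, every other to
  almost 0, so the constant coefficient is a lower bound up to a small error. If the orbit missed
  the neighbourhood, the kernel would be at most \<open>d ^ m\<close> with \<open>d < 1\<close>,
  whereas the constant coefficient, a power of a normalized central binomial coefficient, decays
  only polynomially in \<open>m\<close>. Divisibility of the parameter group enters twice: it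
  supplies shifts in distinct cosets, and it turns additivity modulo the rationals into
  linearity.\<close>

definition avg :: "'t list \<Rightarrow> ('t::ab_group_add \<Rightarrow> complex) \<Rightarrow> 't \<Rightarrow> complex" where
  "avg H f t = (\<Sum>h\<leftarrow>H. f (t + h)) / of_nat (length H)"

text \<open>Uniformity in \<open>t\<close> makes the bound survive further averaging. Shifts form a
  list because sums \<open>h + k\<close> must be counted with multiplicity when averages are
  composed.\<close>

definition mean_zero :: "('t::ab_group_add \<Rightarrow> complex) \<Rightarrow> bool" where
  "mean_zero f \<longleftrightarrow> (\<forall>e>0. \<exists>H. H \<noteq> [] \<and> (\<forall>t. norm (avg H f t) \<le> e))"

lemma norm_sum_list_le: "(\<And>x. x \<in> set xs \<Longrightarrow> norm (g x :: complex) \<le> e) \<Longrightarrow> norm (\<Sum>x\<leftarrow>xs. g x) \<le> of_nat (length xs) * e"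
proof (induction xs)
  case (Cons a xs)
  have "norm (g a + (\<Sum>x\<leftarrow>xs. g x)) \<le> e + of_nat (length xs) * e"
    by (rule norm_triangle_mono) (use Cons in auto)
  then show ?case by (simp add: algebra_simps)
qed simp

lemma norm_avg_le:
  assumes "H \<noteq> []" "\<And>t. norm (f t) \<le> e"
  shows "norm (avg H f t) \<le> e"
proof -
  have "norm (\<Sum>h\<leftarrow>H. f (t + h)) \<le> of_nat (length H) * e"
    by (rule norm_sum_list_le) (rule assms)
  then show ?thesis
    using assms(1) by (simp add: avg_def norm_divide divide_le_eq mult.commute)
qed

lemma sum_list_swap: "(\<Sum>x\<leftarrow>xs. \<Sum>y\<leftarrow>ys. g x y) = (\<Sum>y\<leftarrow>ys. \<Sum>x\<leftarrow>xs. g x y :: complex)"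
  by (induction xs) (simp_all add: sum_list_addf)

lemma sum_list_divide: "(\<Sum>x\<leftarrow>xs. g x / c) = (\<Sum>x\<leftarrow>xs. g x) / (c :: complex)"
  by (induction xs) (simp_all add: add_divide_distrib)

lemma avg_avg:
  "avg H (avg K f) t = (\<Sum>h\<leftarrow>H. \<Sum>k\<leftarrow>K. f (t + h + k)) / (of_nat (length H) * of_nat (length K))"
  by (simp add: avg_def sum_list_divide mult.commute)

lemma avg_commute: "avg H (avg K f) t = avg K (avg H f) t"
proof -
  have "(\<Sum>h\<leftarrow>H. \<Sum>k\<leftarrow>K. f (t + h + k)) = (\<Sum>k\<leftarrow>K. \<Sum>h\<leftarrow>H. f (t + h + k))"
    by (rule sum_list_swap)
  then show ?thesis
    by (simp add: avg_avg ac_simps)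
qed

lemma avg_avg_eq_avg:
  assumes "H \<noteq> []" "K \<noteq> []"
  obtains L where "L \<noteq> []" "\<And>f t. avg L f t = avg H (avg K f) t"
proof
  let ?L = "concat (map (\<lambda>h. map (\<lambda>k. h + k) K) H)"
  show "?L \<noteq> []" using assms by (cases H; cases K) auto
  have "length ?L = length H * length K" by (induction H) auto
  moreover have "(\<Sum>x\<leftarrow>?L. f (t + x)) = (\<Sum>h\<leftarrow>H. \<Sum>k\<leftarrow>K. f (t + h + k))" for f :: "'a \<Rightarrow> complex" and t
    by (induction H) (simp_all add: o_def add.assoc)
  ultimately show "avg ?L f t = avg H (avg K f) t" for f t
    unfolding avg_avg by (simp add: avg_def)
qed

text \<open>Averaging operators commute and preserve uniform bounds, so composing the lists that
  work for single functions gives one that works for all.\<close>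

lemma mean_zero_common:
  assumes "finite I" "\<And>i. i \<in> I \<Longrightarrow> mean_zero (f i)" "e > 0"
  shows "\<exists>K. K \<noteq> [] \<and> (\<forall>i\<in>I. \<forall>t. norm (avg K (f i) t) \<le> e)"
  using assms
proof (induction I)
  case empty
  show ?case by (intro exI[of _ "[0]"]) auto
next
  case (insert j I)
  then obtain K where K: "K \<noteq> []" "\<forall>i\<in>I. \<forall>t. norm (avg K (f i) t) \<le> e" by auto
  obtain H where H: "H \<noteq> []" "\<forall>t. norm (avg H (f j) t) \<le> e"
    using insert.prems unfolding mean_zero_def by blast
  obtain L where L: "L \<noteq> []" "\<And>f t. avg L f t = avg H (avg K f) t"
    using avg_avg_eq_avg[OF H(1) K(1)] by blast
  have "norm (avg L (f j) t) \<le> e" for t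
    unfolding L avg_commute[of H K] by (rule norm_avg_le[OF K(1)]) (use H in auto)
  moreover have "norm (avg L (f i) t) \<le> e" if "i \<in> I" for i t
    unfolding L by (rule norm_avg_le[OF H(1)]) (use K that in auto)
  ultimately show ?case using L(1) by blast
qed

text \<open>Cauchy-Schwarz, with the right-hand side left as an average so that
  \<open>g * cnj g\<close> can be expanded into correlations.\<close>

lemma norm_avg_squared_le:
  assumes "K \<noteq> []"
  shows "(norm (avg K g t))\<^sup>2 \<le> Re (avg K (\<lambda>t. g t * cnj (g t)) t)"
proof -
  let ?n = "length K"
  have "(norm (\<Sum>k\<leftarrow>K. g (t + k)))\<^sup>2 \<le> (\<Sum>i<?n. norm (g (t + K ! i)))\<^sup>2"
    by (rule power_mono) (simp_all add: sum_list_sum_nth atLeast0LessThan norm_sum)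
  also have "\<dots> \<le> (\<Sum>i<?n. (norm (g (t + K ! i)))\<^sup>2) * real ?n"
    using sum_squared_le_sum_of_squares[of "\<lambda>i. norm (g (t + K ! i))" "{..<?n}"] by simp
  finally have *: "(norm (\<Sum>k\<leftarrow>K. g (t + k)))\<^sup>2 \<le> (\<Sum>i<?n. (norm (g (t + K ! i)))\<^sup>2) * real ?n" .
  have "avg K (\<lambda>t. g t * cnj (g t)) t = of_real ((\<Sum>i<?n. (norm (g (t + K ! i)))\<^sup>2) / real ?n)"
    by (simp add: avg_def sum_list_sum_nth atLeast0LessThan complex_norm_square del: of_real_power)
  then have "Re (avg K (\<lambda>t. g t * cnj (g t)) t) = (\<Sum>i<?n. (norm (g (t + K ! i)))\<^sup>2) / real ?n"
    by simp
  moreover have "(norm (avg K g t))\<^sup>2 = (norm (\<Sum>k\<leftarrow>K. g (t + k)))\<^sup>2 / (real ?n)\<^sup>2"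
    by (simp add: avg_def norm_divide power_divide)
  moreover have "\<dots> \<le> (\<Sum>i<?n. (norm (g (t + K ! i)))\<^sup>2) * real ?n / (real ?n)\<^sup>2"
    by (rule divide_right_mono[OF *]) simp
  ultimately show ?thesis
    using assms by (simp add: power2_eq_square)
qed

text \<open>Averaging over \<open>n\<close> shifts and then over \<open>K\<close> bounds the squared
  mean by \<open>n\<^sup>2\<close> correlations divided by \<open>n\<^sup>2\<close>. The diagonal
  ones cost \<open>1 / n\<close>; one common \<open>K\<close> makes all others small.\<close>

lemma mean_zero_van_der_Corput:
  fixes f :: "'t::ab_group_add \<Rightarrow> complex"
  assumes f: "\<And>t. norm (f t) = 1"
    and diff: "\<And>n. \<exists>h :: nat \<Rightarrow> 't. \<forall>i<n. \<forall>j<n. i \<noteq> j \<longrightarrow> mean_zero (\<lambda>t. f (t + h i) * cnj (f (t + h j)))"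
  shows "mean_zero f"
  unfolding mean_zero_def
proof (intro allI impI)
  fix e :: real assume e: "e > 0"
  \<comment> \<open>Chosen so that the diagonal contributes at most \<open>e\<^sup>2 / 2\<close>,
    the same share as the off-diagonal correlations.\<close>
  obtain n :: nat where n: "real n > 2 / e\<^sup>2" using reals_Archimedean2 by blast
  have n0: "n > 0" using n e by (cases n) auto
  obtain h :: "nat \<Rightarrow> 't" where h: "\<forall>i<n. \<forall>j<n. i \<noteq> j \<longrightarrow> mean_zero (\<lambda>t. f (t + h i) * cnj (f (t + h j)))"
    using diff by blast
  define D where "D = (\<lambda>(i, j) t. f (t + h i) * cnj (f (t + h j)))"
  let ?I = "{(i, j). i < n \<and> j < n \<and> i \<noteq> j}"
  have fin: "finite ?I" by (rule finite_subset[of _ "{..<n} \<times> {..<n}"]) auto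
  have "\<exists>K. K \<noteq> [] \<and> (\<forall>x\<in>?I. \<forall>t. norm (avg K (D x) t) \<le> e\<^sup>2 / 2)"
    by (rule mean_zero_common[OF fin]) (use h e in \<open>auto simp: D_def\<close>)
  then obtain K where K: "K \<noteq> []" "\<And>i j t. i < n \<Longrightarrow> j < n \<Longrightarrow> i \<noteq> j \<Longrightarrow> norm (avg K (D (i, j)) t) \<le> e\<^sup>2 / 2"
    by blast
  let ?H = "map h [0..<n]"
  have H: "?H \<noteq> []" using n0 by simp
  obtain L where L: "L \<noteq> []" "\<And>f t. avg L f t = avg K (avg ?H f) t"
    using avg_avg_eq_avg[OF K(1) H] by blast
  have avgH: "avg ?H f t = (\<Sum>i<n. f (t + h i)) / of_nat n" for t
    by (simp add: avg_def o_def interv_sum_list_conv_sum_set_nat atLeast0LessThan)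
  have sq: "avg ?H f t * cnj (avg ?H f t) = (\<Sum>i<n. \<Sum>j<n. D (i, j) t) / (of_nat n)\<^sup>2" for t
    by (simp add: avgH D_def sum_product power2_eq_square)
  have swap: "(\<Sum>k\<leftarrow>K. \<Sum>i<n. \<Sum>j<n. D (i, j) (t + k)) = (\<Sum>i<n. \<Sum>j<n. \<Sum>k\<leftarrow>K. D (i, j) (t + k))" for t
    by (induction K) (simp_all add: sum.distrib)
  have "norm (avg L f t) \<le> e" for t
  proof -
    have D1: "norm (avg K (D (i, j)) t) \<le> 1" for i j
      by (rule norm_avg_le[OF K(1)]) (simp add: D_def norm_mult f)
    have "(norm (avg L f t))\<^sup>2 \<le> Re (avg K (\<lambda>t. avg ?H f t * cnj (avg ?H f t)) t)"
      unfolding L by (rule norm_avg_squared_le[OF K(1)])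
    also have "avg K (\<lambda>t. avg ?H f t * cnj (avg ?H f t)) t = (\<Sum>i<n. \<Sum>j<n. avg K (D (i, j)) t) / (of_nat n)\<^sup>2"
      unfolding sq by (simp add: avg_def sum_list_divide swap sum_divide_distrib[symmetric] mult.commute)
    also have "Re \<dots> \<le> norm ((\<Sum>i<n. \<Sum>j<n. avg K (D (i, j)) t) / (of_nat n)\<^sup>2)"
      by (rule complex_Re_le_cmod)
    also have "\<dots> \<le> (\<Sum>i<n. \<Sum>j<n. norm (avg K (D (i, j)) t)) / (real n)\<^sup>2"
      by (simp add: norm_divide norm_power divide_right_mono sum_norm_le norm_sum)
    also have "\<dots> \<le> (\<Sum>i<n. \<Sum>j<n. (if i = j then 1 else 0) + e\<^sup>2 / 2) / (real n)\<^sup>2"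
    proof (intro divide_right_mono sum_mono)
      fix i j assume "i \<in> {..<n}" "j \<in> {..<n}"
      then show "norm (avg K (D (i, j)) t) \<le> (if i = j then 1 else 0) + e\<^sup>2 / 2"
        using order_trans[OF D1[of i j], of "1 + e\<^sup>2 / 2"] K(2)[of i j t] by auto
    qed simp
    also have "\<dots> = (real n + real n * (real n * (e\<^sup>2 / 2))) / (real n)\<^sup>2"
      by (simp add: sum.distrib distrib_left)
    also have "\<dots> = 1 / real n + e\<^sup>2 / 2"
      using n0 by (simp add: field_simps power2_eq_square)
    also have "\<dots> \<le> e\<^sup>2"
    proof -
      have "1 / real n \<le> e\<^sup>2 / 2"
        using n n0 e by (simp add: field_simps)
      then show ?thesis by simp
    qed
    finally show ?thesis using e by (simp add: power2_le_iff_abs_le)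
  qed
  then show "\<exists>H. H \<noteq> [] \<and> (\<forall>t. norm (avg H f t) \<le> e)" using L(1) by blast
qed

text \<open>A multiplicative notion of degree: for unimodular \<open>f\<close> the product with
  \<open>cnj\<close> is the quotient \<open>f (t + h) / f t\<close>, and \<open>n\<close> such steps
  leave a constant.\<close>

fun phase_poly :: "nat \<Rightarrow> ('t::ab_group_add \<Rightarrow> complex) \<Rightarrow> bool" where
  "phase_poly 0 f \<longleftrightarrow> f constant_on UNIV"
| "phase_poly (Suc n) f \<longleftrightarrow> (\<forall>h. phase_poly n (\<lambda>t. f (t + h) * cnj (f t)))"

text \<open>Along multiples of \<open>s\<close> the values form a geometric progression with ratio
  \<open>c\<close> of modulus 1, whose partial sums are bounded by \<open>2 / norm (1 - c)\<close>.
  Multiples appear as constant sums because the type is only an abelian group.\<close>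

lemma mean_zero_geometric:
  fixes f :: "'t::ab_group_add \<Rightarrow> complex"
  assumes f: "\<And>t. norm (f t) = 1" and s: "\<And>t. f (t + s) = f t * c" and c: "c \<noteq> 1"
  shows "mean_zero f"
  unfolding mean_zero_def
proof (intro allI impI)
  fix e :: real assume e: "e > 0"
  obtain n :: nat where n: "real n > (2 / norm (1 - c)) / e" using reals_Archimedean2 by blast
  have "(2 / norm (1 - c)) / e > 0" using e c by simp
  then have "real n > 0" using n by linarith
  then have n0: "n > 0" by simp
  have nc: "norm c = 1"
    using f[of "0 + s"] f[of 0] unfolding s by (simp add: norm_mult)
  have fs: "f (t + (\<Sum>_<i. s)) = f t * c ^ i" for t i
    by (induction i) (simp_all add: s flip: add.assoc)
  let ?H = "map (\<lambda>i. \<Sum>_<i. s) [0..<n]"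
  have "norm (avg ?H f t) \<le> e" for t
  proof -
    have "avg ?H f t = f t * (\<Sum>i<n. c ^ i) / of_nat n"
      unfolding avg_def map_map o_def fs
      by (simp add: interv_sum_list_conv_sum_set_nat atLeast0LessThan sum_distrib_left)
    also have "(\<Sum>i<n. c ^ i) = (1 - c ^ n) / (1 - c)" using c by (simp add: sum_gp_strict)
    finally have "norm (avg ?H f t) = norm (1 - c ^ n) / norm (1 - c) / real n"
      by (simp add: norm_mult norm_divide f)
    also have "\<dots> \<le> 2 / norm (1 - c) / real n"
      using norm_triangle_ineq4[of 1 "c ^ n"] by (intro divide_right_mono) (simp_all add: norm_power nc)
    also have "\<dots> \<le> e"
    proof -
      have "2 / norm (1 - c) < real n * e" using n e pos_divide_less_eq by blast
      then show ?thesis using n0 by (subst pos_divide_le_eq) (simp_all add: mult.commute)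
    qed
    finally show ?thesis .
  qed
  then show "\<exists>H. H \<noteq> [] \<and> (\<forall>t. norm (avg H f t) \<le> e)"
    using n0 by (intro exI[of _ ?H]) auto
qed

text \<open>
  The shifts \<open>h\<close> with constant \<open>f (t + h) * cnj (f t)\<close> form a subgroup; a proper subgroup of a
  divisible group has infinite index, which supplies the shifts for van der Corput's inequality.
\<close>

lemma phase_poly_mean_zero:
  fixes f :: "'t::ab_group_add \<Rightarrow> complex"
  assumes div: "\<And>(n :: nat) (t :: 't). n > 0 \<Longrightarrow> \<exists>s. (\<Sum>_<n. s) = t"
    and "phase_poly n f" "\<And>t. norm (f t) = 1" "\<not> f constant_on UNIV"
  shows "mean_zero f"
  using assms(2-)
proof (induction n arbitrary: f)
  case (Suc n)
  let ?D = "\<lambda>h t. f (t + h) * cnj (f t)"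
  have ff: "f t * cnj (f t) = 1" for t
    using Suc.prems(2)[of t] by (simp flip: complex_norm_square)
  define G where "G = {h. ?D h constant_on UNIV}"
  have G0: "0 \<in> G" by (simp add: G_def constant_on_def ff)
  have Gadd: "h + k \<in> G" if hk: "h \<in> G" "k \<in> G" for h k
  proof -
    obtain b c where bc: "\<And>t. ?D h t = b" "\<And>t. ?D k t = c"
      using hk by (auto simp: G_def constant_on_def)
    have "?D (h + k) t = ?D h (t + k) * ?D k t" for t
      using ff[of "t + k"] by (simp add: ac_simps)
    then show ?thesis unfolding G_def constant_on_def mem_Collect_eq bc by blast
  qed
  have Gmult: "(\<Sum>_<m. h) \<in> G" if "h \<in> G" for h and m :: nat
    by (induction m) (use G0 Gadd that in \<open>auto simp: add.commute\<close>)
  have shift: "mean_zero (\<lambda>t. g (t + k))" if "mean_zero g" for g :: "'t \<Rightarrow> complex" and k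
  proof -
    have "avg H (\<lambda>t. g (t + k)) t = avg H g (t + k)" for H t
      by (simp add: avg_def add.assoc add.commute[of k])
    then show ?thesis using that unfolding mean_zero_def by metis
  qed
  have mz: "mean_zero (?D h)" if "h \<notin> G" for h
    by (rule Suc.IH) (use that Suc.prems in \<open>auto simp: G_def norm_mult\<close>)
  show ?case
  proof (cases "G = UNIV")
    case True
    \<comment> \<open>All multiplicative differences are constant, so \<open>f\<close> is a multiple
      of a character, and a shift that changes \<open>f 0\<close> has ratio other than 1.\<close>
    obtain s where s: "f s \<noteq> f 0" using Suc.prems(3) unfolding constant_on_def by metis
    obtain c where c: "\<And>t. ?D s t = c" using True by (auto simp: G_def constant_on_def)
    have fs: "f (t + s) = f t * c" for t
      unfolding c[of t, symmetric] using ff[of t] by (simp add: ac_simps)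
    have "c \<noteq> 1" using fs[of 0] s by auto
    then show ?thesis using mean_zero_geometric Suc.prems(2) fs by blast
  next
    case False
    then obtain s where s: "s \<notin> G" by blast
    show ?thesis
    proof (rule mean_zero_van_der_Corput)
      fix m :: nat
      \<comment> \<open>The shifts will be \<open>0, u, ..., (m - 1) u\<close>. The factorial is
        divisible by every difference of indices, so \<open>(i - j) u\<close> in \<open>G\<close>
        would force its multiple \<open>s\<close> into \<open>G\<close>.\<close>
      obtain u where u: "(\<Sum>_<(fact m :: nat). u) = s" using div[of "fact m" s] by auto
      define h where "h i = (\<Sum>_<i. u)" for i :: nat
      have hadd: "h (i + j) = h i + h j" for i j
        by (induction j) (simp_all add: h_def add.assoc)
      have hdiff: "h i - h j \<notin> G" if "i < m" "j < i" for i j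
      proof
        assume "h i - h j \<in> G"
        moreover have "h i = h j + h (i - j)"
          using hadd[of j "i - j"] that by simp
        ultimately have hG: "h (i - j) \<in> G" by simp
        have "i - j dvd (fact m :: nat)" using that by (intro dvd_fact) auto
        then obtain q :: nat where q: "fact m = q * (i - j)" by (metis dvd_def mult.commute)
        have "(\<Sum>_<q. h (i - j)) = h (q * (i - j))"
          by (induction q) (simp_all add: hadd add.commute, simp add: h_def)
        then show False using Gmult[OF hG, of q] u s q by (simp add: h_def)
      qed
      have conj: "mean_zero (\<lambda>t. cnj (g t))" if "mean_zero g" for g :: "'t \<Rightarrow> complex"
      proof -
        have "(\<Sum>h\<leftarrow>H. cnj (g (t + h))) = cnj (\<Sum>h\<leftarrow>H. g (t + h))" for H t
          by (induction H) simp_all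
        then have "avg H (\<lambda>t. cnj (g t)) t = cnj (avg H g t)" for H t
          by (simp add: avg_def)
        then show ?thesis using that unfolding mean_zero_def by simp
      qed
      have lt: "mean_zero (\<lambda>t. f (t + h i) * cnj (f (t + h j)))" if "i < m" "j < i" for i j
        using shift[OF mz[OF hdiff[OF that]], of "h j"] by (simp add: add.assoc)
      have "mean_zero (\<lambda>t. f (t + h i) * cnj (f (t + h j)))" if "i < m" "j < m" "i \<noteq> j" for i j
        using lt[of i j] conj[OF lt[of j i]] that by (cases "j < i") (auto simp: mult.commute)
      then show "\<exists>h. \<forall>i<m. \<forall>j<m. i \<noteq> j \<longrightarrow> mean_zero (\<lambda>t. f (t + h i) * cnj (f (t + h j)))"
        by blast
    qed (rule Suc.prems)
  qed
qed simp

section \<open>Arithmetic of the adele ring\<close>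

lemma padic_abs_fraction_le_1:
  assumes p: "prime p" and b: "\<not> int p dvd b" shows "padic_abs p (of_int a / of_int b) \<le> 1"
proof (cases "a = 0")
  case False
  have "b \<noteq> 0" using b by auto
  then have "padic_abs p (of_int a / of_int b) = real p powi (- int (multiplicity (int p) a))"
    using padic_abs_divide[OF p _ False, of b] not_dvd_imp_multiplicity_0[OF b] by simp
  also have "\<dots> \<le> real p powi 0"
    using prime_ge_1_nat[OF p] by (intro power_int_increasing) auto
  finally show ?thesis by simp
qed simp

lemma padic_abs_int_le_1: "prime p \<Longrightarrow> padic_abs p (of_int a) \<le> 1"
  using padic_abs_fraction_le_1[of p 1 a] by (auto dest: prime_gt_1_nat)

lemma padic_of_rat_in_Zp_iff: "prime p \<Longrightarrow> padic_of_rat p q \<in> Zp p \<longleftrightarrow> padic_abs p q \<le> 1"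
  by (simp add: Zp_def padic_of_rat_in_Qp padic_norm_of_rat)

lemma rat_in_Ints_iff_padic_abs: "q \<in> \<int> \<longleftrightarrow> (\<forall>p. prime p \<longrightarrow> padic_abs p q \<le> 1)"
proof
  assume int: "\<forall>p. prime p \<longrightarrow> padic_abs p q \<le> 1"
  obtain a b where ab: "quotient_of q = (a, b)" by fastforce
  have b: "b > 0" "coprime a b" "q = of_int a / of_int b"
    using ab quotient_of_denom_pos quotient_of_coprime quotient_of_div by blast+
  have "\<not> p dvd nat b" if p: "prime p" for p
  proof
    assume "p dvd nat b"
    then have pb: "int p dvd b" using b(1) by (metis int_dvd_int_iff int_nat_eq less_imp_le)
    then have pa: "\<not> int p dvd a"
      using b(2) p by (metis coprime_common_divisor not_prime_unit prime_nat_int_transfer)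
    then have "a \<noteq> 0" by auto
    have "multiplicity (int p) b > 0"
      using pb b(1) p by (simp add: prime_multiplicity_gt_zero_iff)
    then have "real p powi 0 < real p powi (int (multiplicity (int p) b) - int (multiplicity (int p) a))"
      using prime_gt_1_nat[OF p] not_dvd_imp_multiplicity_0[OF pa] by (intro power_int_strict_increasing) auto
    then have "padic_abs p q > 1"
      unfolding b(3) using padic_abs_divide[OF p, of b a] b(1) \<open>a \<noteq> 0\<close> by simp
    then show False using int p by (meson not_le)
  qed
  then have "nat b = 1" using prime_factor_nat by blast
  then have "b = 1" by simp
  then show "q \<in> \<int>" using b(3) by simp
qed (auto simp: padic_abs_int_le_1 elim!: Ints_cases)

section \<open>Strong approximation\<close>

text \<open>The subring R times all Z_p, without condition at the real place. Its rational elements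
  are the integers, which makes the character below independent of choices.\<close>

definition integral_adeles :: "adele set" where
  "integral_adeles = {a. \<forall>p. prime p \<longrightarrow> adele_padic p a \<in> Zp p}"

lemma integral_adeles_closed:
  assumes "a \<in> integral_adeles" "b \<in> integral_adeles"
  shows "a + b \<in> integral_adeles" "a * b \<in> integral_adeles" "- a \<in> integral_adeles" "a - b \<in> integral_adeles"
proof -
  have a: "a + b \<in> integral_adeles" "a * b \<in> integral_adeles" "- a \<in> integral_adeles"
    if "a \<in> integral_adeles" "b \<in> integral_adeles" for a b
    using that by (auto simp: integral_adeles_def Zp_closed)
  then show "a + b \<in> integral_adeles" "a * b \<in> integral_adeles" "- a \<in> integral_adeles"
    using assms by auto
  show "a - b \<in> integral_adeles"
    unfolding minus_adele_def by (rule a(1)[OF assms(1) a(3)[OF assms(2,2)]])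
qed

lemma adele_of_rat_diff: "adele_of_rat (q - r) = adele_of_rat q - adele_of_rat r"
  unfolding diff_conv_add_uminus by (simp only: adele_of_rat_hom)

lemma adele_real_diff [simp]: "adele_real (a - b) = adele_real a - adele_real b"
  unfolding minus_adele_def adele_real_ops by simp

lemma adele_padic_diff: "prime p \<Longrightarrow> adele_padic p (a - b) = adele_padic p a \<ominus>\<^bsub>Qp p\<^esub> adele_padic p b"
  by (simp only: minus_adele_def adele_padic_ops a_minus_def)

lemma adele_of_rat_integral_iff: "adele_of_rat q \<in> integral_adeles \<longleftrightarrow> q \<in> \<int>"
  by (simp add: integral_adeles_def padic_of_rat_in_Zp_iff rat_in_Ints_iff_padic_abs)

text \<open>A late term of a Cauchy sequence representing \<open>x\<close> is close enough.\<close>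

lemma padic_approx_rat:
  assumes p: "prime p" and x: "x \<in> carrier (Qp p)"
  obtains s where "x \<ominus>\<^bsub>Qp p\<^esub> padic_of_rat p s \<in> Zp p"
proof -
  interpret cring "Qp p" by (rule Qp_cring[OF p])
  obtain s where s: "x = padic_class p s" "padic_Cauchy p s"
    using x by (auto simp: carrier_Qp)
  obtain N where N: "\<forall>m\<ge>N. \<forall>n\<ge>N. padic_abs p (s m - s n) < 1"
    using s(2) unfolding padic_Cauchy_def by (meson zero_less_one)
  have C: "padic_Cauchy p (\<lambda>n. s n + - s N)"
    by (rule padic_Cauchy_add[OF p s(2)]) simp
  have eq: "x \<ominus>\<^bsub>Qp p\<^esub> padic_of_rat p (s N) = padic_class p (\<lambda>n. s n + - s N)"
    unfolding s(1) a_minus_def padic_of_rat_eq_class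
    by (simp add: Qp_a_inv[OF p] Qp_ops(3)[OF p s(2)])
  have "padic_norm p (padic_class p (\<lambda>n. s n + - s N)) \<le> 1"
    by (rule LIMSEQ_le_const2[OF padic_norm_class[OF p C]])
      (use N in \<open>auto intro!: exI[of _ N] less_imp_le\<close>)
  moreover have "x \<ominus>\<^bsub>Qp p\<^esub> padic_of_rat p (s N) \<in> carrier (Qp p)"
    using x padic_of_rat_in_Qp by (rule minus_closed)
  ultimately show thesis by (intro that[of "s N"]) (simp add: Zp_def eq)
qed

text \<open>Partial fractions: Bezout for \<open>p ^ k\<close> and the prime-to-\<open>p\<close>
  part \<open>b'\<close> of the denominator splits \<open>s\<close>, and \<open>q\<close> is the
  summand over \<open>p ^ k\<close>. Subtracting it repairs the place \<open>p\<close> without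
  damaging another.\<close>

lemma rat_principal_part:
  assumes p: "prime p"
  obtains q where "padic_abs p (s - q) \<le> 1" "\<And>l. prime l \<Longrightarrow> l \<noteq> p \<Longrightarrow> padic_abs l q \<le> 1"
proof -
  obtain a b where ab: "b > 0" "s = (of_int a / of_int b :: rat)" by (rule rat_as_fraction)
  obtain k b' where b: "b = int p ^ k * b'" "\<not> int p dvd b'"
    using multiplicity_decompose'[of b "int p"] ab(1) prime_gt_1_nat[OF p]
    by (metis int_dvd_int_iff mult.commute nat_int not_prime_unit order_less_irrefl p prime_nat_int_transfer)
  have b0: "b' \<noteq> 0" using b(2) by auto
  have "coprime (int p) b'" using b(2) p by (simp add: prime_imp_coprime)
  then have "coprime b' (int p ^ k)" by (simp add: coprime_commute)
  then obtain u v where uv: "u * b' + v * int p ^ k = 1"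
    using bezout_int[of b' "int p ^ k"] by (auto simp: coprime_iff_gcd_eq_1)
  define q :: rat where "q = of_int (a * u) / of_int (int p ^ k)"
  have p0: "p \<noteq> 0" using prime_gt_0_nat[OF p] by simp
  then have pk: "(of_int (int p ^ k) :: rat) \<noteq> 0" by simp
  have uv': "(of_int u * of_int b' + of_int v * of_int (int p ^ k) :: rat) = 1"
    using arg_cong[OF uv, of "of_int :: int \<Rightarrow> rat"] by simp
  have "s - q = of_int a * (1 - of_int u * of_int b') / (of_int (int p ^ k) * of_int b')"
    using p0 b0 unfolding ab(2) q_def b(1) by (simp add: divide_simps algebra_simps)
  also have "1 - of_int u * of_int b' = (of_int v * of_int (int p ^ k) :: rat)"
    using uv' by linarith
  finally have "s - q = of_int (a * v) / of_int b'" using p0 by simp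
  then have "padic_abs p (s - q) \<le> 1" using padic_abs_fraction_le_1[OF p b(2), of "a * v"] by simp
  moreover have "padic_abs l q \<le> 1" if "prime l" "l \<noteq> p" for l
  proof -
    have "\<not> int l dvd int p ^ k"
      using that p by (metis int_dvd_int_iff of_nat_power prime_dvd_power primes_dvd_imp_eq)
    then show ?thesis unfolding q_def using padic_abs_fraction_le_1 that(1) by blast
  qed
  ultimately show thesis by (rule that)
qed

lemma strong_approximation: obtains q where "a - adele_of_rat q \<in> integral_adeles"
proof -
  have fin: "finite {p \<in> primes. adele_padic p a \<notin> Zp p}"
    using Rep_adele[of a] by (simp add: adele_padic.rep_eq case_prod_unfold)
  \<comment> \<open>\<open>S\<close> is only a superset of the bad primes, so the induction
    hypothesis still applies after \<open>a\<close> has been corrected at \<open>p\<close>.\<close>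
  have "finite S \<Longrightarrow> {p \<in> primes. adele_padic p a \<notin> Zp p} \<subseteq> S \<Longrightarrow> \<exists>q. a - adele_of_rat q \<in> integral_adeles" for S a
  proof (induction S arbitrary: a rule: finite_induct)
    case empty
    then show ?case by (intro exI[of _ 0]) (auto simp: integral_adeles_def adele_of_rat_hom)
  next
    case (insert p S)
    show ?case
    proof (cases "prime p")
      case True
      interpret cring "Qp p" by (rule Qp_cring[OF True])
      obtain s where s: "adele_padic p a \<ominus>\<^bsub>Qp p\<^esub> padic_of_rat p s \<in> Zp p"
        using padic_approx_rat[OF True adele_padic_in_Qp[OF True]] .
      obtain q where q: "padic_abs p (s - q) \<le> 1" "\<And>l. prime l \<Longrightarrow> l \<noteq> p \<Longrightarrow> padic_abs l q \<le> 1"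
        using rat_principal_part[OF True] by blast
      have "adele_padic l (a - adele_of_rat q) \<in> Zp l" if l: "prime l" "l \<notin> S" for l
      proof (cases "l = p")
        case False
        then have "adele_padic l a \<in> Zp l" using insert.prems l by auto
        moreover have "padic_of_rat l q \<in> Zp l" using q(2) l(1) False by (simp add: padic_of_rat_in_Zp_iff)
        ultimately show ?thesis
          using l(1) by (simp add: adele_padic_diff a_minus_def Zp_closed)
      next
        case l: True
        have "x \<ominus>\<^bsub>Qp p\<^esub> z = (x \<ominus>\<^bsub>Qp p\<^esub> y) \<oplus>\<^bsub>Qp p\<^esub> (y \<ominus>\<^bsub>Qp p\<^esub> z)"
          if "x \<in> carrier (Qp p)" "y \<in> carrier (Qp p)" "z \<in> carrier (Qp p)" for x y z
          using that by algebra
        from this[OF adele_padic_in_Qp[OF True, of a] padic_of_rat_in_Qp[of p s] padic_of_rat_in_Qp[of p q]]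
        have "adele_padic p (a - adele_of_rat q) =
            (adele_padic p a \<ominus>\<^bsub>Qp p\<^esub> padic_of_rat p s) \<oplus>\<^bsub>Qp p\<^esub> padic_of_rat p (s - q)"
          unfolding diff_conv_add_uminus[of s q] padic_of_rat_hom[OF True] adele_padic_diff[OF True] adele_padic_ops[OF True]
          by (simp only: a_minus_def)
        moreover have "padic_of_rat p (s - q) \<in> Zp p" using q(1) True by (simp add: padic_of_rat_in_Zp_iff)
        ultimately show ?thesis using s Zp_closed(1)[OF True] l by simp
      qed
      then have "{l \<in> primes. adele_padic l (a - adele_of_rat q) \<notin> Zp l} \<subseteq> S" by blast
      then obtain r where "(a - adele_of_rat q) - adele_of_rat r \<in> integral_adeles"
        using insert.IH by blast
      then show ?thesis by (intro exI[of _ "q + r"]) (simp add: adele_of_rat_hom diff_diff_eq)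
    next
      case False
      then show ?thesis using insert by auto
    qed
  qed
  then show thesis using fin that by blast
qed

section \<open>The standard character\<close>

text \<open>The product of the exponential at the real place and the inverse fractional-part
  characters at the primes: a rational with the same fractional parts collects the latter and is
  determined up to an integer.\<close>

definition adele_char :: "adele \<Rightarrow> complex" where
  "adele_char a = cis (2 * pi * adele_real (a - adele_of_rat (SOME q. a - adele_of_rat q \<in> integral_adeles)))"

lemma cis_2pi_Ints: "x \<in> \<int> \<Longrightarrow> cis (2 * pi * x) = 1"
  by (auto elim!: Ints_cases simp: complex_eq_iff cos_int_2pin sin_int_2pin)

lemma adele_char_eq:
  assumes q: "a - adele_of_rat q \<in> integral_adeles"
  shows "adele_char a = cis (2 * pi * adele_real (a - adele_of_rat q))"
proof -
  define r where "r = (SOME q. a - adele_of_rat q \<in> integral_adeles)"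
  have r: "a - adele_of_rat r \<in> integral_adeles" unfolding r_def using q by (rule someI)
  have "adele_of_rat (q - r) = (a - adele_of_rat r) - (a - adele_of_rat q)"
    by (simp add: adele_of_rat_diff)
  then have "adele_of_rat (q - r) \<in> integral_adeles"
    using integral_adeles_closed(4)[OF r q] by simp
  then have "q - r \<in> \<int>" by (simp add: adele_of_rat_integral_iff)
  then have "(of_rat (q - r) :: real) \<in> \<int>" by (auto elim!: Ints_cases)
  then have one: "cis (2 * pi * of_rat (q - r)) = 1" by (rule cis_2pi_Ints)
  have eq: "2 * pi * adele_real (a - adele_of_rat r) =
      2 * pi * adele_real (a - adele_of_rat q) + 2 * pi * of_rat (q - r)"
    by (simp add: of_rat_diff algebra_simps)
  show ?thesis
    unfolding adele_char_def r_def[symmetric] eq by (simp only: one flip: cis_mult) simp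
qed

lemma norm_adele_char [simp]: "norm (adele_char a) = 1"
  by (simp add: adele_char_def)

lemma adele_char_add: "adele_char (a + b) = adele_char a * adele_char b"
proof -
  obtain q where q: "a - adele_of_rat q \<in> integral_adeles" by (rule strong_approximation)
  obtain r where r: "b - adele_of_rat r \<in> integral_adeles" by (rule strong_approximation)
  have "(a + b) - adele_of_rat (q + r) \<in> integral_adeles"
    using integral_adeles_closed(1)[OF q r] by (simp add: adele_of_rat_hom algebra_simps)
  then show ?thesis
    by (simp add: adele_char_eq[OF q] adele_char_eq[OF r] adele_char_eq cis_mult
        of_rat_add algebra_simps)
qed

lemma adele_char_of_rat [simp]: "adele_char (adele_of_rat q) = 1"
proof -
  have "adele_of_rat q - adele_of_rat q \<in> integral_adeles"
    using adele_of_rat_integral_iff[of 0] by (simp add: adele_of_rat_hom)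
  then show ?thesis using adele_char_eq[of "adele_of_rat q" q] by (simp add: zero_adele_def)
qed

lemma adele_char_0 [simp]: "adele_char 0 = 1"
  using adele_char_of_rat[of 0] by (simp add: adele_of_rat_hom)

lemma adele_char_minus: "adele_char (- a) = cnj (adele_char a)"
proof -
  have "adele_char a * adele_char (- a) = adele_char a * cnj (adele_char a)"
    unfolding adele_char_add[symmetric] by (simp flip: complex_norm_square)
  moreover have "adele_char a \<noteq> 0" by (metis norm_adele_char norm_zero zero_neq_one)
  ultimately show ?thesis by simp
qed

section \<open>Neighbourhoods of zero in the adele ring\<close>

text \<open>The second condition is divisibility by \<open>N\<close> in every \<open>Zp p\<close>.
  These sets are a neighbourhood basis of zero with one real and one integer parameter.\<close>

definition adele_ball :: "real \<Rightarrow> nat \<Rightarrow> adele set" where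
  "adele_ball e N = {c. \<bar>adele_real c\<bar> < e \<and> adele_of_rat (1 / of_nat N) * c \<in> integral_adeles}"

lemma adele_ball_mono:
  assumes "e \<le> e'" "N' dvd N" "N > 0"
  shows "adele_ball e N \<subseteq> adele_ball e' N'"
proof
  fix c assume c: "c \<in> adele_ball e N"
  obtain k where k: "N = N' * k" using assms(2) by blast
  have "adele_of_rat (1 / of_nat N') * c = adele_of_rat (of_nat k) * (adele_of_rat (1 / of_nat N) * c)"
    using k assms(3) by (simp flip: mult.assoc adele_of_rat_hom(4))
  moreover have "adele_of_rat (of_nat k) \<in> integral_adeles"
    by (simp add: adele_of_rat_integral_iff)
  ultimately show "c \<in> adele_ball e' N'"
    using c assms(1) integral_adeles_closed(2) by (auto simp: adele_ball_def)
qed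

lemma adele_ball_integral:
  assumes "c \<in> adele_ball e N" "N > 0" shows "c \<in> integral_adeles"
proof -
  have "c \<in> adele_ball e 1" using adele_ball_mono[of e e 1 N] assms by auto
  then show ?thesis by (simp add: adele_ball_def adele_of_rat_hom)
qed

lemma adele_zeroI:
  assumes "\<And>e N. e > 0 \<Longrightarrow> N > 0 \<Longrightarrow> c \<in> adele_ball e N" shows "c = 0"
proof (rule adele_eqI)
  have "\<bar>adele_real c\<bar> \<le> 0"
    by (rule dense_ge) (use assms[of _ 1] in \<open>auto simp: adele_ball_def intro: less_imp_le\<close>)
  then show "adele_real c = adele_real 0" by (simp add: zero_adele_def)
  fix p :: nat assume p: "prime p"
  have cp: "adele_padic p c \<in> carrier (Qp p)" by (rule adele_padic_in_Qp[OF p])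
  have le: "padic_norm p (adele_padic p c) \<le> inverse (real p) ^ m" for m
  proof -
    have "c \<in> adele_ball 1 (p ^ m)" using assms p by (simp add: prime_gt_0_nat)
    then have "padic_of_rat p (1 / of_nat (p ^ m)) \<otimes>\<^bsub>Qp p\<^esub> adele_padic p c \<in> Zp p"
      using p by (simp add: adele_ball_def integral_adeles_def)
    then have "padic_abs p (1 / of_nat (p ^ m)) * padic_norm p (adele_padic p c) \<le> 1"
      by (simp add: Zp_def padic_norm_mult[OF p] padic_of_rat_in_Qp cp padic_norm_of_rat[OF p])
    moreover have "padic_abs p (1 / of_nat (p ^ m)) = real p ^ m"
      using padic_abs_divide[OF p, of "int p ^ m" 1] p
      by (simp add: prime_gt_0_nat multiplicity_same_power)
    ultimately show ?thesis using p by (simp add: power_inverse field_simps prime_gt_0_nat)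
  qed
  have "(\<lambda>m. inverse (real p) ^ m) \<longlonglongrightarrow> 0"
    using prime_gt_1_nat[OF p] by (intro LIMSEQ_realpow_zero) (auto simp: inverse_less_1_iff)
  then have "padic_norm p (adele_padic p c) \<le> 0"
    by (rule LIMSEQ_le_const) (use le in blast)
  then have "adele_padic p c = \<zero>\<^bsub>Qp p\<^esub>"
    using padic_norm_nonneg[OF p cp] padic_norm_eq_0[OF p cp] by linarith
  then show "adele_padic p c = adele_padic p 0"
    using p by (simp add: zero_adele_def padic_of_rat_hom)
qed

text \<open>Discreteness of the rationals: two rationals approximating \<open>b\<close> with
  integral finite errors and real errors below \<open>1/2\<close> differ by an integer of modulus
  below 1. So one \<open>q\<close> serves all balls, and \<open>b - q\<close> is zero.\<close>

lemma adele_in_range_of_ratI: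
  assumes "\<And>e N. e > 0 \<Longrightarrow> N > 0 \<Longrightarrow> \<exists>q. b - adele_of_rat q \<in> adele_ball e N"
  shows "b \<in> range adele_of_rat"
proof -
  obtain q where q: "b - adele_of_rat q \<in> adele_ball (1/2) 1" using assms[of "1/2" 1] by auto
  have "b - adele_of_rat q \<in> adele_ball e N" if eN: "e > 0" "N > 0" for e N
  proof -
    obtain r where r: "b - adele_of_rat r \<in> adele_ball (min e (1/2)) N"
      using assms[of "min e (1/2)" N] eN by auto
    have "adele_of_rat (q - r) = (b - adele_of_rat r) - (b - adele_of_rat q)"
      by (simp add: adele_of_rat_diff)
    then have "adele_of_rat (q - r) \<in> integral_adeles"
      using integral_adeles_closed(4)[OF adele_ball_integral[OF r eN(2)] adele_ball_integral[OF q]] by simp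
    then have int: "q - r \<in> \<int>" by (simp add: adele_of_rat_integral_iff)
    have "\<bar>adele_real (b - adele_of_rat q)\<bar> < 1/2" "\<bar>adele_real (b - adele_of_rat r)\<bar> < 1/2"
      using q r by (auto simp: adele_ball_def)
    then have "\<bar>of_rat (q - r) :: real\<bar> < 1" unfolding of_rat_diff adele_real_diff adele_real_ops by linarith
    then have "\<bar>q - r\<bar> < 1" by (metis of_rat_1 of_rat_less abs_of_rat)
    then have "q = r" using Ints_nonzero_abs_less1[OF int] by simp
    then show ?thesis using r adele_ball_mono[of "min e (1/2)" e N N] eN by auto
  qed
  then have "b - adele_of_rat q = 0" by (rule adele_zeroI)
  then show ?thesis by simp
qed

text \<open>Once \<open>z / N - q\<close> is integral at the primes, only the real component
  remains. Subtracting the integer \<open>k\<close> preserves integrality, so the approximating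
  rational is \<open>N (q + k)\<close>.\<close>

lemma adele_ballI_small_real:
  assumes "N > 0" "adele_of_rat (1 / of_nat N) * z - adele_of_rat q \<in> integral_adeles"
    and "\<bar>adele_real (adele_of_rat (1 / of_nat N) * z - adele_of_rat q) - of_int k\<bar> < e / real N"
  shows "\<exists>q. z - adele_of_rat q \<in> adele_ball e N"
proof -
  let ?q = "of_nat N * (q + of_int k)"
  have eq: "adele_of_rat (1 / of_nat N) * (z - adele_of_rat ?q)
      = adele_of_rat (1 / of_nat N) * z - adele_of_rat q - adele_of_rat (of_int k)"
    using assms(1) by (simp add: right_diff_distrib adele_of_rat_hom(3) diff_diff_eq flip: adele_of_rat_hom(4))
  have "adele_of_rat (1 / of_nat N) * (z - adele_of_rat ?q) \<in> integral_adeles"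
    unfolding eq using assms(2) by (rule integral_adeles_closed(4)) (simp add: adele_of_rat_integral_iff)
  moreover have "\<bar>adele_real (adele_of_rat (1 / of_nat N) * (z - adele_of_rat ?q))\<bar> < e / real N"
    unfolding eq using assms(3) by simp
  then have "\<bar>adele_real (z - adele_of_rat ?q)\<bar> < e"
    using assms(1) by (simp add: of_rat_divide abs_mult divide_less_cancel)
  ultimately show ?thesis unfolding adele_ball_def by blast
qed

text \<open>The rationals are their own annihilator. Taking \<open>s = 1 / N\<close>, the trivial
  value puts the real component of an integral representative of \<open>b / N\<close> at an integer,
  so \<open>b\<close> lies in every ball around the rationals.\<close>

lemma adele_char_detects_rat:
  assumes "\<And>s. adele_char (adele_of_rat s * b) = 1"
  shows "b \<in> range adele_of_rat"
proof (rule adele_in_range_of_ratI)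
  fix e :: real and N :: nat assume eN: "e > 0" "N > 0"
  obtain q where q: "adele_of_rat (1 / of_nat N) * b - adele_of_rat q \<in> integral_adeles"
    by (rule strong_approximation)
  have "cis (2 * pi * adele_real (adele_of_rat (1 / of_nat N) * b - adele_of_rat q)) = 1"
    using assms adele_char_eq[OF q] by metis
  then have "cos (2 * pi * adele_real (adele_of_rat (1 / of_nat N) * b - adele_of_rat q)) = 1"
    by (simp add: complex_eq_iff)
  then obtain k where "2 * pi * adele_real (adele_of_rat (1 / of_nat N) * b - adele_of_rat q) = of_int k * 2 * pi"
    by (auto simp: cos_one_2pi_int)
  then have "adele_real (adele_of_rat (1 / of_nat N) * b - adele_of_rat q) = of_int k" by simp
  then show "\<exists>q. b - adele_of_rat q \<in> adele_ball e N"
    using adele_ballI_small_real[OF eN(2) q, of k e] eN by simp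
qed

text \<open>The single frequency \<open>1 / N\<close> decides whether \<open>z\<close> is near a
  rational. The quantity compared with the threshold \<open>d\<close> is the factor from which the
  kernel is built.\<close>

lemma adele_char_near_1:
  assumes "e > 0" "N > 0"
  shows "\<exists>d\<ge>0. d < 1 \<and> (\<forall>z. (1 + Re (adele_char (adele_of_rat (1 / of_nat N) * z))) / 2 > d \<longrightarrow>
     (\<exists>q. z - adele_of_rat q \<in> adele_ball e N))"
proof -
  \<comment> \<open>\<open>e / N\<close> is the real radius after scaling by \<open>1 / N\<close>;
    \<open>1/4\<close> keeps the angle \<open>2 pi h\<close> where cosine is strictly
    decreasing.\<close>
  define h where "h = min (e / real N) (1/4)"
  have h: "h > 0" "h \<le> 1/4" "h \<le> e / real N"
    using assms min.cobounded1[of "e / real N" "1/4"] min.cobounded2[of "e / real N" "1/4"]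
    unfolding h_def by auto
  show ?thesis
  proof (intro exI[of _ "(1 + cos (2 * pi * h)) / 2"] conjI allI impI)
    show "0 \<le> (1 + cos (2 * pi * h)) / 2"
      by (simp add: real_0_le_add_iff)
    have "cos (2 * pi * h) < cos 0" using h by (intro cos_monotone_0_pi) auto
    then show "(1 + cos (2 * pi * h)) / 2 < 1" by simp
    fix z assume z: "(1 + Re (adele_char (adele_of_rat (1 / of_nat N) * z))) / 2 > (1 + cos (2 * pi * h)) / 2"
    obtain q where q: "adele_of_rat (1 / of_nat N) * z - adele_of_rat q \<in> integral_adeles"
      by (rule strong_approximation)
    define x where "x = adele_real (adele_of_rat (1 / of_nat N) * z - adele_of_rat q)"
    define y where "y = \<bar>x - of_int (round x)\<bar>"
    have y: "y \<le> 1/2" "y \<ge> 0"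
      using of_int_round_abs_le[of x] by (auto simp: y_def abs_minus_commute)
    have "cos (2 * pi * y) = cos (2 * pi * (x - of_int (round x)))"
      unfolding y_def by (metis abs_mult abs_of_pos cos_abs_real pi_gt_zero mult_pos_pos zero_less_numeral)
    also have "\<dots> = Re (cis (2 * pi * x) * cis (2 * pi * of_int (- round x)))"
      by (simp only: cis_mult) (simp add: right_diff_distrib)
    also have "\<dots> = cos (2 * pi * x)" by (subst cis_2pi_Ints) auto
    also have "\<dots> = Re (adele_char (adele_of_rat (1 / of_nat N) * z))"
      unfolding adele_char_eq[OF q] x_def by simp
    finally have "cos (2 * pi * h) < cos (2 * pi * y)" using z by simp
    then have "2 * pi * y < 2 * pi * h"
      using cos_mono_less_eq[of "2 * pi * h" "2 * pi * y"] y h by simp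
    then have "y < e / real N" using h by simp
    then show "\<exists>q. z - adele_of_rat q \<in> adele_ball e N"
      using adele_ballI_small_real[OF assms(2) q, of "round x" e] by (simp add: x_def y_def)
  qed
qed

section \<open>The topology of adelic space and of the solenoid\<close>

lemma padic_abs_inverse_nat:
  assumes p: "prime p" and N: "N > 0"
  shows "padic_abs p (1 / of_nat N) = real p ^ multiplicity (int p) (int N)"
  using padic_abs_divide[OF p, of "int N" 1] N by simp

text \<open>By the ultrametric inequality this closed ball of radius
  \<open>1 / padic_abs p c\<close> contains the open ball of the same radius around each of its
  points.\<close>

lemma padic_scaled_ball_open:
  assumes p: "prime p" and y: "y \<in> carrier (Qp p)" and c: "c \<noteq> 0"
  shows "openin (padic_topology p) {x \<in> carrier (Qp p). padic_of_rat p c \<otimes>\<^bsub>Qp p\<^esub> (x \<ominus>\<^bsub>Qp p\<^esub> y) \<in> Zp p}"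
proof -
  interpret M: Metric_space "carrier (Qp p)" "padic_dist p" by (rule Metric_space_Qp[OF p])
  interpret cring "Qp p" by (rule Qp_cring[OF p])
  let ?U = "{x \<in> carrier (Qp p). padic_of_rat p c \<otimes>\<^bsub>Qp p\<^esub> (x \<ominus>\<^bsub>Qp p\<^esub> y) \<in> Zp p}"
  have c0: "padic_abs p c > 0" using p c by (rule padic_abs_pos)
  have mem: "x \<in> ?U \<longleftrightarrow> padic_abs p c * padic_norm p (x \<ominus>\<^bsub>Qp p\<^esub> y) \<le> 1" if "x \<in> carrier (Qp p)" for x
    using that y by (simp add: Zp_def padic_norm_mult[OF p] padic_of_rat_in_Qp padic_norm_of_rat[OF p])
  show ?thesis
    unfolding padic_topology_def M.openin_mtopology
  proof (intro conjI allI impI)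
    fix x assume x: "x \<in> ?U"
    then have xc: "x \<in> carrier (Qp p)" by simp
    have "M.mball x (1 / padic_abs p c) \<subseteq> ?U"
    proof
      fix z assume "z \<in> M.mball x (1 / padic_abs p c)"
      then have z: "z \<in> carrier (Qp p)" "padic_dist p z x < 1 / padic_abs p c"
        by (auto simp: M.commute)
      have zx: "padic_norm p (z \<ominus>\<^bsub>Qp p\<^esub> x) < 1 / padic_abs p c"
        using z xc by (simp add: padic_dist_def)
      have "z \<ominus>\<^bsub>Qp p\<^esub> y = (z \<ominus>\<^bsub>Qp p\<^esub> x) \<oplus>\<^bsub>Qp p\<^esub> (x \<ominus>\<^bsub>Qp p\<^esub> y)"
        using z(1) xc y by algebra
      then have "padic_norm p (z \<ominus>\<^bsub>Qp p\<^esub> y) \<le> max (padic_norm p (z \<ominus>\<^bsub>Qp p\<^esub> x)) (padic_norm p (x \<ominus>\<^bsub>Qp p\<^esub> y))"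
        using padic_norm_add[OF p minus_closed[OF z(1) xc] minus_closed[OF xc y]] by simp
      also have "\<dots> \<le> 1 / padic_abs p c"
        using zx x mem[OF xc] c0 by (auto simp: field_simps)
      finally show "z \<in> ?U" using mem[OF z(1)] c0 by (simp add: field_simps)
    qed
    then show "\<exists>r>0. M.mball x r \<subseteq> ?U" using c0 by (intro exI[of _ "1 / padic_abs p c"]) simp
  qed auto
qed

lemma adele_ball_translate_open:
  assumes "N > 0"
  shows "open {a. a - y \<in> adele_ball e N}"
proof -
  let ?c = "1 / of_nat N :: rat"
  define W where "W = {adele_real y - e<..<adele_real y + e}"
  define U where "U p = {x \<in> carrier (Qp p). padic_of_rat p ?c \<otimes>\<^bsub>Qp p\<^esub> (x \<ominus>\<^bsub>Qp p\<^esub> adele_padic p y) \<in> Zp p}" for p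
  have eq: "{a. a - y \<in> adele_ball e N} = {a. adele_real a \<in> W \<and> (\<forall>p\<in>primes. adele_padic p a \<in> U p)}"
    by (auto simp: adele_ball_def W_def U_def integral_adeles_def adele_padic_in_Qp adele_padic_diff)
  have "finite {p \<in> primes. adele_padic p y \<notin> Zp p}"
    using Rep_adele[of y] by (simp add: adele_padic.rep_eq case_prod_unfold)
  \<comment> \<open>A basic open set must be \<open>Zp p\<close> at almost all primes; the
    exceptions here are the divisors of \<open>N\<close> and the primes where \<open>y\<close> is
    not integral.\<close>
  moreover have "U p = Zp p" if p: "prime p" "\<not> p dvd N" "adele_padic p y \<in> Zp p" for p
  proof -
    interpret cring "Qp p" by (rule Qp_cring[OF p(1)])
    have 1: "padic_abs p ?c = 1"
      using padic_abs_inverse_nat[OF p(1) assms] p(2) by (simp add: not_dvd_imp_multiplicity_0)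
    have yc: "adele_padic p y \<in> carrier (Qp p)" using p(3) Zp_subset by blast
    have mem: "x \<in> U p \<longleftrightarrow> x \<ominus>\<^bsub>Qp p\<^esub> adele_padic p y \<in> Zp p" if "x \<in> carrier (Qp p)" for x
      using that yc 1 unfolding U_def
      by (simp add: Zp_def padic_norm_mult[OF p(1)] padic_of_rat_in_Qp padic_norm_of_rat[OF p(1)])
    have "x \<in> Zp p" if "x \<in> carrier (Qp p)" "x \<ominus>\<^bsub>Qp p\<^esub> adele_padic p y \<in> Zp p" for x
    proof -
      have "x = (x \<ominus>\<^bsub>Qp p\<^esub> adele_padic p y) \<oplus>\<^bsub>Qp p\<^esub> adele_padic p y"
        using that(1) yc by algebra
      then show ?thesis using Zp_closed(1)[OF p(1) that(2) p(3)] by simp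
    qed
    moreover have "x \<ominus>\<^bsub>Qp p\<^esub> adele_padic p y \<in> Zp p" if "x \<in> Zp p" for x
      using Zp_closed[OF p(1)] that p(3) by (simp add: a_minus_def)
    moreover have "U p \<subseteq> carrier (Qp p)" by (auto simp: U_def)
    ultimately show ?thesis using mem Zp_subset[of p] by blast
  qed
  then have "{p \<in> primes. U p \<noteq> Zp p} \<subseteq> {p. p dvd N} \<union> {p \<in> primes. adele_padic p y \<notin> Zp p}" by blast
  ultimately have fin: "finite {p \<in> primes. U p \<noteq> Zp p}"
    using finite_divisors_nat[OF assms] by (meson finite_Un finite_subset)
  have op: "\<forall>p\<in>primes. openin (padic_topology p) (U p)"
    unfolding U_def using assms by (auto intro!: padic_scaled_ball_open adele_padic_in_Qp)
  have "open W" by (simp add: W_def)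
  then show ?thesis
    unfolding eq open_adele_def using fin op by (intro generate_topology.Basis) blast
qed

lemma padic_open_contains_adele_ball:
  assumes p: "prime p" and U: "openin (padic_topology p) U" and b: "adele_padic p b \<in> U"
  shows "\<exists>N>0. \<forall>a e. a - b \<in> adele_ball e N \<longrightarrow> adele_padic p a \<in> U"
proof -
  interpret M: Metric_space "carrier (Qp p)" "padic_dist p" by (rule Metric_space_Qp[OF p])
  interpret cring "Qp p" by (rule Qp_cring[OF p])
  obtain r where r: "r > 0" "M.mball (adele_padic p b) r \<subseteq> U"
    using U b unfolding padic_topology_def M.openin_mtopology by blast
  \<comment> \<open>Divisibility by \<open>p ^ m\<close> bounds the norm by
    \<open>1 / p ^ m\<close>, which is below \<open>r\<close>.\<close>
  obtain m where m: "1 / r < real p ^ m"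
    using real_arch_pow[of "real p"] prime_gt_1_nat[OF p] by auto
  have pm: "p ^ m > 0" using prime_gt_0_nat[OF p] by simp
  show ?thesis
  proof (intro exI[of _ "p ^ m"] conjI allI impI pm)
    fix a e assume a: "a - b \<in> adele_ball e (p ^ m)"
    have ab: "adele_padic p a \<in> carrier (Qp p)" "adele_padic p b \<in> carrier (Qp p)"
      using adele_padic_in_Qp[OF p] by auto
    let ?x = "adele_padic p a \<ominus>\<^bsub>Qp p\<^esub> adele_padic p b"
    have "padic_of_rat p (1 / of_nat (p ^ m)) \<otimes>\<^bsub>Qp p\<^esub> ?x \<in> Zp p"
      using a p by (simp add: adele_ball_def integral_adeles_def adele_padic_diff)
    then have "real p ^ m * padic_norm p ?x \<le> 1"
      using padic_abs_inverse_nat[OF p pm] ab p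
      by (simp add: Zp_def padic_norm_mult[OF p] padic_of_rat_in_Qp padic_norm_of_rat[OF p] multiplicity_same_power not_prime_unit)
    moreover have "1 < real p ^ m * r" using m r(1) by (simp add: field_simps)
    ultimately have "real p ^ m * padic_norm p ?x < real p ^ m * r" by linarith
    then have "padic_norm p ?x < r" using pm by simp
    then have "padic_dist p (adele_padic p a) (adele_padic p b) < r"
      using ab by (simp add: padic_dist_def)
    then have "padic_dist p (adele_padic p b) (adele_padic p a) < r"
      by (simp only: M.commute)
    then show "adele_padic p a \<in> U" using r(2) ab by auto
  qed
qed

lemma adele_open_contains_ball:
  assumes "open U" "b \<in> U"
  obtains e N where "e > 0" "N > 0" "\<And>a. a - b \<in> adele_ball e N \<Longrightarrow> a \<in> U"
proof -
  have "\<exists>e>0. \<exists>N>0. \<forall>a. a - b \<in> adele_ball e N \<longrightarrow> a \<in> U"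
    using assms unfolding open_adele_def
  proof (induction U rule: generate_topology.induct)
    case UNIV
    then show ?case using zero_less_one by blast
  next
    case (Int U V)
    then obtain e N e' N' where U: "e > 0" "N > 0" "\<And>a. a - b \<in> adele_ball e N \<Longrightarrow> a \<in> U"
      and V: "e' > 0" "N' > 0" "\<And>a. a - b \<in> adele_ball e' N' \<Longrightarrow> a \<in> V"
      by blast
    have "adele_ball (min e e') (N * N') \<subseteq> adele_ball e N" "adele_ball (min e e') (N * N') \<subseteq> adele_ball e' N'"
      using U V by (intro adele_ball_mono; simp)+
    then show ?case
      using U V by (intro exI[of _ "min e e'"] conjI exI[of _ "N * N'"]) auto
  next
    case (UN K)
    then obtain k where k: "k \<in> K" "b \<in> k" by blast
    then obtain e N where "e > 0" "N > 0" "\<forall>a. a - b \<in> adele_ball e N \<longrightarrow> a \<in> k"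
      using UN.IH by blast
    then show ?case using k(1) by (meson UnionI)
  next
    case (Basis s)
    from Basis.hyps obtain W U where W: "open W" and U: "\<forall>p\<in>primes. openin (padic_topology p) (U p)"
      and fin: "finite {p \<in> primes. U p \<noteq> Zp p}"
      and s: "s = {a. adele_real a \<in> W \<and> (\<forall>p\<in>primes. adele_padic p a \<in> U p)}"
      by blast
    let ?S = "{p \<in> primes. U p \<noteq> Zp p}"
    have b: "adele_real b \<in> W" "\<And>p. prime p \<Longrightarrow> adele_padic p b \<in> U p" using Basis.prems s by auto
    obtain e where e: "e > 0" "\<And>x. \<bar>x - adele_real b\<bar> < e \<Longrightarrow> x \<in> W"
      using W b(1) unfolding open_dist dist_real_def by blast
    have "\<forall>p\<in>?S. \<exists>N>0. \<forall>a e. a - b \<in> adele_ball e N \<longrightarrow> adele_padic p a \<in> U p"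
    proof
      fix p assume p: "p \<in> ?S"
      then have "prime p" "openin (padic_topology p) (U p)" using U by auto
      then show "\<exists>N>0. \<forall>a e. a - b \<in> adele_ball e N \<longrightarrow> adele_padic p a \<in> U p"
        using b(2) by (intro padic_open_contains_adele_ball)
    qed
    then obtain n where n: "\<forall>p\<in>?S. n p > 0 \<and> (\<forall>a e. a - b \<in> adele_ball e (n p) \<longrightarrow> adele_padic p a \<in> U p)"
      by (elim bchoice[THEN exE])
    \<comment> \<open>The modulus collects the conditions at the finitely many primes with
      \<open>U p \<noteq> Zp p\<close>; elsewhere integrality of \<open>a - b\<close> is
      enough.\<close>
    let ?N = "prod n ?S"
    have N: "?N > 0" using n by (intro prod_pos) simp
    have "a \<in> s" if a: "a - b \<in> adele_ball e ?N" for a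
    proof -
      have "adele_padic p a \<in> U p" if p: "prime p" for p
      proof (cases "p \<in> ?S")
        case True
        then have "n p dvd ?N" using fin by (intro dvd_prodI)
        then have "a - b \<in> adele_ball e (n p)" using adele_ball_mono[OF order_refl _ N] a by blast
        then show ?thesis using n True by blast
      next
        case False
        then have Up: "U p = Zp p" using p by blast
        have "adele_padic p (a - b) \<in> Zp p"
          using adele_ball_integral[OF a N] p by (simp add: integral_adeles_def)
        then have "adele_padic p ((a - b) + b) \<in> Zp p"
          using b(2)[OF p] p Up Zp_closed(1)[OF p] by (simp only: adele_padic_ops)
        then show ?thesis using Up by simp
      qed
      moreover have "adele_real a \<in> W"
        using e(2) a by (simp add: adele_ball_def)
      ultimately show ?thesis by (simp add: s)
    qed
    then show ?case using e(1) N by blast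
  qed
  then show thesis using that by blast
qed

lemma adele_vec_open_contains_ball:
  fixes U :: "(adele^'d) set"
  assumes "open U" "b \<in> U"
  shows "\<exists>e>0. \<exists>N>0. \<forall>a. (\<forall>i. a $ i - b $ i \<in> adele_ball e N) \<longrightarrow> a \<in> U"
proof -
  obtain A where A: "\<And>i. open (A i)" "\<And>i. b $ i \<in> A i" "\<And>y. (\<And>i. y $ i \<in> A i) \<Longrightarrow> y \<in> U"
    using assms unfolding open_vec_def by metis
  have "\<forall>i. \<exists>e N. e > 0 \<and> N > 0 \<and> (\<forall>a. a - b $ i \<in> adele_ball e N \<longrightarrow> a \<in> A i)"
    using adele_open_contains_ball[OF A(1,2)] by metis
  then obtain e N where eN: "\<And>i. e i > 0" "\<And>i. N i > 0" "\<And>i a. a - b $ i \<in> adele_ball (e i) (N i) \<Longrightarrow> a \<in> A i"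
    by metis
  let ?e = "Min (range e)" and ?N = "prod N UNIV"
  have pos: "?e > 0" "?N > 0" using eN by (auto intro: prod_pos)
  have "adele_ball ?e ?N \<subseteq> adele_ball (e i) (N i)" for i
    using pos by (intro adele_ball_mono) auto
  then have "a \<in> U" if "\<forall>i. a $ i - b $ i \<in> adele_ball ?e ?N" for a
    using that by (intro A(3) eN(3)) (rule subsetD, auto)
  then show ?thesis using pos by (intro exI[of _ ?e] conjI exI[of _ ?N]) auto
qed

lemma adele_vec_ball_translate_open:
  fixes y :: "adele^'d"
  assumes "N > 0"
  shows "open {a. \<forall>i. a $ i - y $ i \<in> adele_ball e N}"
  unfolding open_vec_def
  by (auto intro!: exI[of _ "\<lambda>i. {a. a - y $ i \<in> adele_ball e N}"] adele_ball_translate_open assms)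

section \<open>Closures in the solenoid through adelic approximation\<close>

lemma solenoid_proj_eq_iff: "solenoid_proj a = solenoid_proj b \<longleftrightarrow> a - b \<in> range adele_vec_of_rat"
  by (rule solenoid.abs_eq_iff)

lemma zero_in_adele_ball: "e > 0 \<Longrightarrow> 0 \<in> adele_ball e N"
  using adele_of_rat_integral_iff[of 0] adele_real_ops(4)[of 0] unfolding adele_of_rat_hom
  by (simp add: adele_ball_def)

text \<open>The preimage of a projected ball is the union of its rational translates, so projected
  balls are open. A rational vector is an arbitrary tuple, hence \<open>q\<close> may depend on the
  coordinate.\<close>

lemma solenoid_in_closure_iff:
  fixes y :: "adele^'d"
  shows "solenoid_proj y \<in> closure (solenoid_proj ` B) \<longleftrightarrow>
    (\<forall>e>0. \<forall>N>0. \<exists>b\<in>B. \<forall>i. \<exists>q. b $ i - y $ i - adele_of_rat q \<in> adele_ball e N)"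
proof (intro iffI allI impI)
  fix e :: real and N :: nat
  assume cl: "solenoid_proj y \<in> closure (solenoid_proj ` B)" and eN: "e > 0" "N > 0"
  let ?U = "solenoid_proj ` {a. \<forall>i. a $ i - y $ i \<in> adele_ball e N}"
  have "solenoid_proj -` ?U = (\<Union>v. {a. \<forall>i. a $ i - (y + adele_vec_of_rat v) $ i \<in> adele_ball e N})" (is "_ = ?R")
  proof (intro equalityI subsetI)
    fix a assume "a \<in> solenoid_proj -` ?U"
    then obtain c where c: "\<forall>i. c $ i - y $ i \<in> adele_ball e N" "solenoid_proj a = solenoid_proj c" by auto
    then obtain v where "a - c = adele_vec_of_rat v" by (auto simp: solenoid_proj_eq_iff)
    then have "a = c + adele_vec_of_rat v" by (simp add: algebra_simps)
    then show "a \<in> ?R" using c(1) by (intro UN_I[of v]) (auto simp: algebra_simps)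
  next
    fix a assume "a \<in> ?R"
    then obtain v where v: "\<forall>i. a $ i - (y + adele_vec_of_rat v) $ i \<in> adele_ball e N" by auto
    have "solenoid_proj a = solenoid_proj (a - adele_vec_of_rat v)" by (simp add: solenoid_proj_eq_iff)
    moreover have "a - adele_vec_of_rat v \<in> {a. \<forall>i. a $ i - y $ i \<in> adele_ball e N}"
      using v by (simp add: algebra_simps)
    ultimately show "a \<in> solenoid_proj -` ?U" by auto
  qed
  moreover have "open ?R" by (intro open_UN ballI adele_vec_ball_translate_open eN)
  ultimately have "open ?U" by (simp add: open_solenoid_def)
  moreover have "solenoid_proj y \<in> ?U"
    by (rule imageI) (simp add: zero_in_adele_ball eN)
  ultimately obtain x where "x \<in> solenoid_proj ` B" "x \<in> ?U"
    using cl open_Int_closure_eq_empty[of ?U "solenoid_proj ` B"] by blast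
  then obtain b c where b: "b \<in> B" "\<forall>i. c $ i - y $ i \<in> adele_ball e N" "solenoid_proj b = solenoid_proj c" by auto
  then obtain v where v: "b - c = adele_vec_of_rat v" by (auto simp: solenoid_proj_eq_iff)
  have "b $ i - y $ i - adele_of_rat (v $ i) = c $ i - y $ i" for i
  proof -
    have "(b - c) $ i = adele_of_rat (v $ i)" unfolding v by (simp add: adele_vec_of_rat_def)
    then show ?thesis by (simp add: algebra_simps)
  qed
  then show "\<exists>b\<in>B. \<forall>i. \<exists>q. b $ i - y $ i - adele_of_rat q \<in> adele_ball e N"
    using b by metis
next
  assume *: "\<forall>e>0. \<forall>N>0. \<exists>b\<in>B. \<forall>i. \<exists>q. b $ i - y $ i - adele_of_rat q \<in> adele_ball e N"
  show "solenoid_proj y \<in> closure (solenoid_proj ` B)"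
  proof (rule ccontr)
    let ?V = "- closure (solenoid_proj ` B)"
    assume "solenoid_proj y \<notin> closure (solenoid_proj ` B)"
    then have V: "solenoid_proj y \<in> ?V" "open ?V" by auto
    then have "open (solenoid_proj -` ?V)" "y \<in> solenoid_proj -` ?V" by (simp_all only: open_solenoid_def vimageI)
    from adele_vec_open_contains_ball[OF this] obtain e N where eN: "e > 0" "N > 0"
      "\<forall>a. (\<forall>i. a $ i - y $ i \<in> adele_ball e N) \<longrightarrow> a \<in> solenoid_proj -` ?V"
      by blast
    obtain b where b: "b \<in> B" "\<forall>i. \<exists>q. b $ i - y $ i - adele_of_rat q \<in> adele_ball e N"
      using * eN(1,2) by blast
    obtain q where q: "\<And>i. b $ i - y $ i - adele_of_rat (q i) \<in> adele_ball e N"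
      using choice[OF b(2)] by blast
    let ?c = "b - adele_vec_of_rat (\<chi> i. q i)"
    have "?c $ i - y $ i = b $ i - y $ i - adele_of_rat (q i)" for i
      by (simp add: adele_vec_of_rat_def)
    then have "\<forall>i. ?c $ i - y $ i \<in> adele_ball e N"
      using q by (simp only: simp_thms)
    then have "?c \<in> solenoid_proj -` ?V" using eN(3) by blast
    then have "solenoid_proj ?c \<in> ?V" by (rule vimageD)
    moreover have "b - ?c = adele_vec_of_rat (\<chi> i. q i)" by simp
    then have "solenoid_proj b = solenoid_proj ?c" unfolding solenoid_proj_eq_iff by (rule range_eqI)
    moreover have "solenoid_proj b \<in> closure (solenoid_proj ` B)"
      by (rule subsetD[OF closure_subset imageI[OF b(1)]])
    ultimately show False by simp
  qed
qed

section \<open>Polynomial maps between abelian groups\<close>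

text \<open>Degree by iterated differences makes sense between arbitrary abelian groups; here the
  source has infinite rational dimension and the target may be the adeles.\<close>

fun degree_le :: "nat \<Rightarrow> ('t::ab_group_add \<Rightarrow> 'b::ab_group_add) \<Rightarrow> bool" where
  "degree_le 0 p \<longleftrightarrow> p constant_on UNIV"
| "degree_le (Suc n) p \<longleftrightarrow> (\<forall>h. degree_le n (\<lambda>t. p (t + h) - p t))"

definition polynomial_map :: "('t::ab_group_add \<Rightarrow> 'b::ab_group_add) \<Rightarrow> bool" where
  "polynomial_map p \<longleftrightarrow> (\<exists>n. degree_le n p)"

lemma degree_le_Suc: "degree_le n p \<Longrightarrow> degree_le (Suc n) p"
proof (induction n arbitrary: p)
  case 0
  then obtain c where "\<And>t. p t = c" by (auto simp: constant_on_def)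
  then show ?case by (auto simp: constant_on_def)
next
  case (Suc n)
  show ?case
    unfolding degree_le.simps(2)[of "Suc n"] by (intro allI Suc.IH) (use Suc.prems in simp)
qed

lemma degree_le_mono: "n \<le> m \<Longrightarrow> degree_le n p \<Longrightarrow> degree_le m p"
  by (induction rule: dec_induct) (simp_all only: degree_le_Suc)

lemma degree_le_add: "degree_le n p \<Longrightarrow> degree_le n q \<Longrightarrow> degree_le n (\<lambda>t. p t + q t)"
proof (induction n arbitrary: p q)
  case (Suc n)
  have "degree_le n (\<lambda>t. (p (t + h) - p t) + (q (t + h) - q t))" for h
    by (rule Suc.IH) (use Suc.prems in auto)
  then show ?case by (simp add: algebra_simps)
qed (auto simp: constant_on_def)

lemma degree_le_comp:
  assumes "\<And>s t. f (s + t) = f s + f t"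
  shows "degree_le n p \<Longrightarrow> degree_le n (\<lambda>t. p (f t))"
  by (induction n arbitrary: p) (use assms in \<open>auto simp: constant_on_def\<close>)

lemma degree_le_hom:
  fixes f :: "'b::ab_group_add \<Rightarrow> 'c::ab_group_add"
  assumes f: "\<And>s t. f (s + t) = f s + f t"
  shows "degree_le n p \<Longrightarrow> degree_le n (\<lambda>t. f (p t))"
proof (induction n arbitrary: p)
  case (Suc n)
  have diff: "f x - f y = f (x - y)" for x y
    using f[of "x - y" y] by (simp add: algebra_simps)
  show ?case
    unfolding degree_le.simps diff by (intro allI Suc.IH) (use Suc.prems in simp)
qed (auto simp: constant_on_def)

lemma degree_le_shift: "degree_le n p \<Longrightarrow> degree_le n (\<lambda>t. p (t + k))"
proof (induction n arbitrary: p)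
  case (Suc n)
  have "degree_le n (\<lambda>t. p ((t + k) + h) - p (t + k))" for h
    by (rule Suc.IH[of "\<lambda>t. p (t + h) - p t"]) (use Suc.prems in auto)
  then show ?case by (simp add: add.assoc add.commute[of k])
qed (auto simp: constant_on_def)

lemma degree_le_const_mult:
  fixes p :: "'t::ab_group_add \<Rightarrow> 'b::comm_ring"
  shows "degree_le n p \<Longrightarrow> degree_le n (\<lambda>t. c * p t)"
  by (rule degree_le_hom) (simp add: distrib_left)

text \<open>Discrete Leibniz rule: the difference of a product is the shifted \<open>p\<close> times
  a difference of \<open>q\<close> plus a difference of \<open>p\<close> times \<open>q\<close>, and
  each term has total degree one less.\<close>

lemma degree_le_mult:
  fixes p q :: "'t::ab_group_add \<Rightarrow> 'b::comm_ring"
  shows "degree_le n p \<Longrightarrow> degree_le m q \<Longrightarrow> degree_le (n + m) (\<lambda>t. p t * q t)"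
proof (induction "n + m" arbitrary: n m p q rule: less_induct)
  case less
  show ?case
  proof (cases "n = 0 \<or> m = 0")
    case True
    then show ?thesis
    proof
      assume n: "n = 0"
      then obtain c where "\<And>t. p t = c" using less.prems by (auto simp: constant_on_def)
      then show ?thesis using n less.prems degree_le_const_mult by simp
    next
      assume m: "m = 0"
      then obtain c where "\<And>t. q t = c" using less.prems by (auto simp: constant_on_def)
      then show ?thesis using m less.prems degree_le_const_mult[of n p c] by (simp add: mult.commute)
    qed
  next
    case False
    then obtain n' m' where nm: "n = Suc n'" "m = Suc m'" by (meson not0_implies_Suc)
    have "degree_le (n' + m) (\<lambda>t. p (t + h) * q (t + h) - p t * q t)" for h
    proof -
      have "degree_le (n + m') (\<lambda>t. p (t + h) * (q (t + h) - q t))"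
        by (rule less.hyps[OF _ degree_le_shift[OF less.prems(1)]]) (use less.prems(2) nm(2) in auto)
      then have 1: "degree_le (n' + m) (\<lambda>t. p (t + h) * (q (t + h) - q t))"
        by (simp only: nm add_Suc add_Suc_right)
      have 2: "degree_le (n' + m) (\<lambda>t. (p (t + h) - p t) * q t)"
        by (rule less.hyps[OF _ _ less.prems(2)]) (use less.prems(1) nm(1) in auto)
      have "p (t + h) * q (t + h) - p t * q t = p (t + h) * (q (t + h) - q t) + (p (t + h) - p t) * q t" for t
        by (simp add: algebra_simps)
      then show ?thesis using degree_le_add[OF 1 2] by (simp only:)
    qed
    then have "degree_le (Suc (n' + m)) (\<lambda>t. p t * q t)" by simp
    then show ?thesis by (simp only: nm add_Suc)
  qed
qed

lemma polynomial_map_const: "polynomial_map (\<lambda>_. c)"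
  by (auto simp: polynomial_map_def constant_on_def intro!: exI[of _ 0])

lemma polynomial_map_add:
  assumes "polynomial_map p" "polynomial_map q" shows "polynomial_map (\<lambda>t. p t + q t)"
proof -
  obtain n m where "degree_le n p" "degree_le m q" using assms by (auto simp: polynomial_map_def)
  then have "degree_le (max n m) p \<and> degree_le (max n m) q"
    using degree_le_mono max.cobounded1 max.cobounded2 by blast
  then show ?thesis unfolding polynomial_map_def by (auto intro: degree_le_add)
qed

lemma polynomial_map_mult:
  fixes p q :: "'t::ab_group_add \<Rightarrow> 'b::comm_ring"
  shows "polynomial_map p \<Longrightarrow> polynomial_map q \<Longrightarrow> polynomial_map (\<lambda>t. p t * q t)"
  unfolding polynomial_map_def by (auto intro: degree_le_mult)

lemma polynomial_map_sum: "(\<And>i. i \<in> A \<Longrightarrow> polynomial_map (f i)) \<Longrightarrow> polynomial_map (\<lambda>t. \<Sum>i\<in>A. f i t)"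
  by (induction A rule: infinite_finite_induct) (simp_all add: polynomial_map_const polynomial_map_add)

lemma polynomial_map_comp:
  "polynomial_map p \<Longrightarrow> (\<And>s t. f (s + t) = f s + f t) \<Longrightarrow> polynomial_map (\<lambda>t. p (f t))"
  unfolding polynomial_map_def by (auto intro: degree_le_comp)

lemma polynomial_map_hom:
  "polynomial_map p \<Longrightarrow> (\<And>s t. f (s + t) = f s + f t) \<Longrightarrow> polynomial_map (\<lambda>t. f (p t))"
  unfolding polynomial_map_def by (auto intro: degree_le_hom)

lemma polynomial_map_coordinate: "polynomial_map (\<lambda>t :: 'i \<Rightarrow> 'b::ab_group_add. t i)"
  by (auto simp: polynomial_map_def constant_on_def intro!: exI[of _ 1])

lemma polynomial_map_poly:
  fixes q :: "'b::comm_ring_1 poly"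
  assumes "polynomial_map p" shows "polynomial_map (\<lambda>t. poly q (p t))"
  by (induction q) (simp_all add: polynomial_map_const polynomial_map_add polynomial_map_mult assms)

section \<open>Character values of adele-valued polynomial maps\<close>

lemma adele_char_diff: "adele_char (x - y) = adele_char x * cnj (adele_char y)"
  by (simp only: diff_conv_add_uminus adele_char_add adele_char_minus)

lemma degree_le_adele_char: "degree_le n p \<Longrightarrow> phase_poly n (\<lambda>t. adele_char (p t))"
proof (induction n arbitrary: p)
  case (Suc n)
  show ?case
    unfolding phase_poly.simps adele_char_diff[symmetric] by (intro allI Suc.IH) (use Suc.prems in simp)
qed (auto simp: constant_on_def)

lemma adele_char_of_int_mult:
  assumes "adele_char a = 1" shows "adele_char (adele_of_rat (of_int k) * a) = 1"
proof -
  have nat: "adele_char (adele_of_rat (of_nat n) * a) = 1" for n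
    by (induction n) (simp_all add: adele_of_rat_hom distrib_right adele_char_add assms)
  show ?thesis
  proof (cases k)
    case (nonneg n)
    then show ?thesis using nat by simp
  next
    case (neg n)
    then show ?thesis using nat[of "Suc n"]
      by (simp only: of_int_minus of_int_of_nat_eq adele_of_rat_hom minus_mult_left[symmetric] adele_char_minus) simp
  qed
qed

text \<open>
  If all differences of \<open>p\<close> are constant modulo the rationals, then \<open>p - p 0\<close> is additive modulo the
  rationals, hence \<open>\<rat>\<close>-linear as its target is uniquely divisible.
\<close>

lemma polynomial_map_adele_char_const:
  fixes p :: "'t::ab_group_add \<Rightarrow> adele"
  assumes div: "\<And>(n :: nat) (t :: 't). n > 0 \<Longrightarrow> \<exists>s. (\<Sum>_<n. s) = t"
    and "polynomial_map p" "(\<lambda>t. adele_char (p t)) constant_on UNIV"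
  shows "p t - p 0 \<in> range adele_of_rat"
proof -
  let ?R = "range adele_of_rat"
  have R0: "0 \<in> ?R" by (metis adele_of_rat_hom(1) rangeI)
  have Radd: "a + b \<in> ?R" if "a \<in> ?R" "b \<in> ?R" for a b
    using that by (auto simp flip: adele_of_rat_hom(3))
  have char_sq: "adele_char x * cnj (adele_char x) = 1" for x
    by (simp flip: complex_norm_square)
  have "degree_le n p \<Longrightarrow> (\<lambda>t. adele_char (p t)) constant_on UNIV \<Longrightarrow> p t - p 0 \<in> ?R" for n t and p :: "'t \<Rightarrow> adele"
  proof (induction n arbitrary: p t)
    case 0
    then show ?case using R0 by (auto simp: constant_on_def)
  next
    case (Suc n)
    obtain c where c: "\<And>t. adele_char (p t) = c" using Suc.prems(2) by (auto simp: constant_on_def)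
    define l where "l h = p h - p 0" for h
    have l1: "adele_char (l h) = 1" for h
      using char_sq[of "p 0"] by (simp add: l_def adele_char_diff c)
    have ladd: "l (t + h) - (l t + l h) \<in> ?R" for t h
    proof -
      have "(p (t + h) - p t) - (p (0 + h) - p 0) \<in> ?R"
      proof (rule Suc.IH)
        show "degree_le n (\<lambda>t. p (t + h) - p t)" using Suc.prems(1) by simp
        show "(\<lambda>t. adele_char (p (t + h) - p t)) constant_on UNIV"
          by (auto simp: constant_on_def adele_char_diff c)
      qed
      then show ?thesis by (simp add: l_def algebra_simps)
    qed
    have lmult: "l (\<Sum>_<m. u) - adele_of_rat (of_nat m) * l u \<in> ?R" for m u
    proof (induction m)
      case 0
      then show ?case by (simp add: l_def adele_of_rat_hom R0)
    next
      case (Suc m)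
      have eq: "l (\<Sum>_<Suc m. u) - adele_of_rat (of_nat (Suc m)) * l u
        = (l ((\<Sum>_<m. u) + u) - (l (\<Sum>_<m. u) + l u)) + (l (\<Sum>_<m. u) - adele_of_rat (of_nat m) * l u)"
        by (simp add: adele_of_rat_hom distrib_right)
      show ?case unfolding eq by (rule Radd[OF ladd Suc.IH])
    qed
    have "adele_char (adele_of_rat s * l t) = 1" for s
    proof -
      obtain k m where km: "m > 0" "s = of_int k / of_int m" by (rule rat_as_fraction)
      define m' where "m' = nat m"
      have m': "m' > 0" "s = of_int k / of_nat m'" using km by (auto simp: m'_def)
      \<comment> \<open>Dividing \<open>t\<close> by the denominator of \<open>s\<close> makes
        \<open>s\<close> times \<open>l t\<close> an integer multiple of \<open>l u\<close> plus a
        rational, both with trivial character.\<close>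
      obtain u where u: "(\<Sum>_<m'. u) = t" using div[OF m'(1), of t] by blast
      obtain r where r: "l t - adele_of_rat (of_nat m') * l u = adele_of_rat r" using lmult[of u m'] u by auto
      then have lt: "l t = adele_of_rat (of_nat m') * l u + adele_of_rat r" by (simp add: algebra_simps)
      have "adele_of_rat s * l t = adele_of_rat (of_int k) * l u + adele_of_rat (s * r)"
        unfolding lt using m' by (simp add: distrib_left flip: mult.assoc adele_of_rat_hom(4))
      then show ?thesis using adele_char_of_int_mult[OF l1] by (simp add: adele_char_add)
    qed
    then show ?case unfolding l_def[symmetric] by (rule adele_char_detects_rat)
  qed
  then show ?thesis using assms(2,3) unfolding polynomial_map_def by blast
qed

lemma fun_rat_divisible: "(n :: nat) > 0 \<Longrightarrow> \<exists>s. (\<Sum>_<n. s) = (t :: 'i \<Rightarrow> rat)"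
proof
  assume "n > 0"
  moreover have "(\<Sum>_<m. (\<lambda>i. t i / of_nat n)) = (\<lambda>i. of_nat m * t i / of_nat n)" for m
    by (induction m) (auto simp: fun_eq_iff distrib_right add_divide_distrib)
  ultimately show "(\<Sum>_<n. (\<lambda>i. t i / of_nat n)) = t" by simp
qed

section \<open>Polynomial families in groups generated by unipotent subgroups\<close>

text \<open>Parameters are infinite sequences so that products of families keep the same type. With
  the identity in the range, each factor can be recovered from a product.\<close>

definition poly_family :: "(rat^'d^'d) set \<Rightarrow> ((nat \<Rightarrow> rat) \<Rightarrow> rat^'d^'d) \<Rightarrow> bool" where
  "poly_family A P \<longleftrightarrow> range P \<subseteq> A \<and> mat 1 \<in> range P \<and> (\<forall>i j. polynomial_map (\<lambda>t. P t $ i $ j))"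

lemma poly_family_mult:
  assumes P: "poly_family A P" and Q: "poly_family A Q"
    and A: "\<And>g h. g \<in> A \<Longrightarrow> h \<in> A \<Longrightarrow> g ** h \<in> A"
  shows "\<exists>R. poly_family A R \<and> (\<forall>s t. P s ** Q t \<in> range R)"
proof -
  \<comment> \<open>\<open>P\<close> reads the even coordinates and \<open>Q\<close> the odd ones,
    so their parameters vary independently.\<close>
  define R where "R t = P (\<lambda>n. t (2 * n)) ** Q (\<lambda>n. t (2 * n + 1))" for t
  have R: "P s ** Q t \<in> range R" for s t
  proof
    show "P s ** Q t = R (\<lambda>n. if even n then s (n div 2) else t (n div 2))"
      by (simp add: R_def)
  qed simp
  obtain s where s: "mat 1 = P s" using P unfolding poly_family_def by blast
  obtain t where t: "mat 1 = Q t" using Q unfolding poly_family_def by blast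
  have "mat 1 \<in> range R"
    using R[of s t] unfolding s[symmetric] t[symmetric] by simp
  moreover have "P t \<in> A" "Q t \<in> A" for t
    using P Q by (auto simp: poly_family_def)
  then have "range R \<subseteq> A"
    by (auto simp: R_def intro!: A)
  moreover have "polynomial_map (\<lambda>t. P (\<lambda>n. t (2 * n)) $ i $ j)" for i j
    by (rule polynomial_map_comp[where p = "\<lambda>t. P t $ i $ j" and f = "\<lambda>t n. t (2 * n)"])
      (use P in \<open>auto simp: poly_family_def\<close>)
  moreover have "polynomial_map (\<lambda>t. Q (\<lambda>n. t (2 * n + 1)) $ i $ j)" for i j
    by (rule polynomial_map_comp[where p = "\<lambda>t. Q t $ i $ j" and f = "\<lambda>t n. t (2 * n + 1)"])
      (use Q in \<open>auto simp: poly_family_def\<close>)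
  ultimately have "polynomial_map (\<lambda>t. R t $ i $ j)" for i j
    unfolding R_def matrix_matrix_mult_def by (simp add: polynomial_map_sum polynomial_map_mult)
  then show ?thesis
    using R \<open>mat 1 \<in> range R\<close> \<open>range R \<subseteq> A\<close> unfolding poly_family_def by (intro exI[of _ R]) simp
qed

lemma poly_map_poly_of_rat: "poly (map_poly of_rat q) (of_rat t :: 'a::field_char_0) = of_rat (poly q t)"
  by (induction q) (simp_all add: map_poly_pCons of_rat_add of_rat_mult)

lemma map_matrix_of_rat_mult:
  "map_matrix of_rat (A ** B) = (map_matrix of_rat A ** map_matrix of_rat B :: 'a::field_char_0^'d^'d)"
  by (simp add: vec_eq_iff matrix_matrix_mult_def of_rat_sum of_rat_mult)

lemma map_matrix_of_rat_eq_iff: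
  "(map_matrix of_rat A :: 'a::field_char_0^'d^'d) = map_matrix of_rat B \<longleftrightarrow> A = B"
  by (simp add: vec_eq_iff)

text \<open>The homomorphism law descends from complex to rational parameters by injectivity of
  \<open>of_rat\<close>; the value at 0 is idempotent and invertible, hence the identity.\<close>

lemma rational_one_parameter_eval:
  fixes G :: "(complex^'d^'d) set"
  assumes G: "subgroup G GL" and u: "rational_one_parameter G u"
  shows "eval_poly_matrix u (s + t) = eval_poly_matrix u s ** eval_poly_matrix u t"
    and "eval_poly_matrix u 0 = mat 1"
proof -
  define U where "U = (eval_poly_matrix (map_matrix (map_poly of_rat) u) :: complex \<Rightarrow> complex^'d^'d)"
  have U: "U t \<in> G" "U (s + t) = U s ** U t" for s t
    using u unfolding rational_one_parameter_def Let_def U_def by auto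
  have Ur: "U (of_rat t) = map_matrix of_rat (eval_poly_matrix u t)" for t
    by (simp add: U_def eval_poly_matrix_def vec_eq_iff poly_map_poly_of_rat)
  show "eval_poly_matrix u (s + t) = eval_poly_matrix u s ** eval_poly_matrix u t"
    using U(2)[of "of_rat s" "of_rat t"]
    unfolding of_rat_add[symmetric] Ur map_matrix_of_rat_mult[symmetric] map_matrix_of_rat_eq_iff .
  have "invertible (U 0)" using subgroup.subset[OF G] U(1)[of 0] by (auto simp: GL_def)
  then obtain V where V: "V ** U 0 = mat 1" by (auto simp: invertible_def)
  have "V ** (U 0 ** U 0) = U 0" by (simp add: matrix_mul_assoc V)
  moreover have "U 0 ** U 0 = U 0" using U(2)[of 0 0] by simp
  ultimately have "U 0 = mat 1" using V by simp
  moreover have "map_matrix of_rat (mat 1) = (mat 1 :: complex^'d^'d)"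
    by (simp add: vec_eq_iff mat_def)
  ultimately have "map_matrix of_rat (eval_poly_matrix u 0) = (map_matrix of_rat (mat 1) :: complex^'d^'d)"
    using Ur[of 0] by simp
  then show "eval_poly_matrix u 0 = mat 1" by (simp only: map_matrix_of_rat_eq_iff)
qed

lemma GL_inverse_unique:
  assumes "g ** h = mat 1" "h ** g = mat 1" shows "inv\<^bsub>GL\<^esub> g = h"
proof -
  interpret group GL by (rule group_GL)
  show ?thesis by (rule inv_equality) (use assms in \<open>auto simp: GL_def invertible_def\<close>)
qed

text \<open>Induction over words in the generators: a one-parameter subgroup is a family containing
  its inverses, as values at \<open>- t\<close>, and concatenation multiplies families.\<close>

lemma poly_family_generate:
  fixes G :: "(complex^'d^'d) set"
  assumes G: "subgroup G GL" and A: "A = generate GL (\<Union> (unipotent_one_parameter_subgroups G))"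
  shows "g \<in> A \<Longrightarrow> \<exists>P. poly_family A P \<and> g \<in> range P"
proof -
  have mult: "g ** h \<in> A" if "g \<in> A" "h \<in> A" for g h
    using generate.eng[of g GL _ h] that unfolding A by (simp add: GL_def)
  have uni: "\<exists>P. poly_family A P \<and> range P = range (eval_poly_matrix u)"
    if u: "rational_one_parameter G u" for u
  proof (intro exI conjI)
    let ?P = "\<lambda>t :: nat \<Rightarrow> rat. eval_poly_matrix u (t 0)"
    have "s \<in> range (\<lambda>t :: nat \<Rightarrow> rat. t 0)" for s by (rule range_eqI[of _ _ "\<lambda>_. s"]) simp
    then have "range (\<lambda>t :: nat \<Rightarrow> rat. t 0) = UNIV" by blast
    then show range: "range ?P = range (eval_poly_matrix u)"
      using image_image[of "eval_poly_matrix u" "\<lambda>t :: nat \<Rightarrow> rat. t 0" UNIV] by simp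
    show "poly_family A ?P"
      unfolding poly_family_def range
    proof (intro conjI allI)
      show "range (eval_poly_matrix u) \<subseteq> A"
        unfolding A using u by (auto simp: unipotent_one_parameter_subgroups_def intro!: generate.incl)
      show "mat 1 \<in> range (eval_poly_matrix u)"
        using rational_one_parameter_eval(2)[OF G u] by (metis rangeI)
      show "polynomial_map (\<lambda>t. ?P t $ i $ j)" for i j
        by (simp add: eval_poly_matrix_def polynomial_map_poly polynomial_map_coordinate)
    qed
  qed
  have "g \<in> generate GL (\<Union> (unipotent_one_parameter_subgroups G)) \<Longrightarrow> \<exists>P. poly_family A P \<and> g \<in> range P"
  proof (induction rule: generate.induct)
    case one
    have "mat 1 \<in> A" unfolding A using generate.one[of GL] by (simp add: GL_def)
    then have "poly_family A (\<lambda>_. mat 1)" by (auto simp: poly_family_def polynomial_map_const)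
    then show ?case by (intro exI[of _ "\<lambda>_. mat 1"]) (simp add: GL_def)
  next
    case (incl h)
    then obtain u where "rational_one_parameter G u" "h \<in> range (eval_poly_matrix u)"
      by (auto simp: unipotent_one_parameter_subgroups_def)
    then show ?case using uni by metis
  next
    case (inv h)
    then obtain u t where u: "rational_one_parameter G u" "h = eval_poly_matrix u t"
      by (auto simp: unipotent_one_parameter_subgroups_def)
    have "inv\<^bsub>GL\<^esub> h = eval_poly_matrix u (- t)"
      using rational_one_parameter_eval[OF G u(1), symmetric]
      by (intro GL_inverse_unique) (simp_all add: u(2))
    then show ?case using uni[OF u(1)] by (metis rangeI)
  next
    case (eng g h)
    then obtain P Q where PQ: "poly_family A P" "g \<in> range P" "poly_family A Q" "h \<in> range Q" by blast
    obtain R where "poly_family A R" "\<forall>s t. P s ** Q t \<in> range R"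
      using poly_family_mult[OF PQ(1,3) mult] by blast
    moreover have "g \<otimes>\<^bsub>GL\<^esub> h = g ** h" by (simp add: GL_def)
    ultimately show ?case using PQ(2,4) by (metis imageE)
  qed
  then show "g \<in> A \<Longrightarrow> \<exists>P. poly_family A P \<and> g \<in> range P" unfolding A by blast
qed

text \<open>In a product of families, setting one factor to the identity leaves the whole range of
  the other.\<close>

lemma poly_family_finite:
  assumes "finite F" "F \<subseteq> A" "mat 1 \<in> A"
    and gen: "\<And>g. g \<in> A \<Longrightarrow> \<exists>P. poly_family A P \<and> g \<in> range P"
    and mult: "\<And>g h. g \<in> A \<Longrightarrow> h \<in> A \<Longrightarrow> g ** h \<in> A"
  shows "\<exists>P. poly_family A P \<and> F \<subseteq> range P"
  using assms(1,2)
proof (induction F)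
  case empty
  then show ?case using gen[OF \<open>mat 1 \<in> A\<close>] by blast
next
  case (insert g F)
  then obtain P Q where PQ: "poly_family A P" "F \<subseteq> range P" "poly_family A Q" "g \<in> range Q"
    using gen[of g] by blast
  obtain R where R: "poly_family A R" "\<And>s t. P s ** Q t \<in> range R"
    using poly_family_mult[OF PQ(1,3) mult] by blast
  obtain s t where st: "P s = mat 1" "Q t = mat 1"
    using PQ(1,3) unfolding poly_family_def by (metis imageE)
  have "P s' \<in> range R" "Q t' \<in> range R" for s' t'
    using R(2)[of s' t] R(2)[of s t'] st by simp_all
  then show ?case using R(1) PQ(2,4) by blast
qed

section \<open>A Fejer kernel argument\<close>

lemma avg_sum: "avg L (\<lambda>t. \<Sum>k\<in>K. c k * f k t) t = (\<Sum>k\<in>K. c k * avg L (f k) t)"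
proof -
  have "(\<Sum>h\<leftarrow>L. \<Sum>k\<in>K. c k * f k (t + h)) = (\<Sum>k\<in>K. c k * (\<Sum>h\<leftarrow>L. f k (t + h)))"
    by (induction L) (simp_all add: sum.distrib distrib_left)
  then show ?thesis by (simp add: avg_def sum_divide_distrib)
qed

lemma avg_const: "L \<noteq> [] \<Longrightarrow> (\<And>t. f t = c) \<Longrightarrow> avg L f t = c"
  by (simp add: avg_def sum_list_triv)

text \<open>On the unit circle the base equals \<open>(z + 1)\<^sup>2 * cnj z / 4\<close>, so the
  binomial theorem applies. The frequency \<open>j - m\<close>, from \<open>-m\<close> to
  \<open>m\<close>, is encoded as \<open>z ^ j * cnj z ^ m\<close>.\<close>

lemma half_one_plus_Re_power:
  assumes z: "norm z = 1"
  shows "of_real (((1 + Re z) / 2) ^ m) = (\<Sum>j\<le>2*m. of_nat ((2*m) choose j) / 4 ^ m * (z ^ j * cnj z ^ m))"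
proof -
  have zz: "z * cnj z = 1" using z by (simp flip: complex_norm_square)
  have "(of_real ((1 + Re z) / 2) :: complex) = (2 + (z + cnj z)) / 4"
    by (simp add: complex_add_cnj field_simps)
  also have "2 + (z + cnj z) = (z + 1)\<^sup>2 * cnj z"
  proof -
    have "(z + 1)\<^sup>2 * cnj z = (z * cnj z) * z + 2 * (z * cnj z) + cnj z"
      by (simp add: power2_eq_square algebra_simps)
    then show ?thesis by (simp add: zz)
  qed
  finally have "of_real (((1 + Re z) / 2) ^ m) = ((z + 1)\<^sup>2 * cnj z / 4) ^ m"
    by (simp only: of_real_power)
  also have "\<dots> = (z + 1) ^ (2 * m) * cnj z ^ m / 4 ^ m"
    by (simp add: power_mult_distrib power_divide power_mult)
  also have "(z + 1) ^ (2 * m) = (\<Sum>j\<le>2*m. of_nat ((2*m) choose j) * z ^ j)"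
    by (subst binomial_ring) simp
  finally show ?thesis
    by (simp add: sum_distrib_right sum_divide_distrib mult.assoc)
qed

text \<open>
  The average of \<open>\<Prod>i. ((1 + Re (\<theta> t i)) / 2) ^ m\<close>, a trigonometric polynomial with nonnegative
  coefficients, is at least its constant coefficient.
\<close>

lemma trigonometric_average_bound:
  fixes \<theta> :: "'t::ab_group_add \<Rightarrow> 'd::finite \<Rightarrow> complex"
  assumes norm: "\<And>t i. norm (\<theta> t i) = 1"
    and dich: "\<And>k. k \<in> (\<Pi>\<^sub>E i\<in>UNIV. {..2*m}) \<Longrightarrow>
      mean_zero (\<lambda>t. \<Prod>i\<in>UNIV. \<theta> t i ^ k i * cnj (\<theta> t i) ^ m) \<or> (\<forall>t. (\<Prod>i\<in>UNIV. \<theta> t i ^ k i * cnj (\<theta> t i) ^ m) = 1)"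
    and away: "\<And>t. \<exists>i. (1 + Re (\<theta> t i)) / 2 \<le> d"
  shows "(real ((2*m) choose m) / 4 ^ m) ^ CARD('d) \<le> d ^ m"
proof (rule field_le_epsilon)
  fix e :: real assume e: "e > 0"
  let ?K = "\<Pi>\<^sub>E i\<in>(UNIV :: 'd set). {..2*m}"
  let ?f = "\<lambda>k t. \<Prod>i\<in>UNIV. \<theta> t i ^ k i * cnj (\<theta> t i) ^ m"
  \<comment> \<open>Coefficients of the product kernel; \<open>k i = m\<close> stands for frequency
    0 in coordinate \<open>i\<close>.\<close>
  define c :: "('d \<Rightarrow> nat) \<Rightarrow> real" where "c k = (\<Prod>i\<in>UNIV. real ((2*m) choose k i) / 4 ^ m)" for k
  define s where "s t i = ((1 + Re (\<theta> t i)) / 2)" for t i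
  have fin: "finite ?K" by (intro finite_PiE) auto
  have c0: "c k \<ge> 0" for k by (auto simp: c_def intro!: prod_nonneg)
  have s01: "0 \<le> s t i" "s t i \<le> 1" for t i
    using abs_Re_le_cmod[of "\<theta> t i"] norm[of t i] by (auto simp: s_def abs_le_iff)
  have expand: "of_real (\<Prod>i\<in>UNIV. s t i ^ m) = (\<Sum>k\<in>?K. of_real (c k) * ?f k t)" for t
  proof -
    have "(of_real (\<Prod>i\<in>UNIV. s t i ^ m) :: complex)
        = (\<Prod>i\<in>UNIV. \<Sum>j\<le>2*m. of_nat ((2*m) choose j) / 4 ^ m * (\<theta> t i ^ j * cnj (\<theta> t i) ^ m))"
      unfolding s_def of_real_prod by (intro prod.cong refl half_one_plus_Re_power norm)
    also have "\<dots> = (\<Sum>k\<in>?K. \<Prod>i\<in>UNIV. of_nat ((2*m) choose k i) / 4 ^ m * (\<theta> t i ^ k i * cnj (\<theta> t i) ^ m))"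
      by (rule prod_sum_PiE) auto
    finally show ?thesis by (simp add: c_def prod.distrib prod_dividef)
  qed
  have "(\<Sum>k\<in>?K. c k) = (\<Prod>i\<in>(UNIV :: 'd set). \<Sum>j\<le>2*m. real ((2*m) choose j) / 4 ^ m)"
    unfolding c_def by (rule prod_sum_PiE[symmetric]) auto
  also have "(\<Sum>j\<le>2*m. real ((2*m) choose j) / 4 ^ m) = (\<Sum>j\<le>2*m. real ((2*m) choose j)) / 4 ^ m"
    by (simp add: sum_divide_distrib)
  also have "(\<Sum>j\<le>2*m. real ((2*m) choose j)) = 4 ^ m"
    by (simp add: choose_row_sum power_mult flip: of_nat_sum)
  finally have csum: "(\<Sum>k\<in>?K. c k) = 1" by simp
  let ?F = "{k \<in> ?K. mean_zero (?f k)}"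
  have "\<exists>L. L \<noteq> [] \<and> (\<forall>k\<in>?F. \<forall>t. norm (avg L (?f k) t) \<le> e)"
    by (rule mean_zero_common) (use fin e in auto)
  then obtain L where L: "L \<noteq> []" "\<And>k t. k \<in> ?F \<Longrightarrow> norm (avg L (?f k) t) \<le> e" by blast
  have avg1: "avg L (?f k) 0 = 1" if "k \<in> ?K - ?F" for k
    using dich[of k] that by (intro avg_const[OF L(1)]) auto
  \<comment> \<open>Each mean has real part at least \<open>- e\<close> or equals 1, and it is 1 at
    frequency zero. As the coefficients sum to 1, the total error is \<open>e\<close>.\<close>
  have lower: "c k * (if k = (\<lambda>_. m) then 1 else 0) - e * c k \<le> Re (of_real (c k) * avg L (?f k) 0)" if k: "k \<in> ?K" for k
  proof -
    have "Re (avg L (?f k) 0) \<ge> (if k = (\<lambda>_. m) then 1 else 0) - e"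
    proof (cases "k \<in> ?F")
      case True
      have "k \<noteq> (\<lambda>_. m)"
      proof
        assume km: "k = (\<lambda>_. m)"
        have "\<theta> t i ^ m * cnj (\<theta> t i) ^ m = 1" for t i
          using norm[of t i] by (simp flip: power_mult_distrib complex_norm_square)
        then have "avg L (?f k) 0 = 1" if "L \<noteq> []" for L :: "'t list"
          using that by (intro avg_const) (auto simp: km)
        moreover have "mean_zero (?f k)" using True by simp
        then obtain H where "H \<noteq> []" "norm (avg H (?f k) 0) \<le> 1/2"
          unfolding mean_zero_def by (meson half_gt_zero_iff zero_less_one)
        ultimately show False by simp
      qed
      moreover have "\<bar>Re (avg L (?f k) 0)\<bar> \<le> e"
        using abs_Re_le_cmod L(2)[OF True] order_trans by blast
      ultimately show ?thesis by simp
    next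
      case False
      then show ?thesis using avg1[of k] k e by simp
    qed
    from mult_left_mono[OF this c0[of k]] show ?thesis
      by (simp add: right_diff_distrib mult.commute)
  qed
  have mK: "(\<lambda>_. m) \<in> ?K" by auto
  have "c (\<lambda>_. m) - e = (\<Sum>k\<in>?K. c k * (if k = (\<lambda>_. m) then 1 else 0) - e * c k)"
    using fin mK csum by (simp add: sum_subtractf if_distrib[of "(*) _"] flip: sum_distrib_left cong: if_cong)
  also have "\<dots> \<le> (\<Sum>k\<in>?K. Re (of_real (c k) * avg L (?f k) 0))"
    by (rule sum_mono) (rule lower)
  also have "\<dots> = Re (avg L (\<lambda>t. of_real (\<Prod>i\<in>UNIV. s t i ^ m)) 0)"
    unfolding expand avg_sum by simp
  also have "\<dots> \<le> norm (avg L (\<lambda>t. of_real (\<Prod>i\<in>UNIV. s t i ^ m)) 0)"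
    by (rule complex_Re_le_cmod)
  also have "\<dots> \<le> d ^ m"
  proof (rule norm_avg_le[OF L(1)])
    fix t
    \<comment> \<open>All factors lie in [0, 1], so the one that is at most \<open>d ^ m\<close>
      bounds the product.\<close>
    obtain i where i: "s t i \<le> d" using away[of t] by (auto simp: s_def)
    have "(\<Prod>i\<in>UNIV. s t i ^ m) = s t i ^ m * (\<Prod>i\<in>UNIV - {i}. s t i ^ m)"
      by (rule prod.remove) auto
    also have "\<dots> \<le> s t i ^ m * 1"
      by (intro mult_left_mono prod_le_1) (auto simp: s01 power_le_one)
    also have "\<dots> \<le> d ^ m" using i s01(1)[of t i] by (simp add: power_mono)
    finally show "norm (of_real (\<Prod>i\<in>UNIV. s t i ^ m) :: complex) \<le> d ^ m"
      by (simp only: norm_of_real) (simp add: prod_nonneg s01)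
  qed
  finally show "(real ((2*m) choose m) / 4 ^ m) ^ CARD('d) \<le> d ^ m + e"
    by (simp add: c_def)
qed

text \<open>The normalized central binomial coefficient is at least \<open>1 / (2 m)\<close>, so a
  fixed power of it decays more slowly than a geometric sequence.\<close>

lemma central_binomial_power_dominates:
  fixes d :: real
  assumes "0 \<le> d" "d < 1" "D > 0"
  shows "\<exists>m. (real ((2*m) choose m) / 4 ^ m) ^ D > d ^ m"
proof -
  \<comment> \<open>Since \<open>b ^ D\<close> is at least \<open>d\<close>, it is enough that
    \<open>b ^ m < 1 / (2 m)\<close>. The maximum with \<open>1/2\<close> keeps \<open>b\<close>
    positive when \<open>d = 0\<close>.\<close>
  define b where "b = root D (max d (1/2))"
  have b: "b > 0" "b < 1" "b ^ D = max d (1/2)"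
    using assms by (auto simp: b_def)
  have "(\<lambda>n. of_nat n * b ^ n) \<longlonglongrightarrow> 0"
    by (rule powser_times_n_limit_0) (use b in simp)
  then have "\<forall>\<^sub>F n in sequentially. of_nat n * b ^ n < 1/2"
    by (rule order_tendstoD) simp
  then have "\<forall>\<^sub>F n in sequentially. of_nat n * b ^ n < 1/2 \<and> n > 0"
    using eventually_gt_at_top[of 0] by eventually_elim simp
  then obtain m where m: "real m * b ^ m < 1/2" "m > 0"
    using eventually_happens' sequentially_bot by blast
  have "b ^ m < 1 / (2 * real m)" using m by (simp add: field_simps)
  also have "1 / (2 * real m) \<le> real ((2*m) choose m) / 4 ^ m"
    using central_binomial_lower_bound[OF m(2)] by (simp add: field_simps)
  finally have "(b ^ m) ^ D < (real ((2*m) choose m) / 4 ^ m) ^ D"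
    using b assms by (intro power_strict_mono) auto
  moreover have "(b ^ m) ^ D = (max d (1/2)) ^ m"
    unfolding b(3)[symmetric] by (simp add: mult.commute flip: power_mult)
  ultimately have "(max d (1/2)) ^ m < (real ((2*m) choose m) / 4 ^ m) ^ D" by simp
  moreover have "d ^ m \<le> (max d (1/2)) ^ m"
    using assms by (intro power_mono) auto
  ultimately show ?thesis by (meson le_less_trans)
qed

section \<open>Rational functionals on adelic space\<close>

definition adele_dot :: "rat^'d \<Rightarrow> adele^'d \<Rightarrow> adele" where
  "adele_dot r z = (\<Sum>i\<in>UNIV. adele_of_rat (r $ i) * z $ i)"

abbreviation adele_act :: "rat^'d^'d \<Rightarrow> adele^'d \<Rightarrow> adele^'d" where
  "adele_act g z \<equiv> map_matrix adele_of_rat g *v z"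

lemma adele_of_rat_sum: "adele_of_rat (sum f A) = (\<Sum>i\<in>A. adele_of_rat (f i))"
  by (induction A rule: infinite_finite_induct) (auto simp: adele_of_rat_hom)

lemma adele_dot_add_right: "adele_dot r (y + z) = adele_dot r y + adele_dot r z"
  by (simp add: adele_dot_def distrib_left sum.distrib)

lemma adele_dot_diff_right: "adele_dot r (y - z) = adele_dot r y - adele_dot r z"
  by (simp add: adele_dot_def right_diff_distrib sum_subtractf)

lemma adele_dot_add_left: "adele_dot (r + s) z = adele_dot r z + adele_dot s z"
  by (simp add: adele_dot_def adele_of_rat_hom distrib_right sum.distrib)

lemma adele_dot_scale_left: "adele_dot (c *s r) z = adele_of_rat c * adele_dot r z"
  by (simp add: adele_dot_def adele_of_rat_hom sum_distrib_left mult.assoc)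

lemma adele_dot_zero_left: "adele_dot 0 z = 0"
  by (simp add: adele_dot_def adele_of_rat_hom)

lemma adele_dot_of_rat: "adele_dot r (adele_vec_of_rat v) = adele_of_rat (\<Sum>i\<in>UNIV. r $ i * v $ i)"
  by (simp add: adele_dot_def adele_vec_of_rat_def adele_of_rat_sum adele_of_rat_hom)

lemma adele_dot_act: "adele_dot r (adele_act g z) = adele_dot (r v* g) z"
proof -
  have "adele_dot r (adele_act g z) = (\<Sum>i\<in>UNIV. \<Sum>j\<in>UNIV. adele_of_rat (r $ i) * (adele_of_rat (g $ i $ j) * z $ j))"
    by (simp add: adele_dot_def matrix_vector_mult_def sum_distrib_left)
  also have "\<dots> = (\<Sum>j\<in>UNIV. \<Sum>i\<in>UNIV. adele_of_rat (r $ i) * (adele_of_rat (g $ i $ j) * z $ j))"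
    by (rule sum.swap)
  also have "\<dots> = adele_dot (r v* g) z"
    by (simp add: adele_dot_def vector_matrix_mult_def adele_of_rat_sum adele_of_rat_hom sum_distrib_left ac_simps)
  finally show ?thesis .
qed

lemma adele_act_mult: "adele_act (g ** h) z = adele_act g (adele_act h z)"
proof -
  have "map_matrix adele_of_rat (g ** h) = map_matrix adele_of_rat g ** map_matrix adele_of_rat h"
    by (simp add: vec_eq_iff matrix_matrix_mult_def adele_of_rat_sum adele_of_rat_hom)
  then show ?thesis by (simp add: matrix_vector_mul_assoc)
qed

lemma range_adele_of_rat_closed:
  assumes "a \<in> range adele_of_rat" "b \<in> range adele_of_rat"
  shows "a + b \<in> range adele_of_rat" "a * b \<in> range adele_of_rat" "a - b \<in> range adele_of_rat"
  using assms by (auto simp flip: adele_of_rat_hom adele_of_rat_diff)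

lemma zero_in_range_adele_of_rat: "0 \<in> range adele_of_rat"
  by (metis adele_of_rat_hom(1) rangeI)

definition orbit_relations :: "(rat^'d^'d) set \<Rightarrow> adele^'d \<Rightarrow> (rat^'d) set" where
  "orbit_relations A a = {r. \<forall>g\<in>A. adele_dot r (adele_act g a - a) \<in> range adele_of_rat}"

lemma subspace_orbit_relations: "vec.subspace (orbit_relations A a)"
  by (rule vec.subspaceI)
    (auto simp: orbit_relations_def adele_dot_zero_left adele_dot_add_left adele_dot_scale_left
      zero_in_range_adele_of_rat range_adele_of_rat_closed)

text \<open>\<open>r g\<close> on \<open>h a - a\<close> is \<open>r\<close> on
  \<open>(g h) a - a\<close> minus \<open>r\<close> on \<open>g a - a\<close>. This yields the
  invariance of the annihilator.\<close>

lemma orbit_relations_invariant: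
  assumes r: "r \<in> orbit_relations A a" and g: "g \<in> A"
    and mult: "\<And>g h. g \<in> A \<Longrightarrow> h \<in> A \<Longrightarrow> g ** h \<in> A"
  shows "r v* g \<in> orbit_relations A a"
  unfolding orbit_relations_def
proof (intro CollectI ballI)
  fix h assume h: "h \<in> A"
  have "adele_dot (r v* g) (adele_act h a - a)
      = adele_dot r (adele_act (g ** h) a - a) - adele_dot r (adele_act g a - a)"
    by (simp add: adele_dot_diff_right adele_dot_act[symmetric] adele_act_mult)
  also have "\<dots> \<in> range adele_of_rat"
    using r g mult[OF g h] by (intro range_adele_of_rat_closed) (auto simp: orbit_relations_def)
  finally show "adele_dot (r v* g) (adele_act h a - a) \<in> range adele_of_rat" .
qed

text \<open>Functionals are rows acted on from the right, so \<open>M\<close> is the transposed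
  matrix of a linear projection onto \<open>W\<close>, and its rows are the images of the unit
  vectors.\<close>

lemma subspace_row_projection:
  fixes W :: "(rat^'d) set"
  assumes "vec.subspace W"
  obtains M :: "rat^'d^'d" where "\<And>i. M $ i \<in> W" "\<And>r. r \<in> W \<Longrightarrow> r v* M = r"
proof -
  have "Vector_Spaces.linear (*s) (*s) (id :: rat^'d \<Rightarrow> rat^'d)"
    by (rule vec.linear_id)
  from vec.linear_exists_left_inverse_on[OF this assms]
  obtain g where g: "range g \<subseteq> W" "Vector_Spaces.linear (*s) (*s) g" "\<And>v. v \<in> W \<Longrightarrow> g v = v"
    by auto
  show thesis
  proof
    fix i
    have "transpose (matrix g) $ i = g (axis i 1)"
      by (simp add: vec_eq_iff transpose_def matrix_def)
    then show "transpose (matrix g) $ i \<in> W" using g(1) by auto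
  next
    fix r assume "r \<in> W"
    then show "r v* transpose (matrix g) = r"
      using g(3) matrix_works[OF g(2), of r] by simp
  qed
qed

section \<open>Adelic points of a rational subspace\<close>

lemma adele_real_sum: "adele_real (sum f A) = (\<Sum>i\<in>A. adele_real (f i))"
proof -
  have "adele_real 0 = 0" using adele_real_ops(4)[of 0] by (simp add: adele_of_rat_hom)
  then show ?thesis by (induction A rule: infinite_finite_induct) auto
qed

lemma adele_padic_sum:
  assumes p: "prime p" and "finite A"
  shows "adele_padic p (sum f A) = (\<Oplus>\<^bsub>Qp p\<^esub>i\<in>A. adele_padic p (f i))"
proof -
  interpret cring "Qp p" by (rule Qp_cring[OF p])
  have 0: "adele_padic p 0 = \<zero>\<^bsub>Qp p\<^esub>" using p by (simp add: zero_adele_def padic_of_rat_hom)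
  show ?thesis
    using assms(2)
  proof (induction A)
    case (insert x F)
    have "(\<Oplus>\<^bsub>Qp p\<^esub>i\<in>insert x F. adele_padic p (f i)) = adele_padic p (f x) \<oplus>\<^bsub>Qp p\<^esub> (\<Oplus>\<^bsub>Qp p\<^esub>i\<in>F. adele_padic p (f i))"
      using insert adele_padic_in_Qp[OF p] by (intro finsum_insert) auto
    then show ?case using insert p by simp
  qed (simp add: 0)
qed

lemma padic_of_rat_sum:
  assumes p: "prime p" and "finite A"
  shows "padic_of_rat p (sum f A) = (\<Oplus>\<^bsub>Qp p\<^esub>i\<in>A. padic_of_rat p (f i))"
  using adele_padic_sum[OF assms, of "\<lambda>i. adele_of_rat (f i)"] p
  by (simp flip: adele_of_rat_sum)

lemma padic_span_dot_zero:
  fixes x :: "padic^'d" and r :: "rat^'d" and V :: "(rat^'d) set"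
  assumes p: "prime p" and x: "x \<in> padic_span p (carrier (Qp p)) V"
    and r: "\<And>v. v \<in> V \<Longrightarrow> (\<Sum>i\<in>UNIV. r $ i * v $ i) = 0"
  shows "(\<Oplus>\<^bsub>Qp p\<^esub>i\<in>UNIV. padic_of_rat p (r $ i) \<otimes>\<^bsub>Qp p\<^esub> x $ i) = \<zero>\<^bsub>Qp p\<^esub>"
proof -
  interpret cring "Qp p" by (rule Qp_cring[OF p])
  note [simp] = padic_of_rat_in_Qp
  obtain F c where F: "finite F" "F \<subseteq> V" "c \<in> F \<rightarrow> carrier (Qp p)"
    and xi: "\<And>i. x $ i = (\<Oplus>\<^bsub>Qp p\<^esub>v\<in>F. c v \<otimes>\<^bsub>Qp p\<^esub> padic_of_rat p (v $ i))"
    using x unfolding padic_span_def by blast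
  let ?S = "\<lambda>F i. (\<Oplus>\<^bsub>Qp p\<^esub>v\<in>F. c v \<otimes>\<^bsub>Qp p\<^esub> padic_of_rat p (v $ i))"
  have "(\<Oplus>\<^bsub>Qp p\<^esub>i\<in>UNIV. padic_of_rat p (r $ i) \<otimes>\<^bsub>Qp p\<^esub> ?S F i) = \<zero>\<^bsub>Qp p\<^esub>"
    using F
  proof (induction F)
    case empty
    then show ?case by simp
  next
    case (insert w F)
    have cw: "c w \<in> carrier (Qp p)" and cF: "c \<in> F \<rightarrow> carrier (Qp p)" using insert.prems by auto
    have SF: "?S F i \<in> carrier (Qp p)" for i
      using cF by (intro finsum_closed) (auto simp: Pi_iff)
    have step: "padic_of_rat p (r $ i) \<otimes>\<^bsub>Qp p\<^esub> ?S (insert w F) i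
        = c w \<otimes>\<^bsub>Qp p\<^esub> padic_of_rat p (r $ i * w $ i) \<oplus>\<^bsub>Qp p\<^esub> padic_of_rat p (r $ i) \<otimes>\<^bsub>Qp p\<^esub> ?S F i" for i
    proof -
      have "?S (insert w F) i = c w \<otimes>\<^bsub>Qp p\<^esub> padic_of_rat p (w $ i) \<oplus>\<^bsub>Qp p\<^esub> ?S F i"
        using insert.hyps cw cF by (intro finsum_insert) (auto simp: Pi_iff)
      moreover have "padic_of_rat p (r $ i) \<otimes>\<^bsub>Qp p\<^esub> (c w \<otimes>\<^bsub>Qp p\<^esub> padic_of_rat p (w $ i) \<oplus>\<^bsub>Qp p\<^esub> ?S F i)
        = c w \<otimes>\<^bsub>Qp p\<^esub> (padic_of_rat p (r $ i) \<otimes>\<^bsub>Qp p\<^esub> padic_of_rat p (w $ i)) \<oplus>\<^bsub>Qp p\<^esub> padic_of_rat p (r $ i) \<otimes>\<^bsub>Qp p\<^esub> ?S F i"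
        using cw SF[of i] by (simp add: r_distr m_lcomm)
      ultimately show ?thesis by (simp add: padic_of_rat_hom[OF p])
    qed
    have "(\<Oplus>\<^bsub>Qp p\<^esub>i\<in>UNIV. padic_of_rat p (r $ i) \<otimes>\<^bsub>Qp p\<^esub> ?S (insert w F) i)
       = (\<Oplus>\<^bsub>Qp p\<^esub>i\<in>UNIV. c w \<otimes>\<^bsub>Qp p\<^esub> padic_of_rat p (r $ i * w $ i))
         \<oplus>\<^bsub>Qp p\<^esub> (\<Oplus>\<^bsub>Qp p\<^esub>i\<in>UNIV. padic_of_rat p (r $ i) \<otimes>\<^bsub>Qp p\<^esub> ?S F i)"
      unfolding step using cw SF by (intro finsum_addf) auto
    also have "(\<Oplus>\<^bsub>Qp p\<^esub>i\<in>UNIV. padic_of_rat p (r $ i) \<otimes>\<^bsub>Qp p\<^esub> ?S F i) = \<zero>\<^bsub>Qp p\<^esub>"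
      using insert by auto
    also have "(\<Oplus>\<^bsub>Qp p\<^esub>i\<in>UNIV. c w \<otimes>\<^bsub>Qp p\<^esub> padic_of_rat p (r $ i * w $ i))
        = c w \<otimes>\<^bsub>Qp p\<^esub> (\<Oplus>\<^bsub>Qp p\<^esub>i\<in>UNIV. padic_of_rat p (r $ i * w $ i))"
      using cw by (intro finsum_rdistr[symmetric]) auto
    also have "(\<Oplus>\<^bsub>Qp p\<^esub>i\<in>UNIV. padic_of_rat p (r $ i * w $ i)) = \<zero>\<^bsub>Qp p\<^esub>"
      using padic_of_rat_sum[OF p finite, of "\<lambda>i. r $ i * w $ i" UNIV] r[of w] insert.prems
      by (simp add: padic_of_rat_hom[OF p])
    finally show ?case using cw by simp
  qed
  then show ?thesis by (simp only: xi)
qed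

text \<open>A rational relation on \<open>V\<close> extends linearly to the span at every place, and
  an adele is determined by its components.\<close>

lemma adelic_points_dot_zero:
  fixes a :: "adele^'d" and r :: "rat^'d" and V :: "(rat^'d) set"
  assumes a: "a \<in> adelic_points V"
    and r: "\<And>v. v \<in> V \<Longrightarrow> (\<Sum>i\<in>UNIV. r $ i * v $ i) = 0"
  shows "adele_dot r a = 0"
proof (rule adele_eqI)
  obtain S where S: "(\<chi> i. adele_real (a $ i)) \<in> real_points V"
    "\<forall>p\<in>S. (\<chi> i. adele_padic p (a $ i)) \<in> Qp_points p V"
    "\<forall>p\<in>primes - S. (\<chi> i. adele_padic p (a $ i)) \<in> Zp_points p V"
    using a unfolding adelic_points_def by blast
  have "(\<Sum>i\<in>UNIV. of_rat (r $ i) * x $ i) = 0" if "x \<in> real_points V" for x :: "real^'d"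
    using that unfolding real_points_def
  proof (induction rule: span_induct)
    case base
    show ?case
      by (rule subspaceI) (auto simp: distrib_left sum.distrib scaleR_vec_def mult.left_commute simp flip: sum_distrib_left)
  next
    case (step x)
    then obtain v where v: "v \<in> V" "x = (\<chi> i. of_rat (v $ i))" by blast
    then have "(\<Sum>i\<in>UNIV. of_rat (r $ i) * x $ i) = of_rat (\<Sum>i\<in>UNIV. r $ i * v $ i)"
      by (simp add: of_rat_sum of_rat_mult)
    then show ?case using r[OF v(1)] by simp
  qed
  from this[OF S(1)] show "adele_real (adele_dot r a) = adele_real 0"
    by (simp add: adele_dot_def adele_real_sum zero_adele_def)
  fix p :: nat assume p: "prime p"
  have "Zp_points p V \<subseteq> Qp_points p V"
    using Zp_subset[of p] unfolding Zp_points_def Qp_points_def padic_span_def by fastforce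
  then have "(\<chi> i. adele_padic p (a $ i)) \<in> padic_span p (carrier (Qp p)) V"
    using S p unfolding Qp_points_def by blast
  from padic_span_dot_zero[OF p this r]
  show "adele_padic p (adele_dot r a) = adele_padic p 0"
    using p by (simp add: adele_dot_def adele_padic_sum zero_adele_def padic_of_rat_hom)
qed

section \<open>Adelic points as combinations of rational vectors\<close>

lemma padic_span_add_base:
  fixes x :: "padic^'d" and w :: "rat^'d"
  assumes p: "prime p" and R: "R \<subseteq> carrier (Qp p)" "\<zero>\<^bsub>Qp p\<^esub> \<in> R"
    "\<And>x y. x \<in> R \<Longrightarrow> y \<in> R \<Longrightarrow> x \<oplus>\<^bsub>Qp p\<^esub> y \<in> R"
    and x: "x \<in> padic_span p R B" and w: "w \<in> B" and d: "d \<in> R"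
  shows "(\<chi> i. d \<otimes>\<^bsub>Qp p\<^esub> padic_of_rat p (w $ i) \<oplus>\<^bsub>Qp p\<^esub> x $ i) \<in> padic_span p R B"
proof -
  interpret cring "Qp p" by (rule Qp_cring[OF p])
  note [simp] = padic_of_rat_in_Qp
  obtain F c where F: "finite F" "F \<subseteq> B" "c \<in> F \<rightarrow> R"
    and xi: "\<And>i. x $ i = (\<Oplus>\<^bsub>Qp p\<^esub>v\<in>F. c v \<otimes>\<^bsub>Qp p\<^esub> padic_of_rat p (v $ i))"
    using x unfolding padic_span_def by blast
  \<comment> \<open>\<open>padic_span\<close> indexes combinations by a set of vectors, so if
    \<open>w\<close> already occurs, its old coefficient \<open>b\<close> must be merged with
    \<open>d\<close>.\<close>
  define F' where "F' = F - {w}"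
  define b where "b = (if w \<in> F then c w else \<zero>\<^bsub>Qp p\<^esub>)"
  define c' where "c' = c(w := d \<oplus>\<^bsub>Qp p\<^esub> b)"
  have b: "b \<in> R" using F(3) R(2) by (auto simp: b_def)
  have F': "finite F'" "F' \<subseteq> B" "w \<notin> F'" using F by (auto simp: F'_def)
  have cR: "c v \<in> R" if "v \<in> F'" for v using F(3) that by (auto simp: F'_def)
  have cC: "c v \<in> carrier (Qp p)" if "v \<in> F'" for v using cR[OF that] R(1) by blast
  have bC: "b \<in> carrier (Qp p)" and dC: "d \<in> carrier (Qp p)" using b d R(1) by auto
  let ?S = "\<lambda>i. \<Oplus>\<^bsub>Qp p\<^esub>v\<in>F'. c v \<otimes>\<^bsub>Qp p\<^esub> padic_of_rat p (v $ i)"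
  have Sc: "?S i \<in> carrier (Qp p)" for i using cC by (intro finsum_closed) auto
  have x': "x $ i = b \<otimes>\<^bsub>Qp p\<^esub> padic_of_rat p (w $ i) \<oplus>\<^bsub>Qp p\<^esub> ?S i" for i
  proof (cases "w \<in> F")
    case True
    then have "F = insert w F'" by (auto simp: F'_def)
    then have "x $ i = (\<Oplus>\<^bsub>Qp p\<^esub>v\<in>insert w F'. c v \<otimes>\<^bsub>Qp p\<^esub> padic_of_rat p (v $ i))" by (simp only: xi)
    also have "\<dots> = c w \<otimes>\<^bsub>Qp p\<^esub> padic_of_rat p (w $ i) \<oplus>\<^bsub>Qp p\<^esub> ?S i"
      using F' cC bC True by (intro finsum_insert) (auto simp: b_def)
    finally show ?thesis using True by (simp add: b_def)
  next
    case False
    then show ?thesis using Sc[of i] xi by (simp add: b_def F'_def)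
  qed
  have "d \<otimes>\<^bsub>Qp p\<^esub> padic_of_rat p (w $ i) \<oplus>\<^bsub>Qp p\<^esub> x $ i
      = (\<Oplus>\<^bsub>Qp p\<^esub>v\<in>insert w F'. c' v \<otimes>\<^bsub>Qp p\<^esub> padic_of_rat p (v $ i))" for i
  proof -
    have "(\<Oplus>\<^bsub>Qp p\<^esub>v\<in>insert w F'. c' v \<otimes>\<^bsub>Qp p\<^esub> padic_of_rat p (v $ i))
      = c' w \<otimes>\<^bsub>Qp p\<^esub> padic_of_rat p (w $ i) \<oplus>\<^bsub>Qp p\<^esub> (\<Oplus>\<^bsub>Qp p\<^esub>v\<in>F'. c' v \<otimes>\<^bsub>Qp p\<^esub> padic_of_rat p (v $ i))"
      using F' cC bC dC by (intro finsum_insert) (auto simp: c'_def)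
    also have "(\<Oplus>\<^bsub>Qp p\<^esub>v\<in>F'. c' v \<otimes>\<^bsub>Qp p\<^esub> padic_of_rat p (v $ i)) = ?S i"
      using F' cC by (intro finsum_cong') (auto simp: c'_def)
    finally show ?thesis
      using bC dC Sc[of i] by (simp add: x' c'_def l_distr a_assoc)
  qed
  moreover have "c' \<in> insert w F' \<rightarrow> R" using cR b d R(3) by (auto simp: c'_def)
  moreover have "finite (insert w F')" "insert w F' \<subseteq> B" using F' w by auto
  ultimately show ?thesis unfolding padic_span_def by (intro CollectI exI[of _ "insert w F'"] exI[of _ c']) simp
qed

text \<open>Indexing by \<open>J\<close> permits repeated vectors, as among the columns of a
  matrix.\<close>

lemma padic_span_sum:
  fixes v :: "'j \<Rightarrow> rat^'d"
  assumes p: "prime p" and R: "R \<subseteq> carrier (Qp p)" "\<zero>\<^bsub>Qp p\<^esub> \<in> R"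
    "\<And>x y. x \<in> R \<Longrightarrow> y \<in> R \<Longrightarrow> x \<oplus>\<^bsub>Qp p\<^esub> y \<in> R"
    and J: "finite J" "\<And>j. j \<in> J \<Longrightarrow> c j \<in> R" "\<And>j. j \<in> J \<Longrightarrow> v j \<in> B"
  shows "(\<chi> i. \<Oplus>\<^bsub>Qp p\<^esub>j\<in>J. c j \<otimes>\<^bsub>Qp p\<^esub> padic_of_rat p (v j $ i)) \<in> padic_span p R B"
  using J
proof (induction J)
  case empty
  interpret cring "Qp p" by (rule Qp_cring[OF p])
  show ?case unfolding padic_span_def by (intro CollectI exI[of _ "{}"]) simp
next
  case (insert k J)
  interpret cring "Qp p" by (rule Qp_cring[OF p])
  have c: "c j \<in> carrier (Qp p)" if "j \<in> insert k J" for j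
    using insert.prems(1)[OF that] R(1) by blast
  have "(\<Oplus>\<^bsub>Qp p\<^esub>j\<in>insert k J. c j \<otimes>\<^bsub>Qp p\<^esub> padic_of_rat p (v j $ i))
      = c k \<otimes>\<^bsub>Qp p\<^esub> padic_of_rat p (v k $ i) \<oplus>\<^bsub>Qp p\<^esub> (\<Oplus>\<^bsub>Qp p\<^esub>j\<in>J. c j \<otimes>\<^bsub>Qp p\<^esub> padic_of_rat p (v j $ i))" for i
    using insert.hyps c by (intro finsum_insert) (auto simp: padic_of_rat_in_Qp)
  then show ?case
    using padic_span_add_base[OF p R insert.IH, of "v k" "c k"] insert.prems by simp
qed

lemma finite_common_denominator:
  assumes "finite (Q :: rat set)"
  shows "\<exists>D::nat. D > 0 \<and> (\<forall>q\<in>Q. of_nat D * q \<in> \<int>)"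
  using assms
proof (induction Q)
  case (insert q Q)
  then obtain D :: nat where D: "D > 0" "\<forall>q\<in>Q. of_nat D * q \<in> \<int>" by auto
  obtain a b where ab: "b > 0" "q = of_int a / of_int b" by (rule rat_as_fraction)
  define b' where "b' = nat b"
  have b': "b' > 0" "of_nat b' * q \<in> \<int>" using ab by (auto simp: b'_def)
  have "of_nat (D * b') * q' = of_nat D * (of_nat b' * q')" for q' :: rat by simp
  moreover have "of_nat (D * b') * q' = of_nat b' * (of_nat D * q')" for q' :: rat by simp
  ultimately have "\<forall>q'\<in>insert q Q. of_nat (D * b') * q' \<in> \<int>"
    using D(2) b'(2) by (metis Ints_mult Ints_of_nat insert_iff)
  then show ?case using D(1) b'(1) by (intro exI[of _ "D * b'"]) simp
qed auto

lemma adele_act_in_adelic_points: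
  fixes M :: "rat^'d^'d"
  assumes V: "vec.subspace V" and M: "\<And>j. column j M \<in> V"
  shows "adele_act M z \<in> adelic_points V"
proof -
  obtain D :: nat where D: "D > 0" "\<And>i j. of_nat D * M $ i $ j \<in> \<int>"
  proof -
    have "finite (range (\<lambda>(i, j). M $ i $ j))" by simp
    from finite_common_denominator[OF this] show thesis using that by auto
  qed
  \<comment> \<open>Outside this set \<open>D\<close> is a unit and \<open>z\<close> is integral, so
    the product combines the integral vectors \<open>D *s column j M\<close> with integral
    coefficients \<open>z $ j / D\<close>.\<close>
  let ?S = "{p. prime p \<and> p dvd D} \<union> (\<Union>j. {p \<in> primes. adele_padic p (z $ j) \<notin> Zp p})"
  have "finite {p \<in> primes. adele_padic p (z $ j) \<notin> Zp p}" for j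
    using Rep_adele[of "z $ j"] by (simp add: adele_padic.rep_eq case_prod_unfold)
  moreover have "finite {p. prime p \<and> p dvd D}"
    using finite_divisors_nat[OF D(1)] by (rule rev_finite_subset) auto
  ultimately have fin: "finite ?S" by auto
  have comp: "adele_act M z $ i = (\<Sum>j\<in>UNIV. adele_of_rat (M $ i $ j) * z $ j)" for i
    by (simp add: matrix_vector_mult_def)
  have real: "(\<chi> i. adele_real (adele_act M z $ i)) \<in> real_points V"
  proof -
    have "(\<chi> i. adele_real (adele_act M z $ i)) = (\<Sum>j\<in>UNIV. adele_real (z $ j) *\<^sub>R (\<chi> i. of_rat (column j M $ i)))"
      by (simp add: vec_eq_iff comp adele_real_sum column_def mult.commute)
    also have "\<dots> \<in> real_points V"
      unfolding real_points_def using M by (intro span_sum span_scale span_base imageI)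
    finally show ?thesis .
  qed
  have Qp: "(\<chi> i. adele_padic p (adele_act M z $ i)) \<in> Qp_points p V" if p: "prime p" for p
  proof -
    interpret cring "Qp p" by (rule Qp_cring[OF p])
    have "adele_padic p (adele_act M z $ i) = (\<Oplus>\<^bsub>Qp p\<^esub>j\<in>UNIV. adele_padic p (z $ j) \<otimes>\<^bsub>Qp p\<^esub> padic_of_rat p (column j M $ i))" for i
      unfolding comp adele_padic_sum[OF p finite]
      using p adele_padic_in_Qp[OF p] by (simp add: column_def m_comm padic_of_rat_in_Qp)
    then show ?thesis
      unfolding Qp_points_def using padic_span_sum[OF p subset_refl, of UNIV "\<lambda>j. adele_padic p (z $ j)" "\<lambda>j. column j M" V] M adele_padic_in_Qp[OF p]
      by simp
  qed
  have Zp: "(\<chi> i. adele_padic p (adele_act M z $ i)) \<in> Zp_points p V" if p: "p \<in> primes - ?S" for p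
  proof -
    have pp: "prime p" and pD: "\<not> p dvd D" and zZ: "\<And>j. adele_padic p (z $ j) \<in> Zp p" using p by auto
    interpret cring "Qp p" by (rule Qp_cring[OF pp])
    let ?e = "padic_of_rat p (1 / of_nat D)"
    have e: "?e \<in> Zp p"
      using padic_abs_fraction_le_1[OF pp, of "int D" 1] pD pp by (simp add: padic_of_rat_in_Zp_iff)
    have split: "padic_of_rat p (M $ i $ j) \<otimes>\<^bsub>Qp p\<^esub> adele_padic p (z $ j)
       = (?e \<otimes>\<^bsub>Qp p\<^esub> adele_padic p (z $ j)) \<otimes>\<^bsub>Qp p\<^esub> padic_of_rat p ((of_nat D *s column j M) $ i)" for i j
    proof -
      have "M $ i $ j = 1 / of_nat D * (of_nat D *s column j M) $ i"
        using D(1) by (simp add: column_def)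
      then have "padic_of_rat p (M $ i $ j) = ?e \<otimes>\<^bsub>Qp p\<^esub> padic_of_rat p ((of_nat D *s column j M) $ i)"
        by (simp only: padic_of_rat_hom(4)[OF pp])
      then show ?thesis
        using adele_padic_in_Qp[OF pp, of "z $ j"] by (simp only: padic_of_rat_in_Qp m_ac m_closed)
    qed
    have "adele_padic p (adele_act M z $ i)
       = (\<Oplus>\<^bsub>Qp p\<^esub>j\<in>UNIV. (?e \<otimes>\<^bsub>Qp p\<^esub> adele_padic p (z $ j)) \<otimes>\<^bsub>Qp p\<^esub> padic_of_rat p ((of_nat D *s column j M) $ i))" for i
      unfolding comp adele_padic_sum[OF pp finite] split[symmetric] using pp by simp
    moreover have "(\<chi> i. \<Oplus>\<^bsub>Qp p\<^esub>j\<in>UNIV. (?e \<otimes>\<^bsub>Qp p\<^esub> adele_padic p (z $ j)) \<otimes>\<^bsub>Qp p\<^esub> padic_of_rat p ((of_nat D *s column j M) $ i))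
        \<in> padic_span p (Zp p) {v \<in> V. \<forall>i. v $ i \<in> \<int>}"
    proof (rule padic_span_sum[OF pp Zp_subset Zp_0_1(1)[OF pp] Zp_closed(1)[OF pp] finite])
      show "?e \<otimes>\<^bsub>Qp p\<^esub> adele_padic p (z $ j) \<in> Zp p" for j using Zp_closed(2)[OF pp e zZ] .
      show "of_nat D *s column j M \<in> {v \<in> V. \<forall>i. v $ i \<in> \<int>}" for j
        using D(2) M V by (auto simp: column_def vec.subspace_scale)
    qed
    ultimately show ?thesis unfolding Zp_points_def by (simp only:)
  qed
  show ?thesis
    unfolding adelic_points_def using fin real Qp Zp by (intro UN_I[of ?S]) auto
qed

definition rational_annihilator :: "(rat^'d) set \<Rightarrow> (rat^'d) set" where
  "rational_annihilator W = {v. \<forall>r\<in>W. (\<Sum>i\<in>UNIV. r $ i * v $ i) = 0}"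

lemma subspace_rational_annihilator: "vec.subspace (rational_annihilator W)"
  by (rule vec.subspaceI)
    (auto simp: rational_annihilator_def distrib_left sum.distrib mult.left_commute simp flip: sum_distrib_left)

text \<open>
  With \<open>M\<close> a projection onto \<open>W\<close> acting on rows, \<open>z\<close> is the sum of \<open>M z\<close>, which is rational, and
  \<open>(1 - M) z\<close>, an adelic combination of the columns of \<open>1 - M\<close>, which are annihilated by \<open>W\<close>.
\<close>

lemma rational_mod_annihilator:
  fixes z :: "adele^'d"
  assumes W: "vec.subspace W" and z: "\<And>r. r \<in> W \<Longrightarrow> adele_dot r z \<in> range adele_of_rat"
  shows "\<exists>v\<in>adelic_points (rational_annihilator W). z - v \<in> range adele_vec_of_rat"
proof -
  obtain M :: "rat^'d^'d" where M: "\<And>i. M $ i \<in> W" "\<And>r. r \<in> W \<Longrightarrow> r v* M = r"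
    using subspace_row_projection[OF W] by blast
  have "column j (mat 1 - M) \<in> rational_annihilator W" for j
    unfolding rational_annihilator_def
  proof (intro CollectI ballI)
    fix r assume r: "r \<in> W"
    have "(\<Sum>i\<in>UNIV. r $ i * column j (mat 1 - M) $ i) = r $ j - (r v* M) $ j"
      by (simp add: column_def mat_def right_diff_distrib sum_subtractf vector_matrix_mult_def
          mult.commute if_distrib[of "(*) _"] cong: if_cong)
    then show "(\<Sum>i\<in>UNIV. r $ i * column j (mat 1 - M) $ i) = 0" using M(2)[OF r] by simp
  qed
  then have "adele_act (mat 1 - M) z \<in> adelic_points (rational_annihilator W)"
    by (intro adele_act_in_adelic_points subspace_rational_annihilator)
  moreover have "z - adele_act (mat 1 - M) z = (\<chi> i. adele_dot (M $ i) z)"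
  proof -
    have "adele_act (mat 1 - M) z $ i = z $ i - adele_dot (M $ i) z" for i
    proof -
      have "adele_act (mat 1 - M) z $ i
          = (\<Sum>j\<in>UNIV. adele_of_rat (mat 1 $ i $ j) * z $ j) - adele_dot (M $ i) z"
        by (simp add: matrix_vector_mult_def adele_dot_def adele_of_rat_diff left_diff_distrib sum_subtractf)
      also have "(\<Sum>j\<in>UNIV. adele_of_rat (mat 1 $ i $ j) * z $ j) = (\<Sum>j\<in>UNIV. if j = i then z $ j else 0)"
        by (intro sum.cong) (auto simp: mat_def adele_of_rat_hom)
      finally show ?thesis by simp
    qed
    then show ?thesis by (simp add: vec_eq_iff)
  qed
  moreover have "(\<chi> i. adele_dot (M $ i) z) \<in> range adele_vec_of_rat"
  proof -
    have "\<forall>i. \<exists>q. adele_dot (M $ i) z = adele_of_rat q" using z[OF M(1)] by blast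
    then obtain q where "\<forall>i. adele_dot (M $ i) z = adele_of_rat (q i)" by (elim choice[THEN exE])
    then have "(\<chi> i. adele_dot (M $ i) z) = adele_vec_of_rat (\<chi> i. q i)"
      by (simp add: vec_eq_iff adele_vec_of_rat_def)
    then show ?thesis by simp
  qed
  ultimately show ?thesis by metis
qed

section \<open>Density of orbits\<close>

lemma adele_char_power: "adele_char (adele_of_rat (of_nat n) * w) = adele_char w ^ n"
  by (induction n) (simp_all add: adele_of_rat_hom distrib_right adele_char_add)

lemma adele_char_sum: "adele_char (sum f A) = (\<Prod>i\<in>A. adele_char (f i))"
  by (induction A rule: infinite_finite_induct) (simp_all add: adele_char_add)

lemma adele_char_range: "b \<in> range adele_of_rat \<Longrightarrow> adele_char b = 1"
  by auto

lemma polynomial_map_adele_dot_orbit: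
  assumes "poly_family A P"
  shows "polynomial_map (\<lambda>t. adele_dot r (adele_act (P t) a - y))"
proof -
  have entry: "polynomial_map (\<lambda>t. adele_of_rat (P t $ i $ j))" for i j
    by (rule polynomial_map_hom[where p = "\<lambda>t. P t $ i $ j" and f = adele_of_rat])
      (use assms in \<open>simp_all add: poly_family_def adele_of_rat_hom\<close>)
  have "polynomial_map (\<lambda>t. \<Sum>i\<in>UNIV. adele_of_rat (r $ i) * ((\<Sum>j\<in>UNIV. adele_of_rat (P t $ i $ j) * a $ j) + - y $ i))"
    by (intro polynomial_map_sum polynomial_map_mult polynomial_map_add polynomial_map_const entry)
  then show ?thesis
    by (simp add: adele_dot_def matrix_vector_mult_def)
qed

text \<open>A constant phase would make the polynomial constant modulo the rationals; comparing its
  values where \<open>P\<close> is \<open>g\<close> and where it is the identity would make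
  \<open>r\<close> rational on \<open>g a - a\<close>. The point \<open>y\<close> cancels.\<close>

lemma poly_family_mean_zero:
  assumes P: "poly_family A P" and g: "g \<in> range P"
    and r: "adele_dot r (adele_act g a - a) \<notin> range adele_of_rat"
  shows "mean_zero (\<lambda>t. adele_char (adele_dot r (adele_act (P t) a - y)))"
proof -
  let ?p = "\<lambda>t. adele_dot r (adele_act (P t) a - y)"
  have p: "polynomial_map ?p" by (rule polynomial_map_adele_dot_orbit[OF P])
  then obtain n where n: "phase_poly n (\<lambda>t. adele_char (?p t))"
    unfolding polynomial_map_def using degree_le_adele_char by blast
  have "\<not> (\<lambda>t. adele_char (?p t)) constant_on UNIV"
  proof
    assume const: "(\<lambda>t. adele_char (?p t)) constant_on UNIV"
    note rat = polynomial_map_adele_char_const[OF fun_rat_divisible p const]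
    obtain s where s: "P s = g" using g by blast
    obtain t where t: "P t = mat 1" using P unfolding poly_family_def by fastforce
    have one: "adele_act (mat 1) a = a"
    proof -
      have "map_matrix adele_of_rat (mat 1) = (mat 1 :: adele^'a^'a)"
        by (simp add: vec_eq_iff mat_def adele_of_rat_hom)
      then show ?thesis by simp
    qed
    have "(?p s - ?p 0) - (?p t - ?p 0) \<in> range adele_of_rat"
      by (intro range_adele_of_rat_closed rat)
    moreover have "(?p s - ?p 0) - (?p t - ?p 0) = adele_dot r (adele_act g a - a)"
      by (simp add: s t one adele_dot_diff_right)
    ultimately show False using r by simp
  qed
  then show ?thesis
    using phase_poly_mean_zero[OF fun_rat_divisible n] by simp
qed

lemma polynomial_orbit_dense:
  fixes A :: "(rat^'d^'d) set" and a y :: "adele^'d"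
  assumes one: "mat 1 \<in> A" and mult: "\<And>g h. g \<in> A \<Longrightarrow> h \<in> A \<Longrightarrow> g ** h \<in> A"
    and gen: "\<And>g. g \<in> A \<Longrightarrow> \<exists>P. poly_family A P \<and> g \<in> range P"
    and y: "\<And>r. r \<in> orbit_relations A a \<Longrightarrow> adele_dot r (y - a) \<in> range adele_of_rat"
    and eN: "e > 0" "N > 0"
  shows "\<exists>g\<in>A. \<forall>i. \<exists>q. adele_act g a $ i - y $ i - adele_of_rat q \<in> adele_ball e N"
proof (rule ccontr)
  assume contra: "\<not> ?thesis"
  obtain d where d: "0 \<le> d" "d < 1" "\<forall>z. (1 + Re (adele_char (adele_of_rat (1 / of_nat N) * z))) / 2 > d \<longrightarrow>
     (\<exists>q. z - adele_of_rat q \<in> adele_ball e N)"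
    using adele_char_near_1[OF eN] by blast
  obtain m where m: "d ^ m < (real ((2*m) choose m) / 4 ^ m) ^ CARD('d)"
    using central_binomial_power_dominates[OF d(1,2), of "CARD('d)"] by auto
  let ?K = "\<Pi>\<^sub>E i\<in>(UNIV :: 'd set). {..2*m}"
  let ?W = "orbit_relations A a"
  \<comment> \<open>The frequencies \<open>k i - m\<close> of a kernel term, scaled by the
    \<open>1 / N\<close> of the neighbourhood test.\<close>
  define \<rho> :: "('d \<Rightarrow> nat) \<Rightarrow> rat^'d" where "\<rho> k = (\<chi> i. (of_nat (k i) - of_nat m) / of_nat N)" for k
  let ?F = "{k \<in> ?K. \<rho> k \<notin> ?W}"
  have finF: "finite ?F" by (simp add: finite_PiE)
  have "\<forall>k\<in>?F. \<exists>g. g \<in> A \<and> adele_dot (\<rho> k) (adele_act g a - a) \<notin> range adele_of_rat"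
    unfolding orbit_relations_def by blast
  then obtain g where g: "\<forall>k\<in>?F. g k \<in> A \<and> adele_dot (\<rho> k) (adele_act (g k) a - a) \<notin> range adele_of_rat"
    by (elim bchoice[THEN exE])
  have "\<exists>P. poly_family A P \<and> g ` ?F \<subseteq> range P"
    using finF g by (intro poly_family_finite one gen mult) auto
  then obtain P where P: "poly_family A P" "g ` ?F \<subseteq> range P" by blast
  have PA: "P t \<in> A" for t using P(1) by (auto simp: poly_family_def)
  define \<theta> where "\<theta> t i = adele_char (adele_of_rat (1 / of_nat N) * (adele_act (P t) a $ i - y $ i))" for t i
  have prod: "(\<Prod>i\<in>UNIV. \<theta> t i ^ k i * cnj (\<theta> t i) ^ m) = adele_char (adele_dot (\<rho> k) (adele_act (P t) a - y))" for k t
  proof -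
    have "\<theta> t i ^ k i * cnj (\<theta> t i) ^ m = adele_char (adele_of_rat (\<rho> k $ i) * (adele_act (P t) a - y) $ i)" for i
    proof -
      let ?w = "adele_of_rat (1 / of_nat N) * (adele_act (P t) a $ i - y $ i)"
      have "\<rho> k $ i = of_nat (k i) * (1 / of_nat N) - of_nat m * (1 / of_nat N)"
        by (simp add: \<rho>_def diff_divide_distrib)
      then have "adele_of_rat (\<rho> k $ i) * (adele_act (P t) a - y) $ i
          = adele_of_rat (of_nat (k i)) * ?w - adele_of_rat (of_nat m) * ?w"
        by (simp only: adele_of_rat_diff adele_of_rat_hom(4) left_diff_distrib mult.assoc vector_minus_component)
      then show ?thesis
        by (simp only: adele_char_diff adele_char_power \<theta>_def complex_cnj_power)
    qed
    then show ?thesis by (simp add: adele_dot_def adele_char_sum)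
  qed
  have "(real ((2*m) choose m) / 4 ^ m) ^ CARD('d) \<le> d ^ m"
  proof (rule trigonometric_average_bound[where \<theta> = \<theta>])
    show "norm (\<theta> t i) = 1" for t i by (simp add: \<theta>_def)
    fix t
    obtain i where i: "\<forall>q. adele_act (P t) a $ i - y $ i - adele_of_rat q \<notin> adele_ball e N"
      using contra PA[of t] by blast
    have "\<not> d < (1 + Re (\<theta> t i)) / 2"
      unfolding \<theta>_def using d(3)[rule_format, of "adele_act (P t) a $ i - y $ i"] i by blast
    then show "\<exists>i. (1 + Re (\<theta> t i)) / 2 \<le> d" by (intro exI[of _ i]) simp
  next
    fix k assume k: "k \<in> ?K"
    show "mean_zero (\<lambda>t. \<Prod>i\<in>UNIV. \<theta> t i ^ k i * cnj (\<theta> t i) ^ m) \<or> (\<forall>t. (\<Prod>i\<in>UNIV. \<theta> t i ^ k i * cnj (\<theta> t i) ^ m) = 1)"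
      unfolding prod
    proof (cases "\<rho> k \<in> ?W")
      case True
      \<comment> \<open>A relation is rational on both \<open>P t a - a\<close> and
        \<open>y - a\<close>, so the character is 1 along the whole family.\<close>
      have "adele_dot (\<rho> k) (adele_act (P t) a - y) \<in> range adele_of_rat" for t
      proof -
        have "adele_dot (\<rho> k) (adele_act (P t) a - a) - adele_dot (\<rho> k) (y - a) \<in> range adele_of_rat"
          using True PA[of t] y[OF True] by (intro range_adele_of_rat_closed) (auto simp: orbit_relations_def)
        then show ?thesis by (simp add: adele_dot_diff_right)
      qed
      then have "adele_char (adele_dot (\<rho> k) (adele_act (P t) a - y)) = 1" for t
        by (simp add: adele_char_range)
      then show "mean_zero (\<lambda>t. adele_char (adele_dot (\<rho> k) (adele_act (P t) a - y))) \<or>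
          (\<forall>t. adele_char (adele_dot (\<rho> k) (adele_act (P t) a - y)) = 1)" by blast
    next
      case False
      then have kF: "k \<in> ?F" using k by blast
      then have "mean_zero (\<lambda>t. adele_char (adele_dot (\<rho> k) (adele_act (P t) a - y)))"
        using g P(2) by (intro poly_family_mean_zero[OF P(1), of "g k"]) auto
      then show "mean_zero (\<lambda>t. adele_char (adele_dot (\<rho> k) (adele_act (P t) a - y))) \<or>
          (\<forall>t. adele_char (adele_dot (\<rho> k) (adele_act (P t) a - y)) = 1)" by blast
    qed
  qed
  then show False using m by simp
qed

text \<open>Rationality of \<open>r\<close> on \<open>z\<close> is a closed condition: pairing with
  \<open>r\<close> distorts balls by bounded factors, so the value is approximated by rationals,
  which are closed in the adeles.\<close>

lemma adele_dot_in_range_of_ratI: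
  fixes z :: "adele^'d"
  assumes "\<And>e N. e > 0 \<Longrightarrow> N > 0 \<Longrightarrow> \<exists>b. adele_dot r b \<in> range adele_of_rat \<and> (\<forall>i. \<exists>q. b $ i - z $ i - adele_of_rat q \<in> adele_ball e N)"
  shows "adele_dot r z \<in> range adele_of_rat"
proof (rule adele_in_range_of_ratI)
  fix e :: real and N :: nat assume eN: "e > 0" "N > 0"
  obtain D :: nat where D: "D > 0" "\<And>i. of_nat D * r $ i \<in> \<int>"
    using finite_common_denominator[of "range (\<lambda>i. r $ i)"] by auto
  \<comment> \<open>\<open>C\<close> accounts for the size of \<open>r\<close> at the real place, as
    \<open>D\<close> does for its denominators at the primes. The added 1 keeps \<open>C\<close>
    positive for \<open>r = 0\<close> and makes the estimate strict.\<close>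
  define C where "C = (\<Sum>i\<in>UNIV. \<bar>of_rat (r $ i) :: real\<bar>) + 1"
  have C: "C > 0" "(\<Sum>i\<in>UNIV. \<bar>of_rat (r $ i) :: real\<bar>) < C"
    by (auto simp: C_def add_nonneg_pos sum_nonneg)
  have "e / C > 0" "N * D > 0" using eN C D by auto
  then obtain b where b: "adele_dot r b \<in> range adele_of_rat" "\<forall>i. \<exists>q. b $ i - z $ i - adele_of_rat q \<in> adele_ball (e / C) (N * D)"
    using assms by blast
  obtain q where q: "\<forall>i. b $ i - z $ i - adele_of_rat (q i) \<in> adele_ball (e / C) (N * D)"
    using b(2) by (elim choice[THEN exE])
  define c where "c = (\<chi> i. b $ i - z $ i - adele_of_rat (q i))"
  have c: "c $ i \<in> adele_ball (e / C) (N * D)" for i using q by (simp add: c_def)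
  have cz: "z + c = b - adele_vec_of_rat (\<chi> i. q i)"
    by (simp add: vec_eq_iff c_def adele_vec_of_rat_def)
  have "adele_dot r (z + c) \<in> range adele_of_rat"
    unfolding cz adele_dot_diff_right adele_dot_of_rat using b(1) by (intro range_adele_of_rat_closed) auto
  then obtain s where s: "adele_dot r z + adele_dot r c = adele_of_rat s"
    by (auto simp: adele_dot_add_right)
  have "- adele_dot r c \<in> adele_ball e N"
    unfolding adele_ball_def
  proof (intro CollectI conjI)
    have "\<bar>adele_real (adele_dot r c)\<bar> \<le> (\<Sum>i\<in>UNIV. \<bar>of_rat (r $ i)\<bar> * \<bar>adele_real (c $ i)\<bar>)"
      unfolding adele_dot_def adele_real_sum by (rule order_trans[OF sum_abs]) (simp add: abs_mult)
    also have "\<dots> \<le> (\<Sum>i\<in>UNIV. \<bar>of_rat (r $ i)\<bar> * (e / C))"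
      using c by (intro sum_mono mult_left_mono) (auto simp: adele_ball_def intro: less_imp_le)
    also have "\<dots> = (\<Sum>i\<in>UNIV. \<bar>of_rat (r $ i)\<bar>) * (e / C)"
      by (rule sum_distrib_right[symmetric])
    also have "\<dots> < C * (e / C)"
      using C eN by (intro mult_strict_right_mono) auto
    finally show "\<bar>adele_real (- adele_dot r c)\<bar> < e" using C by simp
    have "adele_of_rat (1 / of_nat N) * adele_dot r c = (\<Sum>i\<in>UNIV. adele_of_rat (of_nat D * r $ i) * (adele_of_rat (1 / of_nat (N * D)) * c $ i))"
    proof -
      have "1 / of_nat N * r $ i = of_nat D * r $ i * (1 / of_nat (N * D))" for i
        using D(1) by simp
      then have "adele_of_rat (1 / of_nat N) * (adele_of_rat (r $ i) * c $ i)
          = adele_of_rat (of_nat D * r $ i) * (adele_of_rat (1 / of_nat (N * D)) * c $ i)" for i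
        by (simp only: mult.assoc[symmetric] adele_of_rat_hom(4)[symmetric])
      then show ?thesis by (simp only: adele_dot_def sum_distrib_left)
    qed
    also have "\<dots> \<in> integral_adeles"
    proof -
      have zero: "0 \<in> integral_adeles" using adele_of_rat_integral_iff[of 0] by (simp add: adele_of_rat_hom)
      have summand: "adele_of_rat (of_nat D * r $ i) * (adele_of_rat (1 / of_nat (N * D)) * c $ i) \<in> integral_adeles" for i
        using c[of i] D(2)[of i] by (rule_tac integral_adeles_closed(2)) (simp_all only: adele_of_rat_integral_iff adele_ball_def mem_Collect_eq)
      have "(\<Sum>i\<in>J. adele_of_rat (of_nat D * r $ i) * (adele_of_rat (1 / of_nat (N * D)) * c $ i)) \<in> integral_adeles" for J
        by (induction J rule: infinite_finite_induct) (simp_all only: sum.infinite sum.empty sum.insert zero integral_adeles_closed summand not_False_eq_True)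
      then show ?thesis .
    qed
    finally have int: "adele_of_rat (1 / of_nat N) * adele_dot r c \<in> integral_adeles" .
    have "- (adele_of_rat (1 / of_nat N) * adele_dot r c) \<in> integral_adeles"
      by (rule integral_adeles_closed(3)[OF int int])
    then show "adele_of_rat (1 / of_nat N) * - adele_dot r c \<in> integral_adeles" by simp
  qed
  moreover have "adele_dot r z - adele_of_rat s = - adele_dot r c" unfolding s[symmetric] by simp
  ultimately show "\<exists>q. adele_dot r z - adele_of_rat q \<in> adele_ball e N" by metis
qed

lemma solenoid_orbit_closure:
  fixes A :: "(rat^'d^'d) set" and a :: "adele^'d"
  assumes one: "mat 1 \<in> A" and mult: "\<And>g h. g \<in> A \<Longrightarrow> h \<in> A \<Longrightarrow> g ** h \<in> A"
    and gen: "\<And>g. g \<in> A \<Longrightarrow> \<exists>P. poly_family A P \<and> g \<in> range P"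
  shows "closure ((\<lambda>g. rat_matrix_act g (solenoid_proj a)) ` A) =
    (\<lambda>v. solenoid_proj a + solenoid_proj v) ` adelic_points (rational_annihilator (orbit_relations A a))"
    (is "closure ?O = ?R")
proof -
  let ?W = "orbit_relations A a"
  let ?B = "(\<lambda>g. adele_act g a) ` A"
  have act: "rat_matrix_act g (solenoid_proj z) = solenoid_proj (adele_act g z)" for g and z :: "adele^'d"
    by (rule rat_matrix_act.abs_eq)
  have add: "solenoid_proj y + solenoid_proj z = solenoid_proj (y + z)" for y z :: "adele^'d"
    by (rule plus_solenoid.abs_eq)
  have O: "?O = solenoid_proj ` ?B" by (simp add: act image_image)
  show ?thesis
  proof (intro equalityI subsetI)
    fix x assume x: "x \<in> closure ?O"
    obtain y where y: "x = solenoid_proj y" by (metis Quotient_solenoid Quotient_abs_rep)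
    have "adele_dot r (y - a) \<in> range adele_of_rat" if r: "r \<in> ?W" for r
    proof (rule adele_dot_in_range_of_ratI)
      fix e :: real and N :: nat assume "e > 0" "N > 0"
      then obtain g where g: "g \<in> A" "\<forall>i. \<exists>q. adele_act g a $ i - y $ i - adele_of_rat q \<in> adele_ball e N"
        using x unfolding O y solenoid_in_closure_iff by blast
      show "\<exists>b. adele_dot r b \<in> range adele_of_rat \<and> (\<forall>i. \<exists>q. b $ i - (y - a) $ i - adele_of_rat q \<in> adele_ball e N)"
        using r g by (intro exI[of _ "adele_act g a - a"]) (simp add: orbit_relations_def)
    qed
    then obtain v where v: "v \<in> adelic_points (rational_annihilator ?W)" "(y - a) - v \<in> range adele_vec_of_rat"
      using rational_mod_annihilator[OF subspace_orbit_relations] by blast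
    have eq: "y - (a + v) = (y - a) - v" by (rule diff_diff_add[symmetric])
    have "x = solenoid_proj a + solenoid_proj v"
      unfolding y add solenoid_proj_eq_iff eq by (rule v(2))
    then show "x \<in> ?R" using v(1) by blast
  next
    fix x assume "x \<in> ?R"
    then obtain v where v: "v \<in> adelic_points (rational_annihilator ?W)" "x = solenoid_proj (a + v)"
      by (auto simp: add)
    have "adele_dot r (a + v - a) \<in> range adele_of_rat" if "r \<in> ?W" for r
    proof -
      have "adele_dot r v = 0"
        using that by (intro adelic_points_dot_zero[OF v(1)]) (simp add: rational_annihilator_def)
      then show ?thesis by (simp add: zero_in_range_adele_of_rat)
    qed
    then show "x \<in> closure ?O"
      unfolding O v(2) solenoid_in_closure_iff bex_simps
      by (intro allI impI polynomial_orbit_dense[OF one mult gen])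
  qed
qed

theorem theorem5p9:
  fixes G :: "(complex^'d^'d) set" and a :: "adele^'d" and x :: "'d solenoid"
  assumes "algebraic_subgroup_over_rat G"
    and "connectedin zariski G"
    and "rat_points G = generate GL (\<Union> (unipotent_one_parameter_subgroups G))"
    and "x = solenoid_proj a"
  shows "\<exists>V\<^sub>0 :: (rat^'d) set. vec.subspace V\<^sub>0 \<and>
    (\<forall>g\<in>rat_points G. \<forall>v\<in>V\<^sub>0. g *v v \<in> V\<^sub>0) \<and>
    closure ((\<lambda>g. rat_matrix_act g x) ` rat_points G) =
      (\<lambda>v. x + solenoid_proj v) ` adelic_points V\<^sub>0"
proof -
  let ?A = "rat_points G" and ?W = "orbit_relations (rat_points G) a"
  have G: "subgroup G GL" using assms(1) by (simp add: algebraic_subgroup_over_rat_def)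
  have one: "mat 1 \<in> ?A"
    unfolding assms(3) using generate.one[of GL] by (simp add: GL_def)
  have mult: "g ** h \<in> ?A" if "g \<in> ?A" "h \<in> ?A" for g h
    using generate.eng[of g GL _ h] that unfolding assms(3) by (simp add: GL_def)
  note gen = poly_family_generate[OF G assms(3)]
  have "g *v v \<in> rational_annihilator ?W" if g: "g \<in> ?A" and v: "v \<in> rational_annihilator ?W" for g v
    unfolding rational_annihilator_def
  proof (intro CollectI ballI)
    fix r assume "r \<in> ?W"
    \<comment> \<open>Since \<open>(r g) v = r (g v)\<close>, stability of the relations under right
      multiplication passes to their annihilator.\<close>
    then have "r v* g \<in> ?W" using g mult by (rule orbit_relations_invariant)
    then have "(\<Sum>j\<in>UNIV. (r v* g) $ j * v $ j) = 0" using v by (simp add: rational_annihilator_def)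
    moreover have "(\<Sum>j\<in>UNIV. (r v* g) $ j * v $ j) = (\<Sum>i\<in>UNIV. r $ i * (g *v v) $ i)"
      unfolding vector_matrix_mult_def matrix_vector_mult_def
      by (simp add: sum_distrib_left ac_simps) (rule sum.swap)
    ultimately show "(\<Sum>i\<in>UNIV. r $ i * (g *v v) $ i) = 0" by simp
  qed
  then show ?thesis
    unfolding assms(4)
    by (intro exI[of _ "rational_annihilator ?W"] conjI ballI subspace_rational_annihilator
        solenoid_orbit_closure[OF one mult gen])
qed

end
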